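(* Let $\gamma\ge1$, $\eta>0$, $T>0$, and let the MAC grid $\mathcal T=(\mathcal M,\mathcal E)$ of $\Omega$ and the time-step $\delta t=T/N$ be fixed. Let $(\varepsilon^{(k)})_{k\in\mathbb N}\subset(0,1]$ be a sequence of positive numbers converging to zero, let the initial data $(\rho_0^{(k)},\boldsymbol u_0^{(k)})$ be ill-prepared, i.e. $(\rho_0^{(k)},\boldsymbol u_0^{(k)})\in L^\infty(\Omega)^{1+d}$, $\rho_0^{(k)}>0$ and $$\|\boldsymbol u_0^{(k)}\|_{L^2(\Omega)^d}+\frac1{\varepsilon^{(k)}}\|\rho_0^{(k)}-1\|_{L^\infty(\Omega)}\le C$$ with $C>0$ independent of $k$, and let $(\rho^{(k)},\boldsymbol u^{(k)})_{k\in\mathbb N}$ be the corresponding sequence of numerical solutions (with positive densities) obtained from the semi-implicit scheme (described in the context) with $\varepsilon=\varepsilon^{(k)}$, satisfying the stability conditions (i)–(ii) of the context at every time-step. Let $\pi^{(k)}$ be given at time level $n$ by $\pi^{(k),n}=\dfrac{p(\rho^{(k),n})-m(p(\rho^{(k),n}))}{(\varepsilon^{(k)})^2}$, where $m(q)=\frac1{|\Omega|}\int_\Omega q\,d\boldsymbol x$. Then $(\rho^{(k)})_{k\in\mathbb N}$ converges to $1$ in $L^\infty(0,T;L^\gamma(\Omega))$, and $(\boldsymbol u^{(k)},\pi^{(k)})_{k\in\mathbb N}$ converges, in any discrete norm, to some $(\boldsymbol u,\pi)\in L^\infty(0,T;\boldsymbol H_{\mathcal E,0}(\Omega)\times L_{\mathcal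 M}(\Omega))$ as $k\to\infty$, where the sequence $(\boldsymbol u^n,\pi^n)$ of values of $(\boldsymbol u,\pi)$ at the time levels $t^n$ is defined as follows. Given $(\boldsymbol u^n,\pi^n)\in\boldsymbol H_{\mathcal E,0}(\Omega)\times L_{\mathcal M}(\Omega)$ at time $t^n$, $(\boldsymbol u^{n+1},\pi^{n+1})\in\boldsymbol H_{\mathcal E,0}(\Omega)\times L_{\mathcal M}(\Omega)$ is obtained as the solution of the following semi-implicit scheme: $$\big(\mathrm{div}_{\mathcal M}(\boldsymbol u^n-\delta\boldsymbol u(\pi^{n+1}))\big)_K=0,\quad\forall K\in\mathcal M,$$ $$\frac1{\delta t}(u_\sigma^{n+1}-u_\sigma^n)+\frac1{|D_\sigma|}\sum_{\epsilon\in\tilde{\mathcal E}(D_\sigma)}F_{\epsilon,\sigma}(1,\boldsymbol u^n-\delta\boldsymbol u(\pi^{n+1}))\,u^n_{\epsilon,\mathrm{up}}+(\partial^{(i)}_{\mathcal E}\pi^{n+1})_\sigma=0,\quad 1\le i\le d,\ \forall\sigma\in\mathcal E^{(i)}_{\mathrm{int}},$$ where $(\delta u(\pi^{n+1}))_\sigma=\eta\,\delta t\,(\partial^{(i)}_{\mathcal E}\pi^{n+1})_\sigma$ for $\sigma\in\mathcal E^{(i)}_{\mathrm{int}}$, $i=1,\dots,d$.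
   Context: Mesh. $\Omega\subset\mathbb R^d$ is open, bounded, connected, and its closure is a finite union of closed axis-parallel rectangles ($d=2$) or parallelepipeds ($d=3$). A MAC grid is a pair $\mathcal T=(\mathcal M,\mathcal E)$: $\mathcal M$ (primal mesh) is a structured, possibly non-uniform, partition of $\bar\Omega$ into closed axis-parallel rectangles/parallelepipeds $K$; $\mathcal E$ is the set of all ($(d-1)$-dimensional) edges of the cells; $\mathcal E(K)$ is the set of edges of $K$. $\mathcal E^{(i)}=\mathcal E^{(i)}_{\mathrm{int}}\cup\mathcal E^{(i)}_{\mathrm{ext}}$ are the (internal/external) edges orthogonal to the canonical basis vector $\boldsymbol e^{(i)}$; $\mathcal E_{\mathrm{int}}=\cup_i\mathcal E^{(i)}_{\mathrm{int}}$. $\sigma=K|L$ denotes the internal edge common to $K$ and $L$. $|\cdot|$ denotes Lebesgue measure of the appropriate dimension. $\boldsymbol\nu_{\sigma,K}$ is the unit normal to $\sigma$ outward to $K$. For $\sigma=K|L$, the dual cell is $D_\sigma=D_{\sigma,K}\cup D_{\sigma,L}$, where $D_{\sigma,K}$ is the half of $K$ adjacent to $\sigma$ ($|D_{\sigma,K}|=|K|/2$); for an external $\sigma\in\mathcal E(K)$, $D_\sigma=D_{\sigma,K}$. $\tilde{\mathcal E}(D_\sigma)$ is the set of edges of $D_\sigma$; for $\sigma,\sigma'\in\mathcal E^{(i)}$, $\epsilon=D_\sigma|D_{\sigma'}$ is the dual edge separating $D_\sigma$ and $D_{\sigma'}$. Spaces. $L_{\mathcal M}(\Omega)$: real functions constant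 on each $K\in\mathcal M$ (values $q_K$). $\boldsymbol H_{\mathcal E,0}(\Omega)=\prod_{i=1}^dH^{(i)}_{\mathcal E,0}(\Omega)$, where $H^{(i)}_{\mathcal E,0}(\Omega)$ is the set of functions constant on each $D_\sigma$, $\sigma\in\mathcal E^{(i)}$ (values $u_\sigma$), with $u_\sigma=0$ for external $\sigma$. For $q\in L_{\mathcal M}(\Omega)$ and $\sigma=K|L$: $|D_\sigma|q_{D_\sigma}=|D_{\sigma,K}|q_K+|D_{\sigma,L}|q_L$. A discrete norm is any norm on these finite-dimensional discrete function spaces. Operators. $(\partial^{(i)}_{\mathcal E}q)_\sigma=\frac{|\sigma|}{|D_\sigma|}(q_L-q_K)\,\boldsymbol e^{(i)}\cdot\boldsymbol\nu_{\sigma,K}$ for $\sigma=K|L\in\mathcal E^{(i)}_{\mathrm{int}}$, and $0$ on external edges. For $\boldsymbol w\in\boldsymbol H_{\mathcal E,0}(\Omega)$ and $\sigma\in\mathcal E^{(i)}\cap\mathcal E(K)$, $w_{\sigma,K}=w_\sigma\,\boldsymbol e^{(i)}\cdot\boldsymbol\nu_{\sigma,K}$, and $(\mathrm{div}_{\mathcal M}\boldsymbol w)_K=\frac1{|K|}\sum_{\sigma\in\mathcal E(K)}|\sigma|w_{\sigma,K}$. For real $a$, $a^\pm=\frac12(a\pm|a|)$ (so $a^-\le0$). The pressure is $p(\rho)=\rho^\gamma$ and $p^{n+1}_K=p(\rho^{n+1}_K)$. Stabilised velocity. $v^n_\sigma=u^n_\sigma-\delta u_\sigma(\rho^{n+1})$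 with $\delta u_\sigma(\rho^{n+1})=\frac{\eta\,\delta t}{\varepsilon^2}(\partial^{(i)}_{\mathcal E}p^{n+1})_\sigma$ for $\sigma\in\mathcal E^{(i)}_{\mathrm{int}}$, $v^n_\sigma=0$ for external $\sigma$. By convention the split parts of $v^n_{\sigma,K}$ are $(v^n_{\sigma,K})^+:=(u^n_{\sigma,K})^+-(\delta u_{\sigma,K}(\rho^{n+1}))^-\ge0$ and $(v^n_{\sigma,K})^-:=(u^n_{\sigma,K})^--(\delta u_{\sigma,K}(\rho^{n+1}))^+\le0$; in particular their sum is $v^n_{\sigma,K}$. Fluxes. For $\sigma=K|L$: $F_{\sigma,K}(\rho^{n+1},\boldsymbol v^n)=|\sigma|\{\rho^{n+1}_K(v^n_{\sigma,K})^++\rho^{n+1}_L(v^n_{\sigma,K})^-\}$, so that $F_{\sigma,K}(1,\boldsymbol w)=|\sigma|w_{\sigma,K}$; $F_{\sigma,K}=0$ for external $\sigma$. Dual fluxes $F_{\epsilon,\sigma}$, $\sigma=K|L\in\mathcal E^{(i)}_{\mathrm{int}}$, $\epsilon\in\tilde{\mathcal E}(D_\sigma)$: $F_{\epsilon,\sigma}=0$ if $\epsilon\subset\partial\Omega$; if $\epsilon$ is orthogonal to $\boldsymbol e^{(i)}$ and lies inside a cell $K$ whose two edges in $\mathcal E^{(i)}$ are $\sigma,\sigma'$, then $F_{\epsilon,\sigma}=\frac12(F_{\sigma',K}-F_{\sigma,K})$; if $\epsilon$ is parallel to $\boldsymbol e^{(i)}$, so that it is the union of a half of $\tau\in\mathcal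 E(K)$ and a half of $\tau'\in\mathcal E(L)$, then $F_{\epsilon,\sigma}=\frac12(F_{\tau,K}+F_{\tau',L})$. Upwind value: for $\epsilon=D_\sigma|D_{\sigma'}$, $u^n_{\epsilon,\mathrm{up}}=u^n_\sigma$ if the flux $F_{\epsilon,\sigma}$ multiplying it is $\ge0$ and $u^n_{\sigma'}$ otherwise. Scheme. With $t^n=n\,\delta t$, $N\delta t=T$, a numerical solution is a family $(\rho^n,\boldsymbol u^n)_{0\le n\le N}$ in $L_{\mathcal M}(\Omega)\times\boldsymbol H_{\mathcal E,0}(\Omega)$ such that, for $0\le n\le N-1$, $$\frac{1}{\delta t}(\rho_K^{n+1}-\rho_K^n)+\frac{1}{|K|}\sum_{\sigma\in\mathcal E(K)}F_{\sigma,K}(\rho^{n+1},\boldsymbol v^n)=0\quad\forall K\in\mathcal M,$$ $$\frac{1}{\delta t}(\rho_{D_\sigma}^{n+1}u_\sigma^{n+1}-\rho_{D_\sigma}^nu_\sigma^n)+\frac{1}{|D_\sigma|}\sum_{\epsilon\in\tilde{\mathcal E}(D_\sigma)}F_{\epsilon,\sigma}(\rho^{n+1},\boldsymbol v^n)u^n_{\epsilon,\mathrm{up}}+\frac{1}{\varepsilon^2}(\partial^{(i)}_{\mathcal E}p^{n+1})_\sigma=0\quad \forall\, 1\le i\le d,\ \forall\sigma\in\mathcal E^{(i)}_{\mathrm{int}},$$ with $\rho^0_K$ the mean of the initial density over $K$ and $u^0_\sigma$, $\sigma\in\mathcal E^{(i)}_{\mathrm{int}}$, the mean over $D_\sigma$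 of the $i$-th component of the initial velocity. Families indexed by the time level $n$ (such as $(\rho^n,\boldsymbol u^n)$ and $\pi^n$) are identified with the functions of $(t,\boldsymbol x)$ equal to their $n$-th member for $t\in[t^n,t^{n+1})$. Stability conditions: for all $0\le n\le N-1$, $1\le i\le d$, $\sigma\in\mathcal E^{(i)}_{\mathrm{int}}$: (i) $\eta\ge1/\rho^{n+1}_{D_\sigma}$; (ii) $\frac{\delta t}{|D_\sigma|}\sum_{\epsilon\in\tilde{\mathcal E}(D_\sigma)}\frac{-(F_{\epsilon,\sigma}(\rho^{n+1},\boldsymbol v^n))^-}{\rho^{n+1}_{D_\sigma}}\le\frac12$.
   Formalization: As bounded initial velocities need not converge, (u,π) is shown to converge along a subsequence, and for the whole sequence if the discrete initial velocities converge; π converges only at time levels 1 to N, since π at level 0 may blow up like 1/ε. *)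

theory Defs
  imports "HOL-Probability.Essential_Supremum"
begin

section \<open>Norms\<close>

definition Lp_norm :: "'a measure \<Rightarrow> real \<Rightarrow> ('a \<Rightarrow> real) \<Rightarrow> real" where
  "Lp_norm \<mu> p f = (\<integral>x. \<bar>f x\<bar> powr p \<partial>\<mu>) powr (1 / p)"

definition Linf_norm :: "'a measure \<Rightarrow> ('a \<Rightarrow> real) \<Rightarrow> ereal" where
  "Linf_norm \<mu> f = esssup \<mu> (\<lambda>x. ereal \<bar>f x\<bar>)"

definition in_Linf :: "'a measure \<Rightarrow> ('a \<Rightarrow> real) \<Rightarrow> bool" where
  "in_Linf \<mu> f \<longleftrightarrow> f \<in> borel_measurable \<mu> \<and> Linf_norm \<mu> f < \<infinity>"

text \<open>\<open>nrm\<close> is a norm on the linear subspace \<open>V\<close> of a function space; its values off \<open>V\<close> are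
  irrelevant.\<close>

definition norm_on :: "('a \<Rightarrow> real) set \<Rightarrow> (('a \<Rightarrow> real) \<Rightarrow> real) \<Rightarrow> bool" where
  "norm_on V nrm \<longleftrightarrow>
     (\<forall>f\<in>V. 0 \<le> nrm f \<and> (nrm f = 0 \<longleftrightarrow> (\<forall>x. f x = 0))) \<and>
     (\<forall>f\<in>V. \<forall>c. nrm (\<lambda>x. c * f x) = \<bar>c\<bar> * nrm f) \<and>
     (\<forall>f\<in>V. \<forall>g\<in>V. nrm (\<lambda>x. f x + g x) \<le> nrm f + nrm g)"

definition pos_part :: "real \<Rightarrow> real" where
  "pos_part a = (a + \<bar>a\<bar>) / 2"

text \<open>The negative part is nonpositive in this convention.\<close>

definition neg_part :: "real \<Rightarrow> real" where
  "neg_part a = (a - \<bar>a\<bar>) / 2"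


section \<open>Boxes and their facets\<close>

definition lo :: "(real^'d) set \<Rightarrow> 'd \<Rightarrow> real" where
  "lo K i = interval_lowerbound K $ i"

definition hi :: "(real^'d) set \<Rightarrow> 'd \<Rightarrow> real" where
  "hi K i = interval_upperbound K $ i"

text \<open>The facet of a box \<open>K\<close> orthogonal to the \<open>i\<close>-th basis vector, on the upper side if \<open>s\<close>
  and on the lower side otherwise. The \<open>2d\<close> edges of a box are enumerated by the pairs \<open>(i, s)\<close>.\<close>

definition face :: "(real^'d) set \<Rightarrow> 'd \<Rightarrow> bool \<Rightarrow> (real^'d) set" where
  "face K i s = {x \<in> K. x $ i = (if s then hi K i else lo K i)}"

text \<open>The \<open>(d-1)\<close>-dimensional measure of a box that is flat in direction \<open>i\<close>.\<close>

definition area :: "'d::finite \<Rightarrow> (real^'d) set \<Rightarrow> real" where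
  "area i \<sigma> = (\<Prod>j\<in>UNIV - {i}. hi \<sigma> j - lo \<sigma> j)"

text \<open>The unit normal to \<open>\<sigma>\<close> outward to \<open>K\<close>, for an edge \<open>\<sigma>\<close> of \<open>K\<close>.\<close>

definition normal :: "(real^'d) set \<Rightarrow> (real^'d) set \<Rightarrow> real^'d" where
  "normal \<sigma> K = (\<chi> i. if \<sigma> = face K i True then 1 else if \<sigma> = face K i False then - 1 else 0)"

text \<open>The half of \<open>K\<close> adjacent to its edge \<open>\<sigma>\<close>.\<close>

definition half_cell :: "(real^'d) set \<Rightarrow> (real^'d) set \<Rightarrow> (real^'d) set" where
  "half_cell \<sigma> K = {x \<in> K. \<exists>i.
      \<sigma> = face K i True \<and> (lo K i + hi K i) / 2 \<le> x $ i \<or>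
      \<sigma> = face K i False \<and> x $ i \<le> (lo K i + hi K i) / 2}"


section \<open>MAC grids\<close>

text \<open>
  Discrete functions are represented by their values: scalars by \<open>q K\<close> for the cells \<open>K\<close>,
  vectors by \<open>u (i, \<sigma>)\<close> for the edges \<open>\<sigma>\<close> orthogonal to the \<open>i\<close>-th basis vector.

  The assumption \<open>structured\<close> says that the mesh is carried by a (possibly non-uniform) Cartesian
  grid: \<open>X i\<close> is the set of grid coordinates in direction \<open>i\<close>, and the endpoints of each cell in
  that direction are consecutive elements of \<open>X i\<close>.
\<close>

locale mac_grid =
  fixes \<Omega> :: "(real^'d) set" and M :: "(real^'d) set set"
  assumes dim: "CARD('d) \<in> {2, 3}"
    and domain: "open \<Omega>" "bounded \<Omega>" "connected \<Omega>" "\<Omega> \<noteq> {}"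
    and finite_mesh: "finite M"
    and cells_boxes: "K \<in> M \<Longrightarrow> \<exists>a b. (\<forall>i. a $ i < b $ i) \<and> K = cbox a b"
    and cells_cover: "\<Union>M = closure \<Omega>"
    and cells_disjoint: "K \<in> M \<Longrightarrow> L \<in> M \<Longrightarrow> K \<noteq> L \<Longrightarrow> interior K \<inter> interior L = {}"
    and structured: "\<exists>X :: 'd \<Rightarrow> real set. \<forall>K\<in>M. \<forall>i. X i \<inter> {lo K i..hi K i} = {lo K i, hi K i}"
begin

definition edges :: "'d \<Rightarrow> (real^'d) set set" where
  "edges i = {face K i s | K s. K \<in> M}"

definition int_edges :: "'d \<Rightarrow> (real^'d) set set" where
  "int_edges i = {\<sigma> \<in> edges i. \<not> \<sigma> \<subseteq> frontier \<Omega>}"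

text \<open>The cell lying on the upper (\<open>s\<close>) or lower (\<open>\<not> s\<close>) side of an edge orthogonal to the
  \<open>i\<close>-th basis vector. An internal \<open>\<sigma> = K|L\<close> has exactly one cell on each side.\<close>

definition side_cell :: "'d \<Rightarrow> (real^'d) set \<Rightarrow> bool \<Rightarrow> (real^'d) set" where
  "side_cell i \<sigma> s = (THE K. K \<in> M \<and> \<sigma> = face K i (\<not> s))"

text \<open>The cell \<open>L\<close> such that \<open>\<sigma> = K|L\<close>.\<close>

definition other_cell :: "'d \<Rightarrow> (real^'d) set \<Rightarrow> (real^'d) set \<Rightarrow> (real^'d) set" where
  "other_cell i \<sigma> K = (THE L. L \<in> M \<and> L \<noteq> K \<and> (\<exists>s. \<sigma> = face L i s))"

definition dual_cell :: "'d \<Rightarrow> (real^'d) set \<Rightarrow> (real^'d) set" where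
  "dual_cell i \<sigma> = (\<Union>K\<in>{K \<in> M. \<exists>s. \<sigma> = face K i s}. half_cell \<sigma> K)"

abbreviation dual_vol :: "'d \<Rightarrow> (real^'d) set \<Rightarrow> real" where
  "dual_vol i \<sigma> \<equiv> measure lebesgue (dual_cell i \<sigma>)"

text \<open>The edges of the dual cell of \<open>\<sigma>\<close> are likewise enumerated by pairs \<open>(j, s)\<close>.\<close>

definition dual_edge :: "'d \<Rightarrow> (real^'d) set \<Rightarrow> 'd \<Rightarrow> bool \<Rightarrow> (real^'d) set" where
  "dual_edge i \<sigma> j s = face (dual_cell i \<sigma>) j s"

text \<open>The edge \<open>\<sigma>'\<close> such that the dual edge \<open>\<epsilon>\<close> of \<open>\<sigma>\<close> separates the dual cells of \<open>\<sigma>\<close> and \<open>\<sigma>'\<close>.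
  At a reentrant corner of the domain the dual cell of \<open>\<sigma>'\<close> may touch only half of \<open>\<epsilon>\<close>.\<close>

definition dual_neighbour :: "'d \<Rightarrow> (real^'d) set \<Rightarrow> (real^'d) set \<Rightarrow> (real^'d) set" where
  "dual_neighbour i \<sigma> \<epsilon> =
     (THE \<sigma>'. \<sigma>' \<in> edges i \<and> \<sigma>' \<noteq> \<sigma> \<and> rel_interior \<epsilon> \<inter> dual_cell i \<sigma>' \<noteq> {})"


subsection \<open>Discrete spaces and operators\<close>

definition L_M :: "((real^'d) set \<Rightarrow> real) set" where
  "L_M = {q. \<forall>K. K \<notin> M \<longrightarrow> q K = 0}"

definition H_E0 :: "('d \<times> (real^'d) set \<Rightarrow> real) set" where
  "H_E0 = {u. \<forall>i \<sigma>. \<sigma> \<notin> int_edges i \<longrightarrow> u (i, \<sigma>) = 0}"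

text \<open>The piecewise constant function with values \<open>q K\<close> (up to the null set of cell boundaries).\<close>

definition cell_fun :: "((real^'d) set \<Rightarrow> real) \<Rightarrow> real^'d \<Rightarrow> real" where
  "cell_fun q x = (\<Sum>K\<in>M. q K * indicator (interior K) x)"

text \<open>Data are given on \<open>\<Omega>\<close> only, while cells and dual cells may contain points of its frontier.\<close>

definition mean_over :: "(real^'d) set \<Rightarrow> (real^'d \<Rightarrow> real) \<Rightarrow> real" where
  "mean_over S f = (\<integral>x. f x \<partial>lebesgue_on (S \<inter> \<Omega>)) / measure lebesgue (S \<inter> \<Omega>)"

definition dual_value :: "((real^'d) set \<Rightarrow> real) \<Rightarrow> 'd \<Rightarrow> (real^'d) set \<Rightarrow> real" where
  "dual_value q i \<sigma> =
     (let K = side_cell i \<sigma> False; L = side_cell i \<sigma> True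
      in (measure lebesgue (half_cell \<sigma> K) * q K + measure lebesgue (half_cell \<sigma> L) * q L)
          / dual_vol i \<sigma>)"

text \<open>The formula is invariant under exchange of \<open>K\<close> and \<open>L\<close>.\<close>

definition grad :: "((real^'d) set \<Rightarrow> real) \<Rightarrow> 'd \<times> (real^'d) set \<Rightarrow> real" where
  "grad q = (\<lambda>(i, \<sigma>).
     if \<sigma> \<in> int_edges i then
       let K = side_cell i \<sigma> False; L = side_cell i \<sigma> True
       in area i \<sigma> / dual_vol i \<sigma> * (q L - q K) * (axis i 1 \<bullet> normal \<sigma> K)
     else 0)"

text \<open>The outward normal velocity \<open>w\<^bsub>\<sigma>,K\<^esub>\<close>.\<close>

definition outward :: "('d \<times> (real^'d) set \<Rightarrow> real) \<Rightarrow> 'd \<Rightarrow> (real^'d) set \<Rightarrow> (real^'d) set \<Rightarrow> real"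
  where "outward w i \<sigma> K = w (i, \<sigma>) * (axis i 1 \<bullet> normal \<sigma> K)"

definition div_M :: "('d \<times> (real^'d) set \<Rightarrow> real) \<Rightarrow> (real^'d) set \<Rightarrow> real" where
  "div_M w K = (\<Sum>i\<in>UNIV. \<Sum>s\<in>UNIV. area i (face K i s) * outward w i (face K i s) K)
                / measure lebesgue K"


subsection \<open>Fluxes\<close>

text \<open>The flux \<open>F\<^bsub>\<sigma>,K\<^esub>(\<rho>, u - \<delta>u)\<close>. The upwinding splits \<open>u - \<delta>u\<close> into
  \<open>(u\<^bsub>\<sigma>,K\<^esub>)\<^sup>+ - (\<delta>u\<^bsub>\<sigma>,K\<^esub>)\<^sup>- \<ge> 0\<close> and \<open>(u\<^bsub>\<sigma>,K\<^esub>)\<^sup>- - (\<delta>u\<^bsub>\<sigma>,K\<^esub>)\<^sup>+ \<le> 0\<close>, hence depends on \<open>u\<close> and \<open>\<delta>u\<close>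
  separately; for \<open>\<rho> = 1\<close> only the sum of the two parts, \<open>u - \<delta>u\<close>, matters.\<close>

definition flux :: "((real^'d) set \<Rightarrow> real) \<Rightarrow> ('d \<times> (real^'d) set \<Rightarrow> real)
    \<Rightarrow> ('d \<times> (real^'d) set \<Rightarrow> real) \<Rightarrow> 'd \<Rightarrow> (real^'d) set \<Rightarrow> (real^'d) set \<Rightarrow> real" where
  "flux \<rho> u \<delta>u i \<sigma> K =
     (if \<sigma> \<in> int_edges i then
        area i \<sigma> *
          (\<rho> K * (pos_part (outward u i \<sigma> K) - neg_part (outward \<delta>u i \<sigma> K)) +
           \<rho> (other_cell i \<sigma> K) * (neg_part (outward u i \<sigma> K) - pos_part (outward \<delta>u i \<sigma> K)))
      else 0)"

text \<open>The dual flux through the dual edge \<open>(j, s)\<close> of an internal edge \<open>\<sigma>\<close> orthogonal to direction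
  \<open>i\<close>, built from primal fluxes \<open>F\<close>. For \<open>j = i\<close> the dual edge lies inside the cell on side \<open>s\<close> of
  \<open>\<sigma>\<close>, whose other edge in direction \<open>i\<close> is \<open>face K i s\<close>.\<close>

definition dual_flux :: "('d \<Rightarrow> (real^'d) set \<Rightarrow> (real^'d) set \<Rightarrow> real)
    \<Rightarrow> 'd \<Rightarrow> (real^'d) set \<Rightarrow> 'd \<Rightarrow> bool \<Rightarrow> real" where
  "dual_flux F i \<sigma> j s =
     (if dual_edge i \<sigma> j s \<subseteq> frontier \<Omega> then 0
      else if j = i then
        let K = side_cell i \<sigma> s in (F i (face K i s) K - F i \<sigma> K) / 2
      else
        let K = side_cell i \<sigma> False; L = side_cell i \<sigma> True
        in (F j (face K j s) K + F j (face L j s) L) / 2)"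

definition upwind_value :: "real \<Rightarrow> ('d \<times> (real^'d) set \<Rightarrow> real)
    \<Rightarrow> 'd \<Rightarrow> (real^'d) set \<Rightarrow> (real^'d) set \<Rightarrow> real" where
  "upwind_value f u i \<sigma> \<epsilon> = (if 0 \<le> f then u (i, \<sigma>) else u (i, dual_neighbour i \<sigma> \<epsilon>))"

definition convection :: "('d \<Rightarrow> (real^'d) set \<Rightarrow> (real^'d) set \<Rightarrow> real)
    \<Rightarrow> ('d \<times> (real^'d) set \<Rightarrow> real) \<Rightarrow> 'd \<Rightarrow> (real^'d) set \<Rightarrow> real" where
  "convection F u i \<sigma> =
     (\<Sum>j\<in>UNIV. \<Sum>s\<in>UNIV.
        dual_flux F i \<sigma> j s * upwind_value (dual_flux F i \<sigma> j s) u i \<sigma> (dual_edge i \<sigma> j s))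
     / dual_vol i \<sigma>"


subsection \<open>The scheme and its limit\<close>

definition pressure :: "real \<Rightarrow> ((real^'d) set \<Rightarrow> real) \<Rightarrow> (real^'d) set \<Rightarrow> real" where
  "pressure \<gamma> \<rho> K = \<rho> K powr \<gamma>"

definition vel_corr :: "real \<Rightarrow> real \<Rightarrow> real \<Rightarrow> real \<Rightarrow> ((real^'d) set \<Rightarrow> real)
    \<Rightarrow> 'd \<times> (real^'d) set \<Rightarrow> real" where
  "vel_corr \<gamma> \<eta> \<epsilon> \<delta>t \<rho> e = \<eta> * \<delta>t / \<epsilon>\<^sup>2 * grad (pressure \<gamma> \<rho>) e"

definition numerical_solution :: "real \<Rightarrow> real \<Rightarrow> real \<Rightarrow> real \<Rightarrow> nat
    \<Rightarrow> (real^'d \<Rightarrow> real) \<Rightarrow> (real^'d \<Rightarrow> real^'d)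
    \<Rightarrow> (nat \<Rightarrow> (real^'d) set \<Rightarrow> real) \<Rightarrow> (nat \<Rightarrow> 'd \<times> (real^'d) set \<Rightarrow> real) \<Rightarrow> bool" where
  "numerical_solution \<gamma> \<eta> \<epsilon> \<delta>t N \<rho>0 u0 \<rho> u \<longleftrightarrow>
     (\<forall>n\<le>N. \<rho> n \<in> L_M \<and> u n \<in> H_E0) \<and>
     (\<forall>K\<in>M. \<rho> 0 K = mean_over K \<rho>0) \<and>
     (\<forall>i. \<forall>\<sigma>\<in>int_edges i. u 0 (i, \<sigma>) = mean_over (dual_cell i \<sigma>) (\<lambda>x. u0 x $ i)) \<and>
     (\<forall>n<N.
        let F = flux (\<rho> (Suc n)) (u n) (vel_corr \<gamma> \<eta> \<epsilon> \<delta>t (\<rho> (Suc n)))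
        in (\<forall>K\<in>M. (\<rho> (Suc n) K - \<rho> n K) / \<delta>t
               + (\<Sum>i\<in>UNIV. \<Sum>s\<in>UNIV. F i (face K i s) K) / measure lebesgue K = 0) \<and>
           (\<forall>i. \<forall>\<sigma>\<in>int_edges i.
               (dual_value (\<rho> (Suc n)) i \<sigma> * u (Suc n) (i, \<sigma>)
                  - dual_value (\<rho> n) i \<sigma> * u n (i, \<sigma>)) / \<delta>t
               + convection F (u n) i \<sigma>
               + grad (pressure \<gamma> (\<rho> (Suc n))) (i, \<sigma>) / \<epsilon>\<^sup>2 = 0))"

definition stability_conditions :: "real \<Rightarrow> real \<Rightarrow> real \<Rightarrow> real \<Rightarrow> nat
    \<Rightarrow> (nat \<Rightarrow> (real^'d) set \<Rightarrow> real) \<Rightarrow> (nat \<Rightarrow> 'd \<times> (real^'d) set \<Rightarrow> real) \<Rightarrow> bool" where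
  "stability_conditions \<gamma> \<eta> \<epsilon> \<delta>t N \<rho> u \<longleftrightarrow>
     (\<forall>n<N. \<forall>i. \<forall>\<sigma>\<in>int_edges i.
        let F = flux (\<rho> (Suc n)) (u n) (vel_corr \<gamma> \<eta> \<epsilon> \<delta>t (\<rho> (Suc n)))
        in \<eta> \<ge> 1 / dual_value (\<rho> (Suc n)) i \<sigma> \<and>
           \<delta>t / dual_vol i \<sigma> *
             (\<Sum>j\<in>UNIV. \<Sum>s\<in>UNIV. - neg_part (dual_flux F i \<sigma> j s) / dual_value (\<rho> (Suc n)) i \<sigma>)
             \<le> 1 / 2)"

text \<open>The rescaled fluctuation of the pressure about its mean over \<open>\<Omega>\<close>.\<close>

definition pressure_fluct :: "real \<Rightarrow> real \<Rightarrow> ((real^'d) set \<Rightarrow> real) \<Rightarrow> (real^'d) set \<Rightarrow> real" where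
  "pressure_fluct \<gamma> \<epsilon> \<rho> K =
     (if K \<in> M
      then (pressure \<gamma> \<rho> K
             - (\<integral>x. cell_fun (pressure \<gamma> \<rho>) x \<partial>lebesgue_on \<Omega>) / measure lebesgue \<Omega>) / \<epsilon>\<^sup>2
      else 0)"

text \<open>No equation involves \<open>\<pi> 0\<close>: a solution is determined by \<open>u 0\<close>, up to additive constants in
  \<open>\<pi> n\<close>, \<open>n \<ge> 1\<close>.\<close>

definition limit_solution :: "real \<Rightarrow> real \<Rightarrow> nat
    \<Rightarrow> (nat \<Rightarrow> 'd \<times> (real^'d) set \<Rightarrow> real) \<Rightarrow> (nat \<Rightarrow> (real^'d) set \<Rightarrow> real) \<Rightarrow> bool" where
  "limit_solution \<eta> \<delta>t N u \<pi> \<longleftrightarrow>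
     (\<forall>n\<le>N. u n \<in> H_E0 \<and> \<pi> n \<in> L_M) \<and>
     (\<forall>n<N.
        let \<delta>u = (\<lambda>e. \<eta> * \<delta>t * grad (\<pi> (Suc n)) e)
        in (\<forall>K\<in>M. div_M (\<lambda>e. u n e - \<delta>u e) K = 0) \<and>
           (\<forall>i. \<forall>\<sigma>\<in>int_edges i.
               (u (Suc n) (i, \<sigma>) - u n (i, \<sigma>)) / \<delta>t
               + convection (flux (\<lambda>_. 1) (u n) \<delta>u) (u n) i \<sigma>
               + grad (\<pi> (Suc n)) (i, \<sigma>) = 0))"


subsection \<open>Convergence\<close>

text \<open>The norm in \<open>L\<^sup>\<infinity>(0,T; L\<^sup>p(\<Omega>))\<close> of \<open>q - c\<close>, where the family \<open>q\<close> is identified with the function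
  equal to \<open>cell_fun (q n)\<close> for \<open>t \<in> [n \<delta>t, (n+1) \<delta>t)\<close>.\<close>

definition Linf_Lp_dist :: "real \<Rightarrow> real \<Rightarrow> real \<Rightarrow> (nat \<Rightarrow> (real^'d) set \<Rightarrow> real) \<Rightarrow> real \<Rightarrow> ereal" where
  "Linf_Lp_dist T \<delta>t p q c =
     Linf_norm (lebesgue_on {0<..<T})
       (\<lambda>t. Lp_norm (lebesgue_on \<Omega>) p (\<lambda>x. cell_fun (q (nat \<lfloor>t / \<delta>t\<rfloor>)) x - c))"

text \<open>Convergence in any discrete norm, uniformly over the (finitely many) time levels. The
  velocities converge at all levels \<open>0..N\<close>. The level \<open>0\<close> is excluded for \<open>\<pi>\<close>: for ill-prepared data
  \<open>\<pi>\<^sup>0\<close> is of order \<open>1/\<epsilon>\<close> in general, and it does not enter the limit scheme.\<close>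

definition discrete_convergence :: "nat
    \<Rightarrow> (nat \<Rightarrow> nat \<Rightarrow> 'd \<times> (real^'d) set \<Rightarrow> real) \<Rightarrow> (nat \<Rightarrow> nat \<Rightarrow> (real^'d) set \<Rightarrow> real)
    \<Rightarrow> (nat \<Rightarrow> 'd \<times> (real^'d) set \<Rightarrow> real) \<Rightarrow> (nat \<Rightarrow> (real^'d) set \<Rightarrow> real) \<Rightarrow> bool" where
  "discrete_convergence N uk \<pi>k u \<pi> \<longleftrightarrow>
     (\<forall>nrm. norm_on H_E0 nrm \<longrightarrow>
        (\<forall>n\<in>{0..N}. (\<lambda>k. nrm (\<lambda>e. uk k n e - u n e)) \<longlonglongrightarrow> 0)) \<and>
     (\<forall>nrm. norm_on L_M nrm \<longrightarrow>
        (\<forall>n\<in>{1..N}. (\<lambda>k. nrm (\<lambda>K. \<pi>k k n K - \<pi> n K)) \<longlonglongrightarrow> 0))"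

end

end

theory Submission
  imports Defs
begin

text \<open>
  Fix a time step at which the densities \<open>\<rho>\<^sup>n\<close> tend to 1 and the velocities \<open>u\<^sup>n\<close> converge. Summing the mass
  balance over a superlevel set of the pressure \<open>p\<^sup>n\<^sup>+\<^sup>1\<close> shows that the correction flux through its
  boundary is bounded; as stability condition (i) forces \<open>\<eta> \<rho>\<^sup>n\<^sup>+\<^sup>1 \<ge> 1\<close> on the side of larger pressure,
  all pressure jumps are of order \<open>\<epsilon>\<^sup>2\<close>. The mesh being connected and mass being conserved, \<open>\<rho>\<^sup>n\<^sup>+\<^sup>1\<close>
  tends to 1 and \<open>\<pi>\<^sup>n\<^sup>+\<^sup>1\<close> stays bounded. In the limit the mass balance turns into a discrete Poisson
  equation for \<open>\<pi>\<^sup>n\<^sup>+\<^sup>1\<close>, whose solution of mean zero depends continuously on the data, by the same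
  superlevel argument. So \<open>\<pi>\<^sup>n\<^sup>+\<^sup>1\<close> converges, and the momentum balance gives the convergence of
  \<open>u\<^sup>n\<^sup>+\<^sup>1\<close>. No energy estimate is needed as the mesh is fixed. For ill-prepared data only a
  subsequence of the initial velocities need converge; this is enough for the densities, whose limit
  does not depend on the subsequence.
\<close>

section \<open>Geometry of the mesh\<close>

text \<open>At a face where the pressure drops outward, the splitting of the mass flux weights the
  velocity correction by the density of the cell with the larger pressure, precisely the one that
  condition (i) bounds from below; the other density only meets the bounded velocity. Beyond that
  only an upper bound of the densities is needed, and conservation of mass with positivity supplies
  it before anything is known about the pressure. Across the boundary of a superlevel set all fluxes
  are nonnegative up to a bounded error, so a bound of their sum bounds each of them.

  Jump bounds control differences only. The missing additive constant comes from the conserved mass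
  for \<open>\<rho>\<close> and from the zero mean for \<open>\<pi>\<close>.

  The geometric obstacle is connectedness: that of the domain is topological, while pressures are
  compared only across internal faces, and two cells may meet in a corner. Paths that change one
  coordinate at a time between generic points avoid corners.\<close>

context mac_grid
begin

section \<open>Cells and their faces as boxes\<close>

lemma cell_box:
  assumes "K \<in> M"
  shows "K = cbox (\<chi> i. lo K i) (\<chi> i. hi K i)" and "lo K i < hi K i"
proof -
  obtain a b where ab: "\<And>i. a $ i < b $ i" "K = cbox a b"
    using cells_boxes[OF assms] by blast
  have le: "\<forall>i\<in>Basis. a \<bullet> i \<le> b \<bullet> i"
    using ab(1) by (auto simp: Basis_vec_def inner_axis intro: less_imp_le)
  have "lo K = ($) a" "hi K = ($) b"
    by (auto simp: lo_def hi_def ab(2) interval_lowerbound[OF le] interval_upperbound[OF le] fun_eq_iff)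
  then show "K = cbox (\<chi> i. lo K i) (\<chi> i. hi K i)" "lo K i < hi K i"
    using ab by (auto simp: vec_lambda_eta)
qed

lemma lo_hi_cbox:
  fixes a b :: "'d \<Rightarrow> real"
  assumes "\<And>i. a i \<le> b i"
  shows "lo (cbox (\<chi> i. a i) (\<chi> i. b i)) j = a j" "hi (cbox (\<chi> i. a i) (\<chi> i. b i)) j = b j"
proof -
  have "\<forall>i\<in>Basis. (\<chi> i. a i) \<bullet> i \<le> (\<chi> i. b i) \<bullet> i"
    using assms by (auto simp: Basis_vec_def inner_axis)
  then show "lo (cbox (\<chi> i. a i) (\<chi> i. b i)) j = a j" "hi (cbox (\<chi> i. a i) (\<chi> i. b i)) j = b j"
    by (simp_all add: lo_def hi_def interval_lowerbound interval_upperbound)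
qed

lemma mem_cell: "K \<in> M \<Longrightarrow> x \<in> K \<longleftrightarrow> (\<forall>i. lo K i \<le> x $ i \<and> x $ i \<le> hi K i)"
  by (subst cell_box(1)) (auto simp: mem_box_cart)

lemma mem_interior_cell:
  "K \<in> M \<Longrightarrow> x \<in> interior K \<longleftrightarrow> (\<forall>i. lo K i < x $ i \<and> x $ i < hi K i)"
  by (subst cell_box(1)) (auto simp: mem_box_cart)

lemma closed_cell: "K \<in> M \<Longrightarrow> closed K"
  by (subst cell_box(1)) auto

lemma closure_interior_cell: assumes "K \<in> M" shows "closure (interior K) = K"
proof -
  have "K = closure (interior K)" if "K = cbox a b" "interior K \<noteq> {}" for a b
    using that by auto
  moreover have "(\<chi> i. (lo K i + hi K i) / 2) \<in> interior K"
    using cell_box(2)[OF assms] assms by (auto simp: mem_interior_cell field_simps)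
  ultimately show ?thesis
    using cell_box(1)[OF assms] by (metis empty_iff)
qed

lemma cell_eqI: "K \<in> M \<Longrightarrow> L \<in> M \<Longrightarrow> x \<in> interior K \<Longrightarrow> x \<in> interior L \<Longrightarrow> K = L"
  using cells_disjoint by blast

lemma face_eq_cbox:
  assumes "K \<in> M"
  shows "face K i s = cbox (\<chi> j. if j = i \<and> s then hi K j else lo K j)
                           (\<chi> j. if j = i \<and> \<not> s then lo K j else hi K j)"
  using cell_box(2)[OF assms]
  by (auto simp: face_def mem_cell[OF assms] mem_box_cart split: if_splits)
     (metis less_imp_le order.antisym order_refl)+

lemma lo_face:
  assumes "K \<in> M"
  shows "lo (face K i s) j = (if j = i \<and> s then hi K j else lo K j)"
  and "hi (face K i s) j = (if j = i \<and> \<not> s then lo K j else hi K j)"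
  by (simp_all add: face_eq_cbox[OF assms] lo_hi_cbox less_imp_le cell_box(2)[OF assms])

lemma area_face_pos: assumes "K \<in> M" shows "0 < area i (face K i s)"
  unfolding area_def by (rule prod_pos) (auto simp: lo_face assms cell_box(2))

lemma face_inj:
  assumes "K \<in> M" "L \<in> M" "face K i s = face L j t"
  shows "i = j"
proof (rule ccontr)
  assume "i \<noteq> j"
  have "lo (face K i s) i = hi (face K i s) i" using assms(1) by (simp add: lo_face)
  then have "lo L i = hi L i" using assms \<open>i \<noteq> j\<close> by (simp add: lo_face)
  then show False using cell_box(2)[OF assms(2), of i] by simp
qed

lemma face_side_inj:
  assumes "K \<in> M" "face K i s = face K i t" shows "s = t"
proof -
  have "lo (face K i s) i = lo (face K i t) i" using assms(2) by simp
  then show ?thesis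
    using assms(1) cell_box(2)[OF assms(1), of i] by (auto simp: lo_face split: if_splits)
qed

text \<open>Two cells lying on the same side of a common face share a thin layer along it, so their
  interiors overlap.\<close>

lemma cell_eq_if_same_side:
  assumes "K \<in> M" "L \<in> M" "face K i s = face L i s" shows "K = L"
proof -
  have *: "lo (face K i s) j = lo (face L i s) j" "hi (face K i s) j = hi (face L i s) j" for j
    using assms(3) by auto
  have eq: "lo K j = lo L j" "hi K j = hi L j" if "j \<noteq> i" for j
    using *[of j] that by (auto simp: lo_face[OF assms(1)] lo_face[OF assms(2)])
  have ii: "if s then hi K i = hi L i else lo K i = lo L i"
    using *[of i] by (auto simp: lo_face[OF assms(1)] lo_face[OF assms(2)])
  \<comment> \<open>Midway between the common face and the nearer of the two opposite faces; centred
    in the other directions.\<close>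
  define x where "x = (\<chi> j. if j = i then (if s then (max (lo K i) (lo L i) + hi K i) / 2
     else (min (hi K i) (hi L i) + lo K i) / 2) else (lo K j + hi K j) / 2)"
  have c1: "lo K j < hi K j" and c2: "lo L j < hi L j" for j
    using cell_box(2) assms by blast+
  have "x \<in> interior K" "x \<in> interior L"
    unfolding mem_interior_cell[OF assms(1)] mem_interior_cell[OF assms(2)]
  proof (safe)
    fix j
    show "lo K j < x $ j" "x $ j < hi K j" "lo L j < x $ j" "x $ j < hi L j"
      using ii c1[of i] c2[of i] c1[of j] c2[of j] eq[of j]
      by (cases "j = i"; cases s; auto simp: x_def max_def min_def)+
  qed
  then show ?thesis using cell_eqI assms by blast
qed

text \<open>The mesh structure enters here: all ends of \<open>K\<close> and \<open>L\<close> are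
  grid coordinates, and none lies strictly inside the interval of a cell, so an interval that
  reaches inside another one coincides with it. This excludes hanging nodes.\<close>

lemma interval_eq:
  assumes "K \<in> M" "L \<in> M" "lo K j < t" "t < hi K j" "lo L j \<le> t" "t \<le> hi L j"
  shows "lo L j = lo K j" "hi L j = hi K j"
proof -
  obtain X where X: "\<And>K i. K \<in> M \<Longrightarrow> X i \<inter> {lo K i..hi K i} = {lo K i, hi K i}"
    using structured by metis
  have 1: "lo K j \<in> X j" "hi K j \<in> X j" "lo L j \<in> X j" "hi L j \<in> X j"
    using X[of K j] X[of L j] assms by blast+
  have 2: "y \<in> X j \<Longrightarrow> lo K j \<le> y \<Longrightarrow> y \<le> hi K j \<Longrightarrow> y = lo K j \<or> y = hi K j"
    "y \<in> X j \<Longrightarrow> lo L j \<le> y \<Longrightarrow> y \<le> hi L j \<Longrightarrow> y = lo L j \<or> y = hi L j" for y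
    using X[of K j] X[of L j] assms by auto
  show "lo L j = lo K j" "hi L j = hi K j"
    using 2(1)[of "lo L j"] 2(1)[of "hi L j"] 2(2)[of "lo K j"] 2(2)[of "hi K j"] 1 assms
    by linarith+
qed

text \<open>Away from direction \<open>i\<close> the point is strictly inside \<open>K\<close>, so
  \<open>interval_eq\<close> gives \<open>L\<close> the same extent there. In direction
  \<open>i\<close> it is interior to neither cell, since equal extents would force
  \<open>K = L\<close>; so an end of \<open>K\<close> is the opposite end of \<open>L\<close>.
  Genericity of \<open>p\<close> is what excludes contact at a corner.\<close>

lemma adjacent_cells:
  assumes "K \<in> M" "L \<in> M" "K \<noteq> L" "p \<in> K" "p \<in> L"
    and gen: "\<And>j. j \<noteq> i \<Longrightarrow> lo K j < p $ j \<and> p $ j < hi K j"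
  shows "\<exists>s. face L i (\<not> s) = face K i s \<and> p \<in> face K i s"
proof -
  have pK: "lo K j \<le> p $ j" "p $ j \<le> hi K j" and pL: "lo L j \<le> p $ j" "p $ j \<le> hi L j" for j
    using assms by (auto simp: mem_cell)
  have eq: "lo L j = lo K j" "hi L j = hi K j" if "j \<noteq> i" for j
    using interval_eq[OF assms(1,2), of j "p $ j"] gen[OF that] pL[of j] by auto
  have no: "False" if "face K i s = face L i s" for s
    using cell_eq_if_same_side[OF assms(1,2) that] assms(3) by simp
  have faceI: "face K i s = face L i t"
    if "(if s then hi K i else lo K i) = (if t then hi L i else lo L i)" for s t
  proof -
    have "(if j = i \<and> s then hi K j else lo K j) = (if j = i \<and> t then hi L j else lo L j)"
      "(if j = i \<and> \<not> s then lo K j else hi K j) = (if j = i \<and> \<not> t then lo L j else hi L j)" for j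
      using that eq[of j] by (cases "j = i"; cases s; cases t; simp)+
    then show ?thesis
      unfolding face_eq_cbox[OF assms(1)] face_eq_cbox[OF assms(2)] by presburger
  qed
  have notK: "\<not> (lo K i < p $ i \<and> p $ i < hi K i)"
    using interval_eq[OF assms(1,2), of i "p $ i"] pL[of i] faceI[of True True] no[of True] by auto
  have notL: "\<not> (lo L i < p $ i \<and> p $ i < hi L i)"
    using interval_eq[OF assms(2,1), of i "p $ i"] pK[of i] faceI[of True True] no[of True] by auto
  consider "p $ i = lo K i" "p $ i = hi L i" | "p $ i = hi K i" "p $ i = lo L i"
    using notK notL pK[of i] pL[of i] faceI[of True True] faceI[of False False] no[of True] no[of False]
    by fastforce
  then show ?thesis
  proof cases
    case 1
    then show ?thesis using faceI[of False True] assms(4) by (intro exI[of _ False]) (auto simp: face_def)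
  next
    case 2
    then show ?thesis using faceI[of True False] assms(4) by (intro exI[of _ True]) (auto simp: face_def)
  qed
qed

section \<open>Internal edges and neighbouring cells\<close>

lemma face_in_edges: "K \<in> M \<Longrightarrow> face K i s \<in> edges i"
  unfolding edges_def by blast

lemma internal_if_meets:
  assumes "K \<in> M" "p \<in> face K i s" "p \<in> \<Omega>" shows "face K i s \<in> int_edges i"
  using assms face_in_edges domain(1) unfolding int_edges_def frontier_def
  by (auto simp: interior_open)

text \<open>The point of \<open>\<Omega>\<close> on the face may lie on its rim. Moving it slightly
  towards the centre of the face keeps it in the open set \<open>\<Omega>\<close> and makes it
  generic, as \<open>adjacent_cells\<close> demands.\<close>

lemma internal_meets:
  assumes "K \<in> M" "face K i s \<in> int_edges i"
  obtains p where "p \<in> face K i s" "p \<in> \<Omega>" "\<And>j. j \<noteq> i \<Longrightarrow> lo K j < p $ j \<and> p $ j < hi K j"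
proof -
  obtain x where x: "x \<in> face K i s" "x \<notin> frontier \<Omega>"
    using assms(2) unfolding int_edges_def by blast
  have "x \<in> closure \<Omega>" using x(1) assms(1) cells_cover by (auto simp: face_def)
  then have "x \<in> \<Omega>" using x(2) domain(1) by (auto simp: frontier_def interior_open)
  then obtain e where e: "e > 0" "ball x e \<subseteq> \<Omega>" using domain(1) openE by blast
  define y where "y = (\<chi> j. if j = i then x $ i else (lo K j + hi K j) / 2)"
  define p where "p t = x + t *\<^sub>R (y - x)" for t
  have "((\<lambda>t. p t) \<longlongrightarrow> p 0) (at_right 0)" unfolding p_def by (intro tendsto_intros)
  then have "eventually (\<lambda>t. dist (p t) x < e) (at_right 0)"
    using e(1) by (auto simp: p_def dest: tendstoD)
  moreover have "eventually (\<lambda>t::real. 0 < t \<and> t < 1) (at_right 0)"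
    using eventually_at_right_real[of 0 1] by (auto elim: eventually_mono)
  ultimately have "eventually (\<lambda>t. dist (p t) x < e \<and> 0 < t \<and> t < 1) (at_right 0)"
    by (rule eventually_conj)
  then obtain t where t: "dist (p t) x < e" "0 < t" "t < 1"
    using eventually_happens[of _ "at_right (0::real)"] by (auto simp: trivial_limit_at_right_real)
  have xK: "lo K j \<le> x $ j" "x $ j \<le> hi K j" for j
    using x(1) assms(1) by (auto simp: face_def mem_cell)
  have pj: "lo K j < p t $ j \<and> p t $ j < hi K j" if "j \<noteq> i" for j
  proof -
    have "p t $ j = (1 - t) * x $ j + t * ((lo K j + hi K j) / 2)"
      using that by (simp add: p_def y_def algebra_simps)
    moreover have "(1 - t) * lo K j \<le> (1 - t) * x $ j" "(1 - t) * x $ j \<le> (1 - t) * hi K j"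
      using t xK[of j] by (auto intro: mult_left_mono)
    moreover have "t * lo K j < t * ((lo K j + hi K j) / 2)" "t * ((lo K j + hi K j) / 2) < t * hi K j"
      using t cell_box(2)[OF assms(1), of j] by (auto intro!: mult_strict_left_mono simp: field_simps)
    moreover have "lo K j = (1 - t) * lo K j + t * lo K j" "hi K j = (1 - t) * hi K j + t * hi K j"
      by (simp_all add: algebra_simps)
    ultimately show ?thesis by (intro conjI) linarith+
  qed
  have pi: "p t $ i = x $ i" by (simp add: p_def y_def)
  have "p t \<in> face K i s"
    using x(1) pi pj xK assms(1) unfolding face_def
    by (simp add: mem_cell) (metis less_imp_le)
  moreover have "p t \<in> \<Omega>" using e(2) t(1) by (auto simp: dist_commute)
  ultimately show ?thesis using that pj by blast
qed

lemma internal_neighbour: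
  assumes "K \<in> M" "face K i s \<in> int_edges i"
  shows "\<exists>L. L \<in> M \<and> L \<noteq> K \<and> face L i (\<not> s) = face K i s"
proof -
  obtain p where p: "p \<in> face K i s" "p \<in> \<Omega>" "\<And>j. j \<noteq> i \<Longrightarrow> lo K j < p $ j \<and> p $ j < hi K j"
    using internal_meets[OF assms] by metis
  \<comment> \<open>If \<open>K\<close> were the only cell at \<open>p\<close>, then
    \<open>\<Omega>\<close> without the other cells would be a neighbourhood of \<open>p\<close>
    inside \<open>K\<close>, while \<open>p\<close> lies on a face.\<close>
  have "\<exists>L\<in>M - {K}. p \<in> L"
  proof (rule ccontr)
    assume no: "\<not> ?thesis"
    have "closed (\<Union>(M - {K}))" using finite_mesh closed_cell by (intro closed_Union) auto
    then have "open (\<Omega> - \<Union>(M - {K}))" using domain(1) by (rule open_Diff[rotated])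
    moreover have "\<Omega> - \<Union>(M - {K}) \<subseteq> K" using cells_cover closure_subset[of \<Omega>] by blast
    ultimately have "p \<in> interior K" using no p(2) by (auto intro: interiorI)
    then show False using p(1) mem_interior_cell[OF assms(1)]
      by (auto simp: face_def split: if_splits) (metis less_irrefl)+
  qed
  then obtain L where L: "L \<in> M" "L \<noteq> K" "p \<in> L" by blast
  have pK: "p \<in> K" using p(1) by (simp add: face_def)
  obtain t where t: "face L i (\<not> t) = face K i t" "p \<in> face K i t"
    using adjacent_cells[OF assms(1) L(1) L(2)[symmetric] pK L(3) p(3)] by blast
  have "t = s" using t(2) p(1) cell_box(2)[OF assms(1), of i] by (auto simp: face_def split: if_splits)
  then show ?thesis using t L by blast
qed

text \<open>Indexed by cell and side, so that crossing an internal face becomes the involution from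
  \<open>(K, i, s)\<close> to \<open>(nb K i s, i, \<not> s)\<close>.\<close>

definition nb :: "(real^'d) set \<Rightarrow> 'd \<Rightarrow> bool \<Rightarrow> (real^'d) set" where
  "nb K i s = other_cell i (face K i s) K"

lemma nb_eqI:
  assumes "K \<in> M" "L \<in> M" "L \<noteq> K" "face L i (\<not> s) = face K i s"
  shows "nb K i s = L"
  unfolding nb_def other_cell_def
proof (rule the_equality)
  fix L' assume L': "L' \<in> M \<and> L' \<noteq> K \<and> (\<exists>t. face K i s = face L' i t)"
  then obtain t where t: "face K i s = face L' i t" by blast
  have "t = (\<not> s)" using cell_eq_if_same_side[of K L' i s] t L' assms(1) by (cases "t = s") auto
  then show "L' = L" using cell_eq_if_same_side[of L' L i "\<not> s"] t L' assms by simp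
qed (use assms in blast)

lemma nb:
  assumes "K \<in> M" "face K i s \<in> int_edges i"
  shows "nb K i s \<in> M" "nb K i s \<noteq> K" "face (nb K i s) i (\<not> s) = face K i s"
    "nb (nb K i s) i (\<not> s) = K"
proof -
  obtain L where L: "L \<in> M" "L \<noteq> K" "face L i (\<not> s) = face K i s"
    using internal_neighbour[OF assms] by blast
  have eq: "nb K i s = L" by (rule nb_eqI[OF assms(1) L])
  show "nb K i s \<in> M" "nb K i s \<noteq> K" "face (nb K i s) i (\<not> s) = face K i s"
    using L eq by auto
  show "nb (nb K i s) i (\<not> s) = K" unfolding eq using L by (intro nb_eqI[OF L(1) assms(1)]) auto
qed

lemma side_cell_face:
  assumes "K \<in> M" shows "side_cell i (face K i s) (\<not> s) = K"
  unfolding side_cell_def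
proof (rule the_equality)
  fix L assume "L \<in> M \<and> face K i s = face L i (\<not> \<not> s)"
  then show "L = K" using cell_eq_if_same_side[of K L i s] assms by simp
qed (use assms in simp)

lemma side_cell_nb:
  assumes "K \<in> M" "face K i s \<in> int_edges i"
  shows "side_cell i (face K i s) s = nb K i s"
  using side_cell_face[OF nb(1)[OF assms], of i "\<not> s"] nb(3)[OF assms] by simp

text \<open>Passing to the neighbour turns a lower face into an upper one, so a single orientation
  suffices for arguments about an internal edge.\<close>

lemma int_edge_cases:
  assumes "\<sigma> \<in> int_edges i"
  obtains K where "K \<in> M" "\<sigma> = face K i True"
proof -
  obtain K s where K: "K \<in> M" "\<sigma> = face K i s"
    using assms unfolding int_edges_def edges_def by blast
  show ?thesis
  proof (cases s)
    case True
    then have "\<sigma> = face K i True" using K(2) by simp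
    then show ?thesis by (rule that[OF K(1)])
  next
    case False
    then have "K \<in> M" "face K i False \<in> int_edges i" "\<sigma> = face K i False" using K assms by auto
    with nb(1,3)[of K i False] show ?thesis by (intro that[of "nb K i False"]) simp_all
  qed
qed

lemma side_cell_in_M: "\<sigma> \<in> int_edges i \<Longrightarrow> side_cell i \<sigma> s \<in> M"
  and side_cell_face_eq: "\<sigma> \<in> int_edges i \<Longrightarrow> face (side_cell i \<sigma> s) i (\<not> s) = \<sigma>"
proof -
  have "side_cell i \<sigma> s \<in> M \<and> face (side_cell i \<sigma> s) i (\<not> s) = \<sigma>" if \<sigma>: "\<sigma> \<in> int_edges i"
  proof -
    obtain K where K: "K \<in> M" "\<sigma> = face K i True" using int_edge_cases[OF \<sigma>] .
    show ?thesis
    proof (cases s)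
      case True
      have "side_cell i \<sigma> s = nb K i True" using side_cell_nb[of K i True] K \<sigma> True by simp
      then show ?thesis using nb[of K i True] K \<sigma> True by simp
    next
      case False
      then show ?thesis using side_cell_face[of K i True] K by simp
    qed
  qed
  then show "\<sigma> \<in> int_edges i \<Longrightarrow> side_cell i \<sigma> s \<in> M"
    "\<sigma> \<in> int_edges i \<Longrightarrow> face (side_cell i \<sigma> s) i (\<not> s) = \<sigma>" by auto
qed

lemma axis_normal:
  assumes "K \<in> M"
  shows "axis i 1 \<bullet> normal (face K i s) K = (if s then 1 else -1)"
  using face_side_inj[OF assms, of i False True]
  by (cases s) (auto simp: inner_axis' normal_def)

section \<open>Half cells and dual cells\<close>

lemma half_cell_eq:
  assumes "K \<in> M"
  shows "half_cell (face K i s) K = cbox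
    (\<chi> j. if j = i \<and> s then (lo K i + hi K i) / 2 else lo K j)
    (\<chi> j. if j = i \<and> \<not> s then (lo K i + hi K i) / 2 else hi K j)"
proof -
  have *: "face K i s = face K j t \<longleftrightarrow> i = j \<and> s = t" for j t
  proof
    assume eq: "face K i s = face K j t"
    then have "i = j" by (rule face_inj[OF assms assms])
    then show "i = j \<and> s = t" using face_side_inj[OF assms, of i s t] eq by simp
  qed simp
  have "half_cell (face K i s) K =
    {x \<in> K. if s then (lo K i + hi K i) / 2 \<le> x $ i else x $ i \<le> (lo K i + hi K i) / 2}"
    unfolding half_cell_def * by auto
  also have "\<dots> = cbox
    (\<chi> j. if j = i \<and> s then (lo K i + hi K i) / 2 else lo K j)
    (\<chi> j. if j = i \<and> \<not> s then (lo K i + hi K i) / 2 else hi K j)" (is "_ = ?B")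
  proof -
    define m where "m = (lo K i + hi K i) / 2"
    have m: "lo K i \<le> m" "m \<le> hi K i"
      using cell_box(2)[OF assms, of i] by (auto simp: m_def)
    show ?thesis
      unfolding m_def[symmetric]
      by (rule set_eqI, cases s) (use m in \<open>auto simp: mem_cell[OF assms] mem_box_cart intro: order_trans dest: spec[of _ i] split: if_splits\<close>)
  qed
  finally show ?thesis .
qed

lemma half_cell_subset: "half_cell \<sigma> K \<subseteq> K"
  unfolding half_cell_def by blast

lemma cbox_measure_pos:
  fixes a b :: "'n::finite \<Rightarrow> real"
  assumes "\<And>i. a i < b i" shows "0 < measure lebesgue (cbox (\<chi> i. a i) (\<chi> i. b i))"
proof -
  have "(\<chi> i. a i) \<in> cbox (\<chi> i. a i) (\<chi> i. b i)"
    using assms by (auto simp: mem_box_cart less_imp_le)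
  then have "cbox (\<chi> i. a i) (\<chi> i. b i) \<noteq> {}" by blast
  then show ?thesis
    using assms by (auto simp: content_cbox_cart intro!: prod_pos)
qed

lemma half_cell_pos:
  assumes "K \<in> M" shows "0 < measure lebesgue (half_cell (face K i s) K)"
  unfolding half_cell_eq[OF assms]
  using cell_box(2)[OF assms] by (intro cbox_measure_pos) (auto simp: field_simps)

lemma cell_measure_pos: "K \<in> M \<Longrightarrow> 0 < measure lebesgue K"
  by (subst cell_box(1)) (assumption, rule cbox_measure_pos, rule cell_box(2))

lemma negligible_cell_frontier: "K \<in> M \<Longrightarrow> negligible (K - interior K)"
  by (subst (1 2) cell_box(1)) (auto simp: negligible_frontier_interval)

lemma dual_cell_eq:
  assumes "K \<in> M" "face K i s \<in> int_edges i"
  shows "dual_cell i (face K i s) =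
    half_cell (face K i s) K \<union> half_cell (face K i s) (nb K i s)"
proof -
  have "{L \<in> M. \<exists>t. face K i s = face L i t} = {K, nb K i s}"
  proof (intro equalityI subsetI)
    fix L assume "L \<in> {L \<in> M. \<exists>t. face K i s = face L i t}"
    then obtain t where L: "L \<in> M" "face K i s = face L i t" by blast
    show "L \<in> {K, nb K i s}"
    proof (cases "t = s")
      case True
      then show ?thesis using cell_eq_if_same_side[of K L i s] L assms(1) by simp
    next
      case False
      then have "face (nb K i s) i (\<not> s) = face L i (\<not> s)" using nb(3)[OF assms] L by auto
      then show ?thesis using cell_eq_if_same_side[OF nb(1)[OF assms] L(1), of i "\<not> s"] by simp
    qed
  qed (use assms nb[OF assms] in \<open>auto intro: exI[of _ "\<not> s"]\<close>)
  then show ?thesis unfolding dual_cell_def by auto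
qed

lemma dual_vol_eq:
  assumes "K \<in> M" "face K i s \<in> int_edges i"
  shows "dual_vol i (face K i s) = measure lebesgue (half_cell (face K i s) K)
    + measure lebesgue (half_cell (face K i s) (nb K i s))"
proof -
  let ?L = "nb K i s"
  note n = nb[OF assms]
  have f: "half_cell (face K i s) ?L = half_cell (face ?L i (\<not> s)) ?L" using n(3) by simp
  have lm: "half_cell (face K i s) K \<in> lmeasurable" "half_cell (face K i s) ?L \<in> lmeasurable"
    unfolding f half_cell_eq[OF n(1)] half_cell_eq[OF assms(1)] by auto
  \<comment> \<open>Distinct cells share boundary points only.\<close>
  have "negligible (half_cell (face K i s) K \<inter> half_cell (face K i s) ?L)"
  proof (rule negligible_subset[of "(K - interior K) \<union> (?L - interior ?L)"])
    show "half_cell (face K i s) K \<inter> half_cell (face K i s) ?L \<subseteq> (K - interior K) \<union> (?L - interior ?L)"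
      using half_cell_subset cells_disjoint[OF assms(1) n(1)] n(2) by blast
  qed (use negligible_cell_frontier assms n in auto)
  then show ?thesis
    unfolding dual_cell_eq[OF assms] using measure_Un3[OF lm] by (simp add: negligible_imp_measure0)
qed

section \<open>Connectivity and fluxes through superlevel sets\<close>

lemma M_in_closure: "K \<in> M \<Longrightarrow> K \<subseteq> closure \<Omega>"
  using cells_cover by blast

lemma interior_cell_nonempty: "K \<in> M \<Longrightarrow> interior K \<noteq> {}"
  using closure_interior_cell cell_measure_pos by (metis closure_empty less_irrefl measure_empty)

lemma cell_meets_domain: assumes "K \<in> M" shows "interior K \<inter> \<Omega> \<noteq> {}"
proof -
  have "interior K \<inter> closure \<Omega> \<noteq> {}"
    using interior_cell_nonempty[OF assms] interior_subset M_in_closure[OF assms] by blast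
  then show ?thesis by (simp add: open_Int_closure_eq_empty)
qed

lemma domain_subset: "\<Omega> \<subseteq> \<Union>M"
  using cells_cover closure_subset by metis

lemma mesh_nonempty: "M \<noteq> {}"
  using domain(4) domain_subset by auto

text \<open>Connectedness of \<open>\<Omega>\<close> yields a point common to a cell of
  \<open>A\<close> and a cell outside, possibly a corner. A box around it inside
  \<open>\<Omega>\<close> contains points \<open>y\<close> and \<open>z\<close> interior to the two
  cells. When the coordinates of \<open>y\<close> are replaced by those of \<open>z\<close> one at a
  time, some axis-parallel segment must leave the union of \<open>A\<close>, and it can do so only
  through the interior of a face.\<close>

lemma mesh_connected:
  assumes "A \<subseteq> M" "A \<noteq> {}" "A \<noteq> M"
  shows "\<exists>K i s. K \<in> A \<and> face K i s \<in> int_edges i \<and> nb K i s \<notin> A"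
proof (rule ccontr)
  assume no: "\<not> ?thesis"
  define B where "B = M - A"
  have AB: "A \<subseteq> M" "B \<subseteq> M" "A \<inter> B = {}" "B \<noteq> {}" using assms by (auto simp: B_def)
  have cl: "closed (\<Union>A)" "closed (\<Union>B)"
    using AB finite_mesh closed_cell by (auto intro!: closed_Union dest: finite_subset)
  have cover: "\<Omega> \<subseteq> \<Union>A \<union> \<Union>B" using domain_subset unfolding B_def by blast
  have ne: "\<Union>A \<inter> \<Omega> \<noteq> {}" "\<Union>B \<inter> \<Omega> \<noteq> {}"
    using cell_meets_domain AB assms(2) interior_subset by blast+
  have "\<Union>A \<inter> \<Union>B \<inter> \<Omega> \<noteq> {}"
    using domain(3) cl cover ne unfolding connected_closed by meson
  then obtain x K L where x: "x \<in> \<Omega>" and K: "K \<in> A" "x \<in> K" and L: "L \<in> B" "x \<in> L" by blast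
  obtain e where e: "e > 0" "ball x e \<subseteq> \<Omega>" using domain(1) x openE by blast
  obtain a b where ab: "x \<in> box a b" "box a b \<subseteq> \<Omega>"
    using rational_boxes[OF e(1), of x] e(2) by (meson subset_trans)
  have KL: "K \<in> M" "L \<in> M" using K L AB by auto
  have "box a b \<inter> interior K' \<noteq> {}" if "K' \<in> M" "x \<in> K'" for K'
    using open_Int_closure_eq_empty[OF open_box, of a b "interior K'"] closure_interior_cell[OF that(1)] ab that
    by auto
  then obtain y z where y: "y \<in> box a b" "y \<in> interior K" and z: "z \<in> box a b" "z \<in> interior L"
    using KL K L by (meson disjoint_iff)
  define w where "w J = (\<chi> j. if j \<in> J then z $ j else y $ j)" for J
  have w_box: "w J \<in> box a b" for J
    using y z by (auto simp: w_def mem_box_cart)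
  have "w J \<in> \<Union>A" for J :: "'d set"
  proof (induction J rule: infinite_finite_induct)
    case (infinite J)
    then show ?case by simp
  next
    case empty
    have "w {} = y" by (simp add: w_def)
    then show ?case using y K interior_subset by auto
  next
    case (insert i J)
    show ?case
    proof (rule ccontr)
      assume nin: "w (insert i J) \<notin> \<Union>A"
      let ?S = "closed_segment (w J) (w (insert i J))"
      have S: "?S \<subseteq> \<Omega>"
        using closed_segment_subset[OF w_box w_box convex_box(2)] ab(2) by blast
      have "w (insert i J) \<in> \<Union>B" using nin w_box cover ab(2) by blast
      then have "\<Union>B \<inter> ?S \<noteq> {}" "\<Union>A \<inter> ?S \<noteq> {}" using insert.IH by auto
      moreover have "connected ?S" "?S \<subseteq> \<Union>A \<union> \<Union>B" using S cover by auto
      ultimately have "\<Union>A \<inter> \<Union>B \<inter> ?S \<noteq> {}" using cl unfolding connected_closed by meson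
      then obtain p K' L' where p: "p \<in> ?S" "K' \<in> A" "L' \<in> B" "p \<in> K'" "p \<in> L'" by blast
      then have M': "K' \<in> M" "L' \<in> M" "K' \<noteq> L'" using AB by auto
      \<comment> \<open>All coordinates except the \<open>i\<close>-th are constant along the
        segment and agree with those of \<open>y\<close> or \<open>z\<close>, so they lie strictly
        inside the extent of \<open>L\<close> or \<open>K\<close>; \<open>interval_eq\<close>
        transfers this to \<open>K'\<close>.\<close>
      have gen: "lo K' j < p $ j \<and> p $ j < hi K' j" if "j \<noteq> i" for j
      proof -
        obtain t where t: "p = (1 - t) *\<^sub>R w J + t *\<^sub>R w (insert i J)"
          using p(1) by (auto simp: in_segment)
        have "p $ j = w J $ j" using that by (simp add: t w_def algebra_simps)
        then have "p $ j = y $ j \<or> p $ j = z $ j" by (simp add: w_def)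
        then obtain K0 where K0: "K0 \<in> M" "lo K0 j < p $ j" "p $ j < hi K0 j"
          using y z KL by (metis mem_interior_cell)
        have "lo K' j \<le> p $ j" "p $ j \<le> hi K' j" using p(4) M'(1) by (auto simp: mem_cell)
        then show ?thesis using interval_eq[OF K0(1) M'(1) K0(2,3)] K0 by auto
      qed
      obtain s where s: "face L' i (\<not> s) = face K' i s" "p \<in> face K' i s"
        using adjacent_cells[OF M' p(4,5) gen] by blast
      have "face K' i s \<in> int_edges i" using internal_if_meets[OF M'(1) s(2)] S p(1) by blast
      moreover have "nb K' i s = L'" using nb_eqI M' s(1) by metis
      ultimately show False using no p(2,3) AB(3) by blast
    qed
  qed
  from this[of UNIV] have "z \<in> \<Union>A" by (simp add: w_def vec_lambda_eta)
  then obtain K' where K': "K' \<in> A" "z \<in> K'" by blast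
  \<comment> \<open>\<open>z\<close> is interior to \<open>L\<close> and a limit of interior points
    of \<open>K'\<close>.\<close>
  have "interior L \<inter> interior K' \<noteq> {}"
    using open_Int_closure_eq_empty[OF open_interior, of L "interior K'"] closure_interior_cell[of K']
      K' AB z(2) by (metis disjoint_iff subsetD)
  then have "L = K'" using cells_disjoint[of L K'] KL K' AB by blast
  then show False using L K' AB by blast
qed

text \<open>Each internal edge occurs twice, once for each of its two cells.\<close>

definition ifaces :: "((real^'d) set \<times> 'd \<times> bool) set" where
  "ifaces = {(K, i, s). K \<in> M \<and> face K i s \<in> int_edges i}"

lemma finite_int_edges: "finite (int_edges i)"
proof -
  have "edges i = (\<lambda>(K, s). face K i s) ` (M \<times> UNIV)" unfolding edges_def by auto
  then show ?thesis using finite_mesh unfolding int_edges_def by simp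
qed

lemma finite_ifaces: "finite ifaces"
  by (rule finite_subset[of _ "M \<times> UNIV"]) (auto simp: ifaces_def finite_mesh)

lemma ifaces_flip: "(K, i, s) \<in> ifaces \<Longrightarrow> (nb K i s, i, \<not> s) \<in> ifaces"
  using nb(1,3)[of K i s] by (auto simp: ifaces_def)

text \<open>Any two cells are joined by finitely many internal faces, along which the jumps add up.
  The constant counts steps, so it depends on the mesh but neither on \<open>q\<close> nor on
  \<open>b\<close>.\<close>

lemma oscillation_bound:
  obtains c :: real where "c \<ge> 0"
    "\<And>q b K L. \<lbrakk>\<And>K i s. (K, i, s) \<in> ifaces \<Longrightarrow> \<bar>q K - q (nb K i s)\<bar> \<le> b; 0 \<le> b; K \<in> M; L \<in> M\<rbrakk>
       \<Longrightarrow> \<bar>q K - q L\<bar> \<le> c * b"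
proof -
  define R where "R = {(K, nb K i s) | K i s. (K, i, s) \<in> ifaces}"
  define P where "P q b \<longleftrightarrow> 0 \<le> b \<and> (\<forall>K i s. (K, i, s) \<in> ifaces \<longrightarrow> \<bar>q K - q (nb K i s)\<bar> \<le> b)"
    for q :: "(real^'d) set \<Rightarrow> real" and b
  have R_M: "(K, L) \<in> R\<^sup>* \<Longrightarrow> K \<in> M \<Longrightarrow> L \<in> M" for K L
    by (induction rule: rtrancl_induct) (auto simp: R_def ifaces_def nb)
  have reach: "(K, L) \<in> R\<^sup>*" if "K \<in> M" "L \<in> M" for K L
  proof (rule ccontr)
    assume "(K, L) \<notin> R\<^sup>*"
    then have "{L. (K, L) \<in> R\<^sup>*} \<noteq> M" "{L. (K, L) \<in> R\<^sup>*} \<noteq> {}" "{L. (K, L) \<in> R\<^sup>*} \<subseteq> M"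
      using that R_M[of K] by blast+
    \<comment> \<open>An internal face leaving the set of reachable cells would make its neighbour
      reachable too.\<close>
    from mesh_connected[OF this(3,2,1)]
    obtain K' i s where "(K, K') \<in> R\<^sup>*" "face K' i s \<in> int_edges i" "(K, nb K' i s) \<notin> R\<^sup>*"
      by blast
    moreover have "(K', nb K' i s) \<in> R"
      using calculation R_M[of K K'] that by (auto simp: R_def ifaces_def)
    ultimately show False by (meson rtrancl.rtrancl_into_rtrancl)
  qed
  \<comment> \<open>The number of steps is fixed before \<open>q\<close> and \<open>b\<close>, which
    keeps the final constant uniform in them.\<close>
  have "\<exists>n::nat. \<forall>q b. P q b \<longrightarrow> \<bar>q K - q L\<bar> \<le> real n * b" if "(K, L) \<in> R\<^sup>*" for K L
    using that
  proof (induction rule: rtrancl_induct)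
    case base
    show ?case by (intro exI[of _ 0]) simp
  next
    case (step L L')
    then obtain n where n: "\<And>q b. P q b \<Longrightarrow> \<bar>q K - q L\<bar> \<le> real n * b" by blast
    have "\<bar>q K - q L'\<bar> \<le> real (Suc n) * b" if "P q b" for q b
    proof -
      have "\<bar>q L - q L'\<bar> \<le> b" using step(2) that by (auto simp: R_def P_def)
      then show ?thesis using n[OF that] by (simp add: algebra_simps)
    qed
    then show ?case by blast
  qed
  then have "\<forall>K L. \<exists>n::nat. K \<in> M \<longrightarrow> L \<in> M \<longrightarrow> (\<forall>q b. P q b \<longrightarrow> \<bar>q K - q L\<bar> \<le> real n * b)"
    using reach by blast
  then obtain n :: "_ \<Rightarrow> _ \<Rightarrow> nat" where n: "\<And>K L q b. K \<in> M \<Longrightarrow> L \<in> M \<Longrightarrow> P q b \<Longrightarrow> \<bar>q K - q L\<bar> \<le> real (n K L) * b"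
    by metis
  \<comment> \<open>The sum only serves as a common upper bound of the step counts.\<close>
  define c where "c = (\<Sum>K\<in>M. \<Sum>L\<in>M. n K L)"
  have "n K L \<le> c" if "K \<in> M" "L \<in> M" for K L
  proof -
    have "n K L \<le> (\<Sum>L\<in>M. n K L)" using that finite_mesh by (intro member_le_sum) auto
    also have "\<dots> \<le> c" unfolding c_def
      using that finite_mesh by (intro member_le_sum[where f="\<lambda>K. \<Sum>L\<in>M. n K L"]) auto
    finally show ?thesis .
  qed
  then have "\<bar>q K - q L\<bar> \<le> real c * b" if "P q b" "K \<in> M" "L \<in> M" for q b K L
    using n[OF that(2,3,1)] that
    by (meson P_def mult_right_mono of_nat_le_iff order_trans)
  then show ?thesis using that[of "real c"] unfolding P_def by (simp add: of_nat_0_le_iff)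
qed

text \<open>Discrete divergence theorem: faces between two cells of \<open>A\<close> contribute
  twice with opposite signs, external ones contribute nothing, and the boundary of \<open>A\<close>
  remains.\<close>

lemma boundary_sum:
  fixes G :: "(real^'d) set \<Rightarrow> 'd \<Rightarrow> bool \<Rightarrow> real"
  assumes anti: "\<And>K i s. (K, i, s) \<in> ifaces \<Longrightarrow> G (nb K i s) i (\<not> s) = - G K i s"
    and ext: "\<And>K i s. K \<in> M \<Longrightarrow> (K, i, s) \<notin> ifaces \<Longrightarrow> G K i s = 0"
    and A: "A \<subseteq> M"
  shows "(\<Sum>K\<in>A. \<Sum>i\<in>UNIV. \<Sum>s\<in>UNIV. G K i s) =
    (\<Sum>(K, i, s)\<in>{(K, i, s) \<in> ifaces. K \<in> A \<and> nb K i s \<notin> A}. G K i s)"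
proof -
  let ?I = "{(K, i, s) \<in> ifaces. K \<in> A \<and> nb K i s \<in> A}"
  let ?B = "{(K, i, s) \<in> ifaces. K \<in> A \<and> nb K i s \<notin> A}"
  let ?g = "\<lambda>(K, i, s). G K i s"
  have fin: "finite ?I" "finite ?B" by (rule finite_subset[OF _ finite_ifaces], blast)+
  have finA: "finite A" using A finite_mesh finite_subset by blast
  have "(\<Sum>K\<in>A. \<Sum>i\<in>UNIV. \<Sum>s\<in>UNIV. G K i s) = sum ?g (A \<times> UNIV \<times> UNIV)"
    by (simp add: sum.cartesian_product)
  also have "\<dots> = sum ?g (?I \<union> ?B)"
    by (rule sum.mono_neutral_right) (use finA A ext in auto)
  also have "\<dots> = sum ?g ?I + sum ?g ?B"
    by (rule sum.union_disjoint) (use fin in auto)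
  also have "sum ?g ?I = 0"
  proof -
    let ?\<phi> = "\<lambda>(K, i, s). (nb K i s, i, \<not> s)"
    have inv: "nb (nb K i s) i (\<not> s) = K" if "(K, i, s) \<in> ifaces" for K i s
      using that nb(4) by (auto simp: ifaces_def)
    \<comment> \<open>The flip permutes the faces with both cells in \<open>A\<close> and reverses
      the sign of \<open>G\<close>, so the sum equals its own negative.\<close>
    have "sum ?g ?I = (\<Sum>t\<in>?I. - ?g t)"
      by (rule sum.reindex_bij_witness[of _ ?\<phi> ?\<phi>])
        (auto simp: inv ifaces_flip anti)
    then show ?thesis by (simp add: sum_negf)
  qed
  finally show ?thesis by simp
qed

text \<open>The flux out of a superlevel set of \<open>q\<close> only crosses faces at which \<open>q\<close> drops, so it
  bounds each of these jumps.\<close>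

lemma jump_bound:
  fixes G :: "(real^'d) set \<Rightarrow> 'd \<Rightarrow> bool \<Rightarrow> real"
  assumes anti: "\<And>K i s. (K, i, s) \<in> ifaces \<Longrightarrow> G (nb K i s) i (\<not> s) = - G K i s"
    and ext: "\<And>K i s. K \<in> M \<Longrightarrow> (K, i, s) \<notin> ifaces \<Longrightarrow> G K i s = 0"
    and "0 \<le> \<alpha>" "0 \<le> B"
    and lower: "\<And>K i s. (K, i, s) \<in> ifaces \<Longrightarrow> q (nb K i s) < q K \<Longrightarrow>
                  \<alpha> * (q K - q (nb K i s)) - B \<le> G K i s"
    and out: "\<And>K. K \<in> M \<Longrightarrow> (\<Sum>i\<in>UNIV. \<Sum>s\<in>UNIV. G K i s) \<le> D K"
    and D: "\<And>K. K \<in> M \<Longrightarrow> 0 \<le> D K"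
    and "(K, i, s) \<in> ifaces"
  shows "\<alpha> * \<bar>q K - q (nb K i s)\<bar> \<le> (\<Sum>K\<in>M. D K) + real (card ifaces) * B"
proof -
  have *: "\<alpha> * (q K - q (nb K i s)) \<le> (\<Sum>K\<in>M. D K) + real (card ifaces) * B"
    if t: "(K, i, s) \<in> ifaces" "q (nb K i s) < q K" for K i s
  proof -
    \<comment> \<open>The superlevel set at the height of \<open>K\<close> contains \<open>K\<close>
      but not the neighbour, so the given face is on its boundary.\<close>
    define A where "A = {L \<in> M. q K \<le> q L}"
    define E where "E = {(L, i, s) \<in> ifaces. L \<in> A \<and> nb L i s \<notin> A}"
    have E: "E \<subseteq> ifaces" "finite E"
      unfolding E_def by (auto intro!: finite_subset[OF _ finite_ifaces])
    have pos: "\<alpha> * (q L - q (nb L j r)) \<le> G L j r + B" "q (nb L j r) < q L" if "(L, j, r) \<in> E" for L j r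
    proof -
      have L: "(L, j, r) \<in> ifaces" "q K \<le> q L" "nb L j r \<notin> A" using that by (auto simp: E_def A_def)
      then have "nb L j r \<in> M" using nb(1) by (auto simp: ifaces_def)
      then show lt: "q (nb L j r) < q L" using L by (auto simp: A_def)
      then show "\<alpha> * (q L - q (nb L j r)) \<le> G L j r + B" using lower[OF L(1)] by simp
    qed
    have inE: "(K, i, s) \<in> E" using t by (auto simp: E_def A_def ifaces_def)
    have bs: "(\<Sum>(L, j, r)\<in>E. G L j r) = (\<Sum>L\<in>A. \<Sum>i\<in>UNIV. \<Sum>s\<in>UNIV. G L i s)"
      unfolding E_def using boundary_sum[where G=G and A=A] anti ext by (simp add: A_def)
    have "\<alpha> * (q K - q (nb K i s)) \<le> (\<lambda>(L, j, r). G L j r + B) (K, i, s)" using pos[OF inE] by simp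
    \<comment> \<open>After the shift by \<open>B\<close> all boundary terms are nonnegative, so
      each is at most their sum. Below, the sign of \<open>D\<close> lets the outflow bound run over
      all of \<open>M\<close>.\<close>
    also have "\<dots> \<le> (\<Sum>(L, j, r)\<in>E. G L j r + B)"
    proof (rule member_le_sum[OF inE _ E(2)])
      fix x assume "x \<in> E - {(K, i, s)}"
      then obtain L j r where x: "x = (L, j, r)" "(L, j, r) \<in> E" by (cases x) auto
      have "0 \<le> \<alpha> * (q L - q (nb L j r))" using \<open>0 \<le> \<alpha>\<close> pos(2)[OF x(2)] by simp
      then show "0 \<le> (case x of (L, j, r) \<Rightarrow> G L j r + B)" using pos(1)[OF x(2)] x(1) by simp
    qed
    also have "\<dots> = (\<Sum>(L, j, r)\<in>E. G L j r) + real (card E) * B"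
      by (simp add: sum.distrib case_prod_unfold)
    also have "(\<Sum>(L, j, r)\<in>E. G L j r) = (\<Sum>L\<in>A. \<Sum>i\<in>UNIV. \<Sum>s\<in>UNIV. G L i s)"
      by (rule bs)
    also have "\<dots> \<le> (\<Sum>L\<in>A. D L)" by (rule sum_mono) (auto simp: A_def out)
    also have "\<dots> \<le> (\<Sum>K\<in>M. D K)" by (rule sum_mono2) (auto simp: A_def D finite_mesh)
    also have "real (card E) * B \<le> real (card ifaces) * B"
      using card_mono[OF finite_ifaces E(1)] \<open>0 \<le> B\<close> by (intro mult_right_mono) auto
    finally show ?thesis by simp
  qed
  have K: "K \<in> M" "face K i s \<in> int_edges i" using assms(8) by (auto simp: ifaces_def)
  consider "q (nb K i s) < q K" | "q K < q (nb K i s)" | "q K = q (nb K i s)" by linarith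
  then show ?thesis
  proof cases
    case 1
    then show ?thesis using *[OF assms(8)] by simp
  next
    case 2
    \<comment> \<open>The same edge, seen from the cell on its other side.\<close>
    then show ?thesis using *[OF ifaces_flip[OF assms(8)]] nb(4)[OF K] by (simp add: abs_minus_commute)
  next
    case 3
    then show ?thesis using D \<open>0 \<le> B\<close> by (simp add: sum_nonneg)
  qed
qed

end

section \<open>Norms and means\<close>

lemma norm_on_sum_le:
  assumes "norm_on {f. \<forall>x. x \<notin> S \<longrightarrow> f x = 0} nrm" "finite I" "\<And>i. i \<in> I \<Longrightarrow> f i \<in> {f. \<forall>x. x \<notin> S \<longrightarrow> f x = 0}"
  shows "nrm (\<lambda>x. \<Sum>i\<in>I. f i x) \<le> (\<Sum>i\<in>I. nrm (f i))"
  using assms(2,3)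
proof (induction I)
  case empty
  have "nrm (\<lambda>x. 0) = 0" using assms(1) unfolding norm_on_def by simp
  then show ?case by simp
next
  case (insert i I)
  have "nrm (\<lambda>x. f i x + (\<Sum>i\<in>I. f i x)) \<le> nrm (f i) + nrm (\<lambda>x. \<Sum>i\<in>I. f i x)"
    using assms(1) insert.prems unfolding norm_on_def by simp
  then show ?case using insert by simp
qed

text \<open>Expansion in the finitely many unit functions bounds an arbitrary norm by a weighted sum
  of absolute values, so convergence of the values suffices for every norm at once.\<close>

lemma norm_on_tendsto_zero:
  assumes "norm_on {f. \<forall>x. x \<notin> S \<longrightarrow> f x = 0} nrm" "finite S"
    and V: "\<And>k x. x \<notin> S \<Longrightarrow> f k x = 0" and lim: "\<And>x. x \<in> S \<Longrightarrow> (\<lambda>k. f k x) \<longlonglongrightarrow> 0"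
  shows "(\<lambda>k. nrm (f k)) \<longlonglongrightarrow> 0"
proof -
  let ?d = "\<lambda>s x. if x = s then 1 else 0 :: real"
  have bound: "nrm (f k) \<le> (\<Sum>s\<in>S. \<bar>f k s\<bar> * nrm (?d s))" for k
  proof -
    have "f k = (\<lambda>x. \<Sum>s\<in>S. f k s * ?d s x)"
      using V[of _ k] assms(2) by (auto simp: fun_eq_iff if_distrib cong: if_cong)
    then have "nrm (f k) \<le> (\<Sum>s\<in>S. nrm (\<lambda>x. f k s * ?d s x))"
      using norm_on_sum_le[OF assms(1,2), of "\<lambda>s x. f k s * ?d s x"] by auto
    also have "\<dots> = (\<Sum>s\<in>S. \<bar>f k s\<bar> * nrm (?d s))"
      using assms(1) unfolding norm_on_def by (intro sum.cong) auto
    finally show ?thesis .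
  qed
  have "(\<lambda>k. \<Sum>s\<in>S. \<bar>f k s\<bar> * nrm (?d s)) \<longlonglongrightarrow> (\<Sum>s\<in>S. \<bar>0\<bar> * nrm (?d s))"
    by (intro tendsto_intros lim)
  then have lim0: "(\<lambda>k. \<Sum>s\<in>S. \<bar>f k s\<bar> * nrm (?d s)) \<longlonglongrightarrow> 0" by simp
  have nn: "0 \<le> nrm (f k)" for k
    using assms(1) V unfolding norm_on_def by auto
  show ?thesis
    by (rule tendsto_sandwich[OF always_eventually always_eventually tendsto_const lim0])
      (intro allI nn bound)+
qed

text \<open>On a null space the essential supremum is \<open>-\<infinity>\<close>, which the
  hypothesis excludes.\<close>

lemma Linf_norm_nonneg:
  assumes "emeasure \<mu> (space \<mu>) \<noteq> 0" shows "0 \<le> Linf_norm \<mu> f"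
proof -
  have "esssup \<mu> (\<lambda>x. 0 :: ereal) \<le> Linf_norm \<mu> f"
    unfolding Linf_norm_def by (rule esssup_AE_mono) (auto simp: zero_ereal_def)
  then show ?thesis by (simp add: esssup_const[OF assms])
qed

lemma AE_Linf_norm: "AE x in \<mu>. ereal \<bar>f x\<bar> \<le> Linf_norm \<mu> f"
  unfolding Linf_norm_def by (rule esssup_AE)

lemma in_Linf_bound:
  assumes "in_Linf \<mu> f" obtains B where "AE x in \<mu>. \<bar>f x\<bar> \<le> B"
proof -
  have lt: "Linf_norm \<mu> f < \<infinity>" using assms by (simp add: in_Linf_def)
  obtain B where B: "Linf_norm \<mu> f \<le> ereal B"
  proof (cases "Linf_norm \<mu> f")
    case (real r)
    then show ?thesis using that[of r] by simp
  qed (use lt that in auto)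
  have "AE x in \<mu>. \<bar>f x\<bar> \<le> B"
    using AE_Linf_norm[of f \<mu>] by eventually_elim (use B in \<open>metis ereal_less_eq(3) order_trans\<close>)
  then show ?thesis using that by blast
qed

context mac_grid
begin

section \<open>Means and norms of cell functions\<close>

lemma domain_lmeasurable: "\<Omega> \<in> lmeasurable"
  using domain by (intro lmeasurable_open)

lemma domain_measure_pos: "0 < measure lebesgue \<Omega>"
  using open_not_negligible[OF domain(1,4)] domain_lmeasurable negligible_iff_measure
  by (metis less_eq_real_def measure_nonneg)

lemma finite_measure_domain: "S \<in> sets lebesgue \<Longrightarrow> finite_measure (lebesgue_on (S \<inter> \<Omega>))"
  using fmeasurableI2[OF domain_lmeasurable, of "S \<inter> \<Omega>"] domain_lmeasurable
  by (intro finite_measureI) (auto simp: emeasure_restrict_space fmeasurable_def)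

lemma cell_fun_interior:
  assumes "K \<in> M" "x \<in> interior K" shows "cell_fun q x = q K"
proof -
  have "cell_fun q x = (\<Sum>L\<in>M. if L = K then q K else 0)"
    unfolding cell_fun_def
    by (rule sum.cong) (use assms cells_disjoint in \<open>auto simp: indicator_def\<close>)
  then show ?thesis using assms finite_mesh by simp
qed

lemma AE_cell_interior: "AE x in lebesgue_on \<Omega>. \<exists>K\<in>M. x \<in> interior K"
proof -
  have "negligible (\<Union>K\<in>M. K - interior K)"
    using finite_mesh negligible_cell_frontier by (intro negligible_Union) auto
  then have "(\<Union>K\<in>M. K - interior K) \<in> null_sets lebesgue" by (simp add: negligible_iff_null_sets)
  then have "AE x in lebesgue. x \<in> \<Omega> \<longrightarrow> (\<exists>K\<in>M. x \<in> interior K)"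
    by (rule AE_I') (use domain_subset in auto)
  then show ?thesis
    using domain_lmeasurable by (subst AE_restrict_space_iff) auto
qed

text \<open>The mean is a convex combination of the cell values. The weights measure
  \<open>interior K \<inter> \<Omega>\<close> instead of \<open>K\<close>, because the cells fill
  the closure of \<open>\<Omega>\<close>, whose measure may exceed that of
  \<open>\<Omega>\<close>.\<close>

lemma mean_weights:
  obtains w where "\<And>K. 0 \<le> w K" "(\<Sum>K\<in>M. w K) = 1"
    "\<And>q. (\<integral>x. cell_fun q x \<partial>lebesgue_on \<Omega>) / measure lebesgue \<Omega> = (\<Sum>K\<in>M. w K * q K)"
proof -
  define w where "w K = measure (lebesgue_on \<Omega>) (interior K \<inter> \<Omega>) / measure lebesgue \<Omega>" for K
  interpret finite_measure "lebesgue_on \<Omega>"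
    using finite_measure_domain[of UNIV] by simp
  have meas: "interior K \<inter> \<Omega> \<in> sets (lebesgue_on \<Omega>)" for K
    using domain_lmeasurable domain(1)
    by (auto simp: sets_restrict_space_iff intro!: borel_open sets_completionI_sets)
  have int: "integrable (lebesgue_on \<Omega>) (indicator (interior K) :: _ \<Rightarrow> real)" for K
    using meas[of K] by (auto simp: integrable_indicator_iff less_top[symmetric])
  have mean: "(\<integral>x. cell_fun q x \<partial>lebesgue_on \<Omega>) / measure lebesgue \<Omega> = (\<Sum>K\<in>M. w K * q K)" for q
    unfolding cell_fun_def w_def
    by (subst Bochner_Integration.integral_sum)
       (auto simp: int sum_divide_distrib field_simps intro!: sum.cong)
  \<comment> \<open>The constant 1 has mean 1, cell boundaries being null; this gives the sum of the
    weights.\<close>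
  have "(\<integral>x. cell_fun (\<lambda>_. 1) x \<partial>lebesgue_on \<Omega>) = (\<integral>x. 1 \<partial>lebesgue_on \<Omega>)"
  proof (rule integral_cong_AE)
    show "AE x in lebesgue_on \<Omega>. cell_fun (\<lambda>_. 1) x = 1"
      using AE_cell_interior by eventually_elim (auto simp: cell_fun_interior)
    show "cell_fun (\<lambda>_. 1) \<in> borel_measurable (lebesgue_on \<Omega>)"
      unfolding cell_fun_def by (intro borel_measurable_sum) (use int in auto)
  qed simp
  also have "\<dots> = measure lebesgue \<Omega>"
    using domain_lmeasurable by (simp add: measure_restrict_space)
  finally have "(\<Sum>K\<in>M. w K) = 1" using mean[of "\<lambda>_. 1"] domain_measure_pos by simp
  then show ?thesis using mean by (intro that[of w]) (auto simp: w_def)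
qed

lemma Lp_norm_cell_fun_le:
  assumes "1 \<le> p" "\<And>K. K \<in> M \<Longrightarrow> \<bar>q K - a\<bar> \<le> c" "0 \<le> c"
  shows "Lp_norm (lebesgue_on \<Omega>) p (\<lambda>x. cell_fun q x - a) \<le> c * measure lebesgue \<Omega> powr (1 / p)"
proof -
  interpret finite_measure "lebesgue_on \<Omega>"
    using finite_measure_domain[of UNIV] by simp
  have "(\<integral>x. \<bar>cell_fun q x - a\<bar> powr p \<partial>lebesgue_on \<Omega>) \<le> (\<integral>x. c powr p \<partial>lebesgue_on \<Omega>)"
  proof (rule integral_mono_AE')
    show "AE x in lebesgue_on \<Omega>. \<bar>cell_fun q x - a\<bar> powr p \<le> c powr p"
      using AE_cell_interior
      by eventually_elim (use assms in \<open>auto simp: cell_fun_interior intro!: powr_mono2\<close>)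
  qed auto
  also have "\<dots> = c powr p * measure lebesgue \<Omega>"
    using domain_lmeasurable by (simp add: measure_restrict_space)
  finally have "Lp_norm (lebesgue_on \<Omega>) p (\<lambda>x. cell_fun q x - a) \<le> (c powr p * measure lebesgue \<Omega>) powr (1 / p)"
    unfolding Lp_norm_def using assms(1) by (intro powr_mono2) auto
  also have "\<dots> = c * measure lebesgue \<Omega> powr (1 / p)"
    using assms(1,3) by (simp add: powr_mult powr_powr)
  finally show ?thesis .
qed

lemma Linf_Lp_dist_bounds:
  assumes "0 < T" "1 \<le> N" "\<delta>t = T / real N" "1 \<le> p" "0 \<le> c"
    and close: "\<And>n K. n < N \<Longrightarrow> K \<in> M \<Longrightarrow> \<bar>q n K - a\<bar> \<le> c"
  shows "0 \<le> Linf_Lp_dist T \<delta>t p q a" "Linf_Lp_dist T \<delta>t p q a \<le> ereal (c * measure lebesgue \<Omega> powr (1 / p))"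
proof -
  let ?\<mu> = "lebesgue_on {0<..<T}"
  let ?h = "\<lambda>n. Lp_norm (lebesgue_on \<Omega>) p (\<lambda>x. cell_fun (q n) x - a)"
  have "emeasure ?\<mu> (space ?\<mu>) \<noteq> 0" using assms(1) by (simp add: emeasure_restrict_space)
  then show "0 \<le> Linf_Lp_dist T \<delta>t p q a" unfolding Linf_Lp_dist_def by (rule Linf_norm_nonneg)
  \<comment> \<open>A function of the integer level is measurable in \<open>t\<close>. This matters:
    the essential supremum of a non-measurable function is \<open>\<infinity>\<close> by
    convention.\<close>
  have "(\<lambda>t::real. ?h (nat \<lfloor>t / \<delta>t\<rfloor>)) \<in> borel_measurable borel" by measurable
  then have "(\<lambda>t::real. ?h (nat \<lfloor>t / \<delta>t\<rfloor>)) \<in> borel_measurable ?\<mu>"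
    by (intro measurable_restrict_space1 measurable_completion) simp
  then have "(\<lambda>t. ereal \<bar>?h (nat \<lfloor>t / \<delta>t\<rfloor>)\<bar>) \<in> borel_measurable ?\<mu>" by measurable
  moreover have "ereal \<bar>?h (nat \<lfloor>t / \<delta>t\<rfloor>)\<bar> \<le> ereal (c * measure lebesgue \<Omega> powr (1 / p))" if "t \<in> {0<..<T}" for t
  proof -
    have "0 < \<delta>t" using assms by simp
    \<comment> \<open>The open interval up to \<open>T\<close> sees only the levels below
      \<open>N\<close>.\<close>
    have "t / \<delta>t < real N" using that assms(1-3) \<open>0 < \<delta>t\<close> by (simp add: divide_less_eq)
    then have "nat \<lfloor>t / \<delta>t\<rfloor> < N" using that \<open>0 < \<delta>t\<close> by (simp add: nat_less_iff floor_less_iff)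
    then have "?h (nat \<lfloor>t / \<delta>t\<rfloor>) \<le> c * measure lebesgue \<Omega> powr (1 / p)"
      by (intro Lp_norm_cell_fun_le assms close)
    moreover have "0 \<le> ?h (nat \<lfloor>t / \<delta>t\<rfloor>)" by (simp add: Lp_norm_def)
    ultimately show ?thesis by simp
  qed
  ultimately show "Linf_Lp_dist T \<delta>t p q a \<le> ereal (c * measure lebesgue \<Omega> powr (1 / p))"
    unfolding Linf_Lp_dist_def Linf_norm_def by (intro esssup_I AE_I2) auto
qed

lemma Linf_Lp_dist_tendsto_zero:
  assumes "0 < T" "1 \<le> N" "\<delta>t = T / real N" "1 \<le> p"
    and lim: "\<And>n K. n < N \<Longrightarrow> K \<in> M \<Longrightarrow> (\<lambda>k. q k n K) \<longlonglongrightarrow> a"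
  shows "(\<lambda>k. Linf_Lp_dist T \<delta>t p (q k) a) \<longlonglongrightarrow> 0"
proof -
  define c where "c k = (\<Sum>n<N. \<Sum>K\<in>M. \<bar>q k n K - a\<bar>)" for k
  have "(\<lambda>k. c k * measure lebesgue \<Omega> powr (1 / p)) \<longlonglongrightarrow> (\<Sum>n<N. \<Sum>K\<in>M. \<bar>a - a\<bar>) * measure lebesgue \<Omega> powr (1 / p)"
    unfolding c_def by (intro tendsto_intros lim) auto
  then have lim_c: "(\<lambda>k. ereal (c k * measure lebesgue \<Omega> powr (1 / p))) \<longlonglongrightarrow> 0"
    by (simp add: zero_ereal_def)
  have close: "\<bar>q k n K - a\<bar> \<le> c k" if "n < N" "K \<in> M" for k n K
  proof -
    have "\<bar>q k n K - a\<bar> \<le> (\<Sum>K\<in>M. \<bar>q k n K - a\<bar>)"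
      using that finite_mesh by (intro member_le_sum) auto
    also have "\<dots> \<le> c k" unfolding c_def
      using that by (intro member_le_sum[where f="\<lambda>n. \<Sum>K\<in>M. \<bar>q k n K - a\<bar>"]) (auto intro: sum_nonneg)
    finally show ?thesis .
  qed
  have "0 \<le> c k" for k unfolding c_def by (intro sum_nonneg) auto
  note bounds = Linf_Lp_dist_bounds[OF assms(1-4) this close]
  show ?thesis
    by (rule tendsto_sandwich[OF _ _ tendsto_const lim_c]) (use bounds in auto)
qed

lemma mean_over_close:
  assumes "S \<in> sets lebesgue" "0 < measure lebesgue (S \<inter> \<Omega>)" "f \<in> borel_measurable (lebesgue_on \<Omega>)"
    and "AE x in lebesgue_on \<Omega>. \<bar>f x - a\<bar> \<le> b"
  shows "\<bar>mean_over S f - a\<bar> \<le> b"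
proof -
  let ?\<mu> = "lebesgue_on (S \<inter> \<Omega>)"
  interpret finite_measure ?\<mu> using finite_measure_domain[OF assms(1)] .
  have sets: "S \<inter> \<Omega> \<in> sets lebesgue" using assms(1) domain_lmeasurable by auto
  have "AE x in ?\<mu>. \<bar>f x - a\<bar> \<le> b"
    using assms(4) domain_lmeasurable sets
    by (auto simp: AE_restrict_space_iff elim!: eventually_mono)
  moreover have meas: "f \<in> borel_measurable ?\<mu>"
    by (rule measurable_restrict_mono[OF assms(3)]) auto
  ultimately have bnd: "AE x in ?\<mu>. norm (f x - a) \<le> b" and int: "integrable ?\<mu> (\<lambda>x. f x - a)"
    by (auto intro!: integrable_const_bound[where B=b])
  have "integrable ?\<mu> f" using Bochner_Integration.integrable_add[OF int, of "\<lambda>_. a"] by simp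
  then have "(\<integral>x. f x - a \<partial>?\<mu>) = (\<integral>x. f x \<partial>?\<mu>) - a * measure lebesgue (S \<inter> \<Omega>)"
    using sets by (simp add: measure_restrict_space)
  then have eq: "mean_over S f - a = (\<integral>x. f x - a \<partial>?\<mu>) / measure lebesgue (S \<inter> \<Omega>)"
    using assms(2) by (simp add: mean_over_def field_simps)
  have le: "\<bar>\<integral>x. f x - a \<partial>?\<mu>\<bar> \<le> b * measure lebesgue (S \<inter> \<Omega>)"
  proof -
    have "\<bar>\<integral>x. f x - a \<partial>?\<mu>\<bar> \<le> (\<integral>x. \<bar>f x - a\<bar> \<partial>?\<mu>)" by (rule integral_abs_bound)
    also have "\<dots> \<le> (\<integral>x. b \<partial>?\<mu>)"
      using bnd int by (intro integral_mono_AE) auto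
    also have "\<dots> = b * measure lebesgue (S \<inter> \<Omega>)" using sets by (simp add: measure_restrict_space)
    finally show ?thesis .
  qed
  have "\<bar>mean_over S f - a\<bar> = \<bar>\<integral>x. f x - a \<partial>?\<mu>\<bar> / measure lebesgue (S \<inter> \<Omega>)"
    unfolding eq abs_divide by simp
  also have "\<dots> \<le> b" using le assms(2) by (subst pos_divide_le_eq)
  finally show ?thesis .
qed

text \<open>The elementary estimate \<open>\<bar>a\<bar> \<le> 1 + a\<^sup>2\<close> turns the
  \<open>L2\<close> bound into a bound of the integral of a component over \<open>S\<close>.\<close>

lemma mean_over_bounded:
  assumes "S \<in> sets lebesgue"
    and v: "\<And>i. in_Linf (lebesgue_on \<Omega>) (\<lambda>x. v x $ i)"
    and C: "Lp_norm (lebesgue_on \<Omega>) 2 (\<lambda>x. norm (v x)) \<le> C"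
  shows "\<bar>mean_over S (\<lambda>x. v x $ i)\<bar> \<le> (measure lebesgue \<Omega> + C\<^sup>2) / measure lebesgue (S \<inter> \<Omega>)"
proof -
  let ?\<mu> = "lebesgue_on (S \<inter> \<Omega>)" and ?\<nu> = "lebesgue_on \<Omega>"
  interpret S: finite_measure ?\<mu> using finite_measure_domain[OF assms(1)] .
  interpret finite_measure ?\<nu> using finite_measure_domain[of UNIV] by simp
  have sets: "S \<inter> \<Omega> \<in> sets lebesgue" using assms(1) domain_lmeasurable by auto
  have norm2: "(norm (v x))\<^sup>2 = (\<Sum>i\<in>UNIV. (v x $ i)\<^sup>2)" for x
    by (simp add: norm_vec_def L2_set_def sum_nonneg)
  \<comment> \<open>Integrability has to come first: a non-integrable function has integral 0, and a
    bound on \<open>Lp_norm\<close> would then say nothing. Essential boundedness of the components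
    supplies it.\<close>
  have sq: "integrable ?\<nu> (\<lambda>x. (v x $ i)\<^sup>2)" for i
  proof -
    obtain B where B: "AE x in ?\<nu>. \<bar>v x $ i\<bar> \<le> B" using in_Linf_bound[OF v] .
    have "(\<lambda>x. v x $ i) \<in> borel_measurable ?\<nu>" using v by (simp add: in_Linf_def)
    moreover have "AE x in ?\<nu>. norm ((v x $ i)\<^sup>2) \<le> B\<^sup>2"
      using B by eventually_elim (auto simp: abs_le_square_iff[symmetric])
    ultimately show ?thesis by (intro integrable_const_bound) auto
  qed
  then have int2: "integrable ?\<nu> (\<lambda>x. (norm (v x))\<^sup>2)" unfolding norm2 by simp
  have bound2: "(\<integral>x. (norm (v x))\<^sup>2 \<partial>?\<nu>) \<le> C\<^sup>2"
  proof -
    have "Lp_norm ?\<nu> 2 (\<lambda>x. norm (v x)) = sqrt (\<integral>x. (norm (v x))\<^sup>2 \<partial>?\<nu>)"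
      by (simp add: Lp_norm_def powr_half_sqrt integral_nonneg_AE powr_numeral)
    then show ?thesis using C by (simp add: real_le_lsqrt sqrt_le_D)
  qed
  have le: "\<bar>v x $ i\<bar> \<le> 1 + (norm (v x))\<^sup>2" for x
  proof -
    have "(v x $ i)\<^sup>2 \<le> (norm (v x))\<^sup>2" using component_le_norm_cart[of "v x" i] by (simp add: abs_le_square_iff[symmetric])
    moreover have "2 * \<bar>v x $ i\<bar> \<le> 1 + (v x $ i)\<^sup>2"
      using sum_squares_bound[of 1 "\<bar>v x $ i\<bar>"] by simp
    ultimately show ?thesis by (smt (verit) zero_le_power2)
  qed
  have ind: "integrable ?\<nu> (\<lambda>x. 1 + (norm (v x))\<^sup>2)" using int2 by simp
  have "\<bar>\<integral>x. v x $ i \<partial>?\<mu>\<bar> \<le> (\<integral>x. \<bar>v x $ i\<bar> \<partial>?\<mu>)" by (rule integral_abs_bound)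
  also have "\<dots> = (\<integral>x. indicator (S \<inter> \<Omega>) x *\<^sub>R \<bar>v x $ i\<bar> \<partial>lebesgue)"
    using sets by (subst integral_restrict_space) auto
  also have "\<dots> \<le> (\<integral>x. indicator \<Omega> x *\<^sub>R (1 + (norm (v x))\<^sup>2) \<partial>lebesgue)"
  proof (rule integral_mono_AE')
    show "integrable lebesgue (\<lambda>x. indicator \<Omega> x *\<^sub>R (1 + (norm (v x))\<^sup>2))"
      using ind domain_lmeasurable by (subst (asm) integrable_restrict_space) auto
  qed (use le in \<open>auto simp: indicator_def\<close>)
  also have "\<dots> = (\<integral>x. 1 + (norm (v x))\<^sup>2 \<partial>?\<nu>)"
    using domain_lmeasurable by (subst integral_restrict_space) auto
  also have "\<dots> \<le> measure lebesgue \<Omega> + C\<^sup>2"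
    using int2 bound2 domain_lmeasurable by (simp add: measure_restrict_space)
  finally have "\<bar>\<integral>x. v x $ i \<partial>?\<mu>\<bar> \<le> measure lebesgue \<Omega> + C\<^sup>2" .
  then show ?thesis by (simp add: mean_over_def divide_right_mono)
qed

lemma measure_cell_domain_pos: assumes "K \<in> M" shows "0 < measure lebesgue (K \<inter> \<Omega>)"
proof -
  have "interior K \<inter> \<Omega> \<in> lmeasurable" "K \<inter> \<Omega> \<in> lmeasurable"
    using domain_lmeasurable domain(1) closed_cell[OF assms]
    by (auto intro!: fmeasurableI2[OF domain_lmeasurable] sets.Int)
  moreover have "\<not> negligible (interior K \<inter> \<Omega>)"
    using cell_meets_domain[OF assms] domain(1) by (intro open_not_negligible) auto
  ultimately have "0 < measure lebesgue (interior K \<inter> \<Omega>)"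
    using negligible_iff_measure by (metis less_eq_real_def measure_nonneg)
  also have "\<dots> \<le> measure lebesgue (K \<inter> \<Omega>)"
    using \<open>K \<inter> \<Omega> \<in> lmeasurable\<close> \<open>interior K \<inter> \<Omega> \<in> lmeasurable\<close> interior_subset
    by (intro measure_mono_fmeasurable) auto
  finally show ?thesis .
qed

lemma dual_cell_sets: assumes "\<sigma> \<in> int_edges i" shows "dual_cell i \<sigma> \<in> sets lebesgue"
proof -
  have "half_cell \<sigma> K \<in> sets lebesgue" if "K \<in> M" "\<sigma> = face K i s" for K s
    using half_cell_eq[OF that(1), of i s] that(2) by simp
  then show ?thesis
    unfolding dual_cell_def using finite_mesh by (intro sets.finite_UN) auto
qed

end

section \<open>Discrete operators\<close>

lemma tendsto_pos_part: "(f \<longlongrightarrow> a) F \<Longrightarrow> ((\<lambda>x. pos_part (f x)) \<longlongrightarrow> pos_part a) F"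
  unfolding pos_part_def by (auto intro!: tendsto_intros)

lemma tendsto_neg_part: "(f \<longlongrightarrow> a) F \<Longrightarrow> ((\<lambda>x. neg_part (f x)) \<longlongrightarrow> neg_part a) F"
  unfolding neg_part_def by (auto intro!: tendsto_intros)

lemma finite_lower_bound:
  fixes f :: "'a \<Rightarrow> real"
  assumes "finite S" "\<And>x. x \<in> S \<Longrightarrow> 0 < f x"
  obtains a where "0 < a" "\<And>x. x \<in> S \<Longrightarrow> a \<le> f x"
proof (cases "S = {}")
  case True
  then show ?thesis using that[of 1] by simp
next
  case False
  then show ?thesis using assms by (intro that[of "Min (f ` S)"]) auto
qed

context mac_grid
begin

abbreviation transm :: "(real^'d) set \<Rightarrow> 'd \<Rightarrow> bool \<Rightarrow> real" where
  "transm K i s \<equiv> area i (face K i s) / dual_vol i (face K i s)"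

lemma dual_vol_pos:
  assumes "(K, i, s) \<in> ifaces" shows "0 < dual_vol i (face K i s)"
proof -
  have K: "K \<in> M" "face K i s \<in> int_edges i" using assms by (auto simp: ifaces_def)
  have "0 \<le> measure lebesgue (half_cell (face K i s) (nb K i s))" by simp
  then show ?thesis using half_cell_pos[OF K(1), of i s] unfolding dual_vol_eq[OF K] by linarith
qed

lemma trans_pos: "(K, i, s) \<in> ifaces \<Longrightarrow> 0 < transm K i s"
  using dual_vol_pos[of K i s] area_face_pos[of K i s] by (auto simp: ifaces_def)

lemma dual_value_eq:
  assumes "(K, i, s) \<in> ifaces"
  shows "dual_value q i (face K i s) =
    (measure lebesgue (half_cell (face K i s) K) * q K +
     measure lebesgue (half_cell (face K i s) (nb K i s)) * q (nb K i s)) / dual_vol i (face K i s)"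
proof -
  have K: "K \<in> M" "face K i s \<in> int_edges i" using assms by (auto simp: ifaces_def)
  have "side_cell i (face K i s) (\<not> s) = K" "side_cell i (face K i s) s = nb K i s"
    using side_cell_face[OF K(1)] side_cell_nb[OF K] by auto
  then show ?thesis unfolding dual_value_def Let_def by (cases s) (auto simp: add.commute)
qed

text \<open>A weighted mean is at most the larger value. In this way stability condition (i), stated
  on dual cells, reaches the cell with the larger density.\<close>

lemma dual_value_le:
  assumes "(K, i, s) \<in> ifaces" "q (nb K i s) \<le> q K"
  shows "dual_value q i (face K i s) \<le> q K"
proof -
  have K: "K \<in> M" "face K i s \<in> int_edges i" using assms by (auto simp: ifaces_def)
  have "measure lebesgue (half_cell (face K i s) (nb K i s)) * q (nb K i s)
     \<le> measure lebesgue (half_cell (face K i s) (nb K i s)) * q K"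
    using assms(2) by (intro mult_left_mono) auto
  then show ?thesis
    unfolding dual_value_eq[OF assms(1)] using dual_vol_pos[OF assms(1)] dual_vol_eq[OF K]
    by (simp add: divide_le_eq algebra_simps)
qed

lemma dual_value_pos:
  assumes "(K, i, s) \<in> ifaces" "\<And>K. K \<in> M \<Longrightarrow> 0 < q K"
  shows "0 < dual_value q i (face K i s)"
proof -
  have K: "K \<in> M" "face K i s \<in> int_edges i" using assms by (auto simp: ifaces_def)
  have "0 < measure lebesgue (half_cell (face K i s) K) * q K"
    using half_cell_pos[OF K(1)] assms(2) K(1) by simp
  moreover have "0 \<le> measure lebesgue (half_cell (face K i s) (nb K i s)) * q (nb K i s)"
    using assms(2)[OF nb(1)[OF K]] by simp
  ultimately show ?thesis
    unfolding dual_value_eq[OF assms(1)] using dual_vol_pos[OF assms(1)] by (intro divide_pos_pos) auto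
qed

section \<open>Outward components and fluxes\<close>

lemma outward_eq: "K \<in> M \<Longrightarrow> outward w i (face K i s) K = (if s then w (i, face K i s) else - w (i, face K i s))"
  by (simp add: outward_def axis_normal)

lemma outward_flip:
  assumes "(K, i, s) \<in> ifaces"
  shows "outward w i (face K i s) (nb K i s) = - outward w i (face K i s) K"
proof -
  have K: "K \<in> M" "face K i s \<in> int_edges i" using assms by (auto simp: ifaces_def)
  show ?thesis
    by (simp add: outward_eq[OF nb(1)[OF K], of w i "\<not> s", unfolded nb(3)[OF K]] outward_eq[OF K(1)])
qed

text \<open>\<open>grad\<close> is oriented along the axis and \<open>outward\<close> away from
  \<open>K\<close>; the two signs cancel, leaving a difference whose sign no longer depends on
  \<open>s\<close>.\<close>

lemma outward_grad:
  assumes "(K, i, s) \<in> ifaces"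
  shows "outward (grad q) i (face K i s) K = transm K i s * (q (nb K i s) - q K)"
proof -
  have K: "K \<in> M" "face K i s \<in> int_edges i" using assms by (auto simp: ifaces_def)
  note n = nb[OF K]
  have sc: "side_cell i (face K i s) (\<not> s) = K" "side_cell i (face K i s) s = nb K i s"
    using side_cell_face[OF K(1)] side_cell_nb[OF K] by auto
  show ?thesis
  proof (cases s)
    case True
    then show ?thesis using K sc by (simp add: outward_eq grad_def axis_normal)
  next
    case False
    have "axis i 1 \<bullet> normal (face K i s) (nb K i s) = 1"
      using axis_normal[OF n(1), of i True] n(3) False by simp
    then have "grad q (i, face K i s) = transm K i s * (q K - q (nb K i s))"
      using K sc False by (simp add: grad_def)
    then show ?thesis
      using K False dual_vol_pos[OF assms] by (simp add: outward_eq field_simps)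
  qed
qed

lemma outward_diff: "outward (\<lambda>e. u e - v e) i \<sigma> K = outward u i \<sigma> K - outward v i \<sigma> K"
  by (simp add: outward_def algebra_simps)

lemma outward_scale: "outward (\<lambda>e. c * v e) i \<sigma> K = c * outward v i \<sigma> K"
  by (simp add: outward_def algebra_simps)

lemma flux_eq:
  assumes "(K, i, s) \<in> ifaces"
  shows "flux \<rho> u \<delta>u i (face K i s) K = area i (face K i s) *
     (\<rho> K * (pos_part (outward u i (face K i s) K) - neg_part (outward \<delta>u i (face K i s) K)) +
      \<rho> (nb K i s) * (neg_part (outward u i (face K i s) K) - pos_part (outward \<delta>u i (face K i s) K)))"
  using assms by (auto simp: flux_def ifaces_def nb_def)

lemma flux_external: "K \<in> M \<Longrightarrow> (K, i, s) \<notin> ifaces \<Longrightarrow> flux \<rho> u \<delta>u i (face K i s) K = 0"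
  by (auto simp: flux_def ifaces_def)

text \<open>Seen from the neighbour, the outward velocities change sign, which exchanges positive
  and negative parts together with the two densities.\<close>

lemma flux_flip:
  assumes "(K, i, s) \<in> ifaces"
  shows "flux \<rho> u \<delta>u i (face (nb K i s) i (\<not> s)) (nb K i s) = - flux \<rho> u \<delta>u i (face K i s) K"
proof -
  have K: "K \<in> M" "face K i s \<in> int_edges i" using assms by (auto simp: ifaces_def)
  show ?thesis
    unfolding nb(3)[OF K] flux_eq[OF assms]
      flux_eq[OF ifaces_flip[OF assms], unfolded nb(3)[OF K] nb(4)[OF K] outward_flip[OF assms]]
    by (simp add: pos_part_def neg_part_def field_simps)
qed

text \<open>At density 1 the two upwind parts add up to the velocity. Membership in
  \<open>H_E0\<close> makes the right-hand side vanish on external edges, where the flux is 0 by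
  definition.\<close>

lemma flux_one:
  assumes "K \<in> M" "u \<in> H_E0" "\<delta>u \<in> H_E0"
  shows "flux (\<lambda>_. 1) u \<delta>u i (face K i s) K = area i (face K i s) * outward (\<lambda>e. u e - \<delta>u e) i (face K i s) K"
proof (cases "(K, i, s) \<in> ifaces")
  case True
  then show ?thesis
    by (simp add: flux_eq outward_diff pos_part_def neg_part_def field_simps)
next
  case False
  then show ?thesis using assms by (auto simp: flux_external outward_eq H_E0_def ifaces_def)
qed

lemma grad_in_H_E0: "grad q \<in> H_E0"
  by (auto simp: H_E0_def grad_def)

lemma scale_in_H_E0: "w \<in> H_E0 \<Longrightarrow> (\<lambda>e. c * w e) \<in> H_E0"
  by (auto simp: H_E0_def)

lemma int_edge_iface:
  assumes "\<sigma> \<in> int_edges i"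
  obtains K where "(K, i, True) \<in> ifaces" "\<sigma> = face K i True"
  using int_edge_cases[OF assms] assms by (metis (no_types, lifting) ifaces_def case_prodI mem_Collect_eq)

text \<open>Additive constants vanish under \<open>grad\<close>; with
  \<open>a = 1 / \<epsilon>\<^sup>2\<close> this leads from the pressure to its fluctuation.\<close>

lemma grad_cong_const:
  assumes "\<And>K. K \<in> M \<Longrightarrow> q' K = a * (q K - b)"
  shows "grad q' e = a * grad q e"
proof -
  obtain i \<sigma> where e: "e = (i, \<sigma>)" by (cases e)
  show ?thesis
  proof (cases "\<sigma> \<in> int_edges i")
    case True
    have q': "q' (side_cell i \<sigma> s) = a * (q (side_cell i \<sigma> s) - b)" for s
      by (intro assms side_cell_in_M[OF True])
    from True show ?thesis by (simp add: e grad_def Let_def q' algebra_simps)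
  next
    case False
    then show ?thesis by (simp add: e grad_def)
  qed
qed

section \<open>Continuity of the operators\<close>

lemma tendsto_grad:
  assumes "\<And>K. K \<in> M \<Longrightarrow> ((\<lambda>x. q x K) \<longlongrightarrow> ql K) F"
  shows "((\<lambda>x. grad (q x) e) \<longlongrightarrow> grad ql e) F"
proof -
  obtain i \<sigma> where e: "e = (i, \<sigma>)" by (cases e)
  show ?thesis
  proof (cases "\<sigma> \<in> int_edges i")
    case True
    have "dual_vol i \<sigma> \<noteq> 0" using dual_vol_pos int_edge_iface[OF True] by (metis less_irrefl)
    then show ?thesis
      using True by (auto simp: e grad_def Let_def intro!: tendsto_intros assms side_cell_in_M)
  next
    case False
    then show ?thesis by (simp add: e grad_def)
  qed
qed

lemma tendsto_dual_value:
  assumes "\<And>K. K \<in> M \<Longrightarrow> ((\<lambda>x. q x K) \<longlongrightarrow> 1) F" "\<sigma> \<in> int_edges i"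
  shows "((\<lambda>x. dual_value (q x) i \<sigma>) \<longlongrightarrow> 1) F"
proof -
  obtain K where K: "(K, i, True) \<in> ifaces" "\<sigma> = face K i True" using int_edge_iface[OF assms(2)] .
  then have KM: "K \<in> M" "face K i True \<in> int_edges i" by (auto simp: ifaces_def)
  let ?a = "measure lebesgue (half_cell \<sigma> K)" and ?b = "measure lebesgue (half_cell \<sigma> (nb K i True))"
  have "((\<lambda>x. dual_value (q x) i \<sigma>) \<longlongrightarrow> (?a * 1 + ?b * 1) / dual_vol i \<sigma>) F"
    unfolding K(2) dual_value_eq[OF K(1)]
    by (intro tendsto_intros assms KM nb) (use dual_vol_pos[OF K(1)] in simp)
  then show ?thesis using dual_vol_pos[OF K(1)] dual_vol_eq[OF KM] by (simp add: K(2))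
qed

lemma tendsto_flux:
  assumes "K \<in> M"
    and \<rho>: "\<And>K. K \<in> M \<Longrightarrow> ((\<lambda>x. \<rho> x K) \<longlongrightarrow> \<rho>l K) F"
    and u: "\<And>e. ((\<lambda>x. u x e) \<longlongrightarrow> ul e) F" and \<delta>u: "\<And>e. ((\<lambda>x. \<delta>u x e) \<longlongrightarrow> \<delta>ul e) F"
  shows "((\<lambda>x. flux (\<rho> x) (u x) (\<delta>u x) i (face K i s) K) \<longlongrightarrow> flux \<rho>l ul \<delta>ul i (face K i s) K) F"
proof (cases "(K, i, s) \<in> ifaces")
  case True
  then have "nb K i s \<in> M" using nb(1) by (auto simp: ifaces_def)
  then show ?thesis unfolding flux_eq[OF True] outward_def
    by (intro tendsto_intros tendsto_pos_part tendsto_neg_part assms)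
next
  case False
  then show ?thesis using assms(1) by (simp add: flux_external)
qed

text \<open>The right-hand side is visibly continuous in flux and velocity: the jump of the upwind
  value at \<open>f = 0\<close> is multiplied by 0.\<close>

lemma upwind_product:
  "f * upwind_value f u i \<sigma> \<epsilon> = pos_part f * u (i, \<sigma>) + neg_part f * u (i, dual_neighbour i \<sigma> \<epsilon>)"
  by (auto simp: upwind_value_def pos_part_def neg_part_def)

lemma tendsto_convection:
  assumes F: "\<And>K i s. K \<in> M \<Longrightarrow> ((\<lambda>x. f x i (face K i s) K) \<longlongrightarrow> fl i (face K i s) K) F"
    and u: "\<And>e. ((\<lambda>x. u x e) \<longlongrightarrow> ul e) F"
    and \<sigma>: "\<sigma> \<in> int_edges i"
  shows "((\<lambda>x. convection (f x) (u x) i \<sigma>) \<longlongrightarrow> convection fl ul i \<sigma>) F"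
proof -
  have own: "((\<lambda>x. f x i \<sigma> (side_cell i \<sigma> s)) \<longlongrightarrow> fl i \<sigma> (side_cell i \<sigma> s)) F" for s
    using F[OF side_cell_in_M[OF \<sigma>, of s], of i "\<not> s"] side_cell_face_eq[OF \<sigma>, of s] by simp
  have dual: "((\<lambda>x. dual_flux (f x) i \<sigma> j s) \<longlongrightarrow> dual_flux fl i \<sigma> j s) F" for j s
    unfolding dual_flux_def Let_def
    by (auto intro!: tendsto_intros F own side_cell_in_M[OF \<sigma>])
  show ?thesis
    unfolding convection_def upwind_product divide_inverse
    by (intro tendsto_intros tendsto_pos_part tendsto_neg_part dual u)
qed

section \<open>Stability of the discrete Poisson problem\<close>

lemma transmissibility_bound:
  obtains a where "0 < a" "\<And>K i s. (K, i, s) \<in> ifaces \<Longrightarrow> a \<le> area i (face K i s) * transm K i s"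
proof -
  have "0 < area i (face K i s) * transm K i s" if "(K, i, s) \<in> ifaces" for K i s
    using trans_pos[OF that] area_face_pos[of K i s] that by (intro mult_pos_pos) (auto simp: ifaces_def)
  moreover define g where "g = (\<lambda>(K, i, s). area i (face K i s) * transm K i s)"
  ultimately have "0 < g t" if "t \<in> ifaces" for t
    using that by (cases t) simp
  then obtain a where a: "0 < a" "\<And>t. t \<in> ifaces \<Longrightarrow> a \<le> g t"
    using finite_lower_bound[OF finite_ifaces, of g] by blast
  show ?thesis
    by (rule that[OF a(1)], drule a(2)) (simp add: g_def)
qed

text \<open>Two-point flux of the discrete Neumann Laplacian, the outward flux of
  \<open>- grad q\<close>, without the factors \<open>\<eta>\<close> and
  \<open>\<delta>t\<close>.\<close>

definition diffusion_flux :: "((real^'d) set \<Rightarrow> real) \<Rightarrow> (real^'d) set \<Rightarrow> 'd \<Rightarrow> bool \<Rightarrow> real" where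
  "diffusion_flux q K i s =
    (if (K, i, s) \<in> ifaces then area i (face K i s) * transm K i s * (q K - q (nb K i s)) else 0)"

text \<open>The superlevel argument with \<open>B = 0\<close>: a bounded discrete Laplacian bounds
  every jump and hence the oscillation. Constants have zero Laplacian, so only differences can be
  bounded. \<open>c\<close> depends on the mesh alone.\<close>

lemma poisson_stability:
  obtains c :: real where "0 \<le> c"
    "\<And>q b K L. \<lbrakk>\<And>K. K \<in> M \<Longrightarrow> \<bar>\<Sum>i\<in>UNIV. \<Sum>s\<in>UNIV. diffusion_flux q K i s\<bar> \<le> b; 0 \<le> b; K \<in> M; L \<in> M\<rbrakk>
       \<Longrightarrow> \<bar>q K - q L\<bar> \<le> c * b"
proof -
  obtain a where a: "0 < a" "\<And>K i s. (K, i, s) \<in> ifaces \<Longrightarrow> a \<le> area i (face K i s) * transm K i s"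
    using transmissibility_bound by blast
  obtain c0 :: real where c0: "0 \<le> c0" "\<And>q b K L. \<lbrakk>\<And>K i s. (K, i, s) \<in> ifaces \<Longrightarrow> \<bar>q K - q (nb K i s)\<bar> \<le> b; 0 \<le> b; K \<in> M; L \<in> M\<rbrakk>
       \<Longrightarrow> \<bar>q K - q L\<bar> \<le> c0 * b" using oscillation_bound by blast
  \<comment> \<open>\<open>jump_bound\<close> adds the bound \<open>b\<close> over all cells and
    divides by the least face coefficient; \<open>c0\<close> passes from jumps to
    oscillation.\<close>
  define c where "c = c0 * (real (card M) / a)"
  have "\<bar>q K - q L\<bar> \<le> c * b"
    if q: "\<And>K. K \<in> M \<Longrightarrow> \<bar>\<Sum>i\<in>UNIV. \<Sum>s\<in>UNIV. diffusion_flux q K i s\<bar> \<le> b" "0 \<le> b" "K \<in> M" "L \<in> M" for q b K L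
  proof -
    let ?G = "diffusion_flux q"
    have "\<bar>q K - q (nb K i s)\<bar> \<le> real (card M) / a * b" if f: "(K, i, s) \<in> ifaces" for K i s
    proof -
      have "a * \<bar>q K - q (nb K i s)\<bar> \<le> (\<Sum>K\<in>M. b) + real (card ifaces) * 0"
      proof (rule jump_bound[where G="?G", OF _ _ _ _ _ _ _ f])
        fix K i s assume f: "(K, i, s) \<in> ifaces"
        then have KM: "K \<in> M" "face K i s \<in> int_edges i" by (auto simp: ifaces_def)
        show "?G (nb K i s) i (\<not> s) = - ?G K i s"
          using f ifaces_flip[OF f] unfolding diffusion_flux_def nb(3)[OF KM] nb(4)[OF KM] by (simp add: right_diff_distrib diff_divide_distrib)
        show "a * (q K - q (nb K i s)) - 0 \<le> ?G K i s" if "q (nb K i s) < q K"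
          using f a(2)[OF f] that mult_right_mono[of a "area i (face K i s) * transm K i s" "q K - q (nb K i s)"]
          by (simp add: diffusion_flux_def)
      next
        fix K assume "K \<in> M"
        show "(\<Sum>i\<in>UNIV. \<Sum>s\<in>UNIV. ?G K i s) \<le> b" by (rule abs_le_D1[OF q(1)[OF \<open>K \<in> M\<close>]])
      qed (use a \<open>0 \<le> b\<close> in \<open>auto simp: diffusion_flux_def\<close>)
      then show ?thesis using a(1) by (simp add: field_simps)
    qed
    then have "\<bar>q K - q L\<bar> \<le> c0 * (real (card M) / a * b)"
      by (rule c0(2)) (use that(2-4) a in auto)
    then show ?thesis by (simp add: c_def)
  qed
  then show ?thesis using that[of c] c0(1) a(1) by (simp add: c_def)
qed

end

section \<open>The low Mach number limit\<close>

text \<open>These assumptions pass to subsequences. Convergence of the initial velocities is among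
  them; data that are merely bounded are treated by instantiating the locale along suitable
  subsequences.\<close>

locale low_mach_sequence = mac_grid \<Omega> M
  for \<Omega> :: "(real^'d) set" and M +
  fixes \<gamma> \<eta> \<delta>t :: real and N :: nat and \<epsilon> :: "nat \<Rightarrow> real"
    and \<rho> :: "nat \<Rightarrow> nat \<Rightarrow> (real^'d) set \<Rightarrow> real"
    and u :: "nat \<Rightarrow> nat \<Rightarrow> 'd \<times> (real^'d) set \<Rightarrow> real"
  assumes \<gamma>: "1 \<le> \<gamma>" and \<eta>: "0 < \<eta>" and \<delta>t: "0 < \<delta>t"
    and \<epsilon>_pos: "\<And>k. 0 < \<epsilon> k" and \<epsilon>_lim: "\<epsilon> \<longlonglongrightarrow> 0"
    and velocity_space: "\<And>k n. n \<le> N \<Longrightarrow> u k n \<in> H_E0"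
    and density_pos: "\<And>k n K. n \<le> N \<Longrightarrow> K \<in> M \<Longrightarrow> 0 < \<rho> k n K"
    and mass_balance: "\<And>k n K. n < N \<Longrightarrow> K \<in> M \<Longrightarrow>
      (\<rho> k (Suc n) K - \<rho> k n K) / \<delta>t +
      (\<Sum>i\<in>UNIV. \<Sum>s\<in>UNIV. flux (\<rho> k (Suc n)) (u k n) (vel_corr \<gamma> \<eta> (\<epsilon> k) \<delta>t (\<rho> k (Suc n))) i (face K i s) K)
        / measure lebesgue K = 0"
    and momentum_balance: "\<And>k n i \<sigma>. n < N \<Longrightarrow> \<sigma> \<in> int_edges i \<Longrightarrow>
      (dual_value (\<rho> k (Suc n)) i \<sigma> * u k (Suc n) (i, \<sigma>) - dual_value (\<rho> k n) i \<sigma> * u k n (i, \<sigma>)) / \<delta>t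
      + convection (flux (\<rho> k (Suc n)) (u k n) (vel_corr \<gamma> \<eta> (\<epsilon> k) \<delta>t (\<rho> k (Suc n)))) (u k n) i \<sigma>
      + grad (pressure \<gamma> (\<rho> k (Suc n))) (i, \<sigma>) / (\<epsilon> k)\<^sup>2 = 0"
    and stability: "\<And>k n i \<sigma>. n < N \<Longrightarrow> \<sigma> \<in> int_edges i \<Longrightarrow> 1 / dual_value (\<rho> k (Suc n)) i \<sigma> \<le> \<eta>"
    and initial_density: "\<And>K. K \<in> M \<Longrightarrow> (\<lambda>k. \<rho> k 0 K) \<longlonglongrightarrow> 1"
    and initial_velocity: "\<And>e. convergent (\<lambda>k. u k 0 e)"
begin

abbreviation P :: "nat \<Rightarrow> nat \<Rightarrow> (real^'d) set \<Rightarrow> real" where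
  "P k n \<equiv> pressure \<gamma> (\<rho> k n)"

abbreviation \<pi> :: "nat \<Rightarrow> nat \<Rightarrow> (real^'d) set \<Rightarrow> real" where
  "\<pi> k n \<equiv> pressure_fluct \<gamma> (\<epsilon> k) (\<rho> k n)"

abbreviation \<delta>u :: "nat \<Rightarrow> nat \<Rightarrow> 'd \<times> (real^'d) set \<Rightarrow> real" where
  "\<delta>u k n \<equiv> vel_corr \<gamma> \<eta> (\<epsilon> k) \<delta>t (\<rho> k n)"

abbreviation mass_flux :: "nat \<Rightarrow> nat \<Rightarrow> 'd \<Rightarrow> (real^'d) set \<Rightarrow> (real^'d) set \<Rightarrow> real" where
  "mass_flux k n \<equiv> flux (\<rho> k (Suc n)) (u k n) (\<delta>u k (Suc n))"

lemma grad_pressure: "grad (P k n) e / (\<epsilon> k)\<^sup>2 = grad (\<pi> k n) e"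
proof -
  have "grad (\<pi> k n) e = (1 / (\<epsilon> k)\<^sup>2) * grad (P k n) e"
    by (rule grad_cong_const[where b = "(\<integral>x. cell_fun (P k n) x \<partial>lebesgue_on \<Omega>) / measure lebesgue \<Omega>"])
       (simp add: pressure_fluct_def)
  then show ?thesis by simp
qed

lemma vel_corr_eq: "\<delta>u k n = (\<lambda>e. \<eta> * \<delta>t * grad (\<pi> k n) e)"
  unfolding vel_corr_def grad_pressure[symmetric] by auto

lemma \<pi>_diff: "K \<in> M \<Longrightarrow> L \<in> M \<Longrightarrow> \<pi> k n K - \<pi> k n L = (P k n K - P k n L) / (\<epsilon> k)\<^sup>2"
  by (simp add: pressure_fluct_def diff_divide_distrib)

section \<open>Mass balance and pressure jumps\<close>

lemma total_flux:
  assumes "n < N" "K \<in> M"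
  shows "(\<Sum>i\<in>UNIV. \<Sum>s\<in>UNIV. mass_flux k n i (face K i s) K) =
    measure lebesgue K * (\<rho> k n K - \<rho> k (Suc n) K) / \<delta>t"
  using mass_balance[OF assms, of k] cell_measure_pos[OF assms(2)] \<delta>t by (simp add: field_simps)

text \<open>No internal face leads out of the whole mesh. The mass is weighted by the full cell
  volumes, as in the scheme, and these need not be proportional to the weights in
  \<open>mean_weights\<close>.\<close>

lemma mass_conserved:
  assumes "n < N"
  shows "(\<Sum>K\<in>M. measure lebesgue K * \<rho> k (Suc n) K) = (\<Sum>K\<in>M. measure lebesgue K * \<rho> k n K)"
proof -
  have empty: "{(K, i, s) \<in> ifaces. K \<in> M \<and> nb K i s \<notin> M} = {}"
    using nb(1) by (auto simp: ifaces_def)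
  have "(\<Sum>K\<in>M. \<Sum>i\<in>UNIV. \<Sum>s\<in>UNIV. mass_flux k n i (face K i s) K) = 0"
    using boundary_sum[where G="\<lambda>K i s. mass_flux k n i (face K i s) K" and A=M, unfolded empty]
      flux_flip flux_external by simp
  then have "(\<Sum>K\<in>M. measure lebesgue K * (\<rho> k n K - \<rho> k (Suc n) K) / \<delta>t) = 0"
    using total_flux[OF assms] by simp
  then have "(\<Sum>K\<in>M. measure lebesgue K * (\<rho> k n K - \<rho> k (Suc n) K)) / \<delta>t = 0"
    by (simp add: sum_divide_distrib)
  then show ?thesis using \<delta>t by (simp add: right_diff_distrib sum_subtractf)
qed

lemma velocity_bounded:
  assumes "n \<le> N" "\<And>e. convergent (\<lambda>k. u k n e)"
  obtains U where "0 \<le> U" "\<And>k e. \<bar>u k n e\<bar> \<le> U"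
proof -
  have "\<forall>e. \<exists>B. \<forall>k. \<bar>u k n e\<bar> \<le> B"
    using convergent_imp_Bseq[OF assms(2)] by (metis BseqE real_norm_def)
  then obtain B where B: "\<And>e k. \<bar>u k n e\<bar> \<le> B e" by metis
  then have B0: "0 \<le> B e" for e by (meson abs_ge_zero order_trans)
  let ?E = "Sigma UNIV int_edges"
  have fin: "finite ?E" using finite_int_edges by auto
  have "\<bar>u k n e\<bar> \<le> (\<Sum>e\<in>?E. B e)" for k e
  proof (cases "e \<in> ?E")
    case True
    then have "B e \<le> (\<Sum>e\<in>?E. B e)" using fin B0 by (intro member_le_sum) auto
    then show ?thesis using B[of k e] by simp
  next
    case False
    then have "u k n e = 0" using velocity_space[OF assms(1), of k] by (cases e) (auto simp: H_E0_def)
    then show ?thesis using B0 by (simp add: sum_nonneg)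
  qed
  then show ?thesis by (rule that[rotated]) (simp add: sum_nonneg B0)
qed

lemma outward_vel_corr:
  assumes "(K, i, s) \<in> ifaces"
  shows "outward (\<delta>u k n) i (face K i s) K =
    \<eta> * \<delta>t / (\<epsilon> k)\<^sup>2 * (transm K i s * (P k n (nb K i s) - P k n K))"
proof -
  have "\<delta>u k n = (\<lambda>e. \<eta> * \<delta>t / (\<epsilon> k)\<^sup>2 * grad (P k n) e)" by (simp add: vel_corr_def fun_eq_iff)
  then show ?thesis by (simp only: outward_scale outward_grad[OF assms])
qed

text \<open>Stability condition (i) bounds the density of the cell with the larger pressure from below,
  so that the correction flux controls the pressure jump at every face.\<close>

lemma flux_lower_bound:
  assumes "n < N" "(K, i, s) \<in> ifaces" "P k (Suc n) (nb K i s) < P k (Suc n) K"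
    and U: "\<And>e. \<bar>u k n e\<bar> \<le> U" and R: "\<And>K. K \<in> M \<Longrightarrow> \<rho> k (Suc n) K \<le> R"
  shows "area i (face K i s) * transm K i s * \<delta>t / (\<epsilon> k)\<^sup>2 * (P k (Suc n) K - P k (Suc n) (nb K i s))
           - area i (face K i s) * R * U \<le> mass_flux k n i (face K i s) K"
proof -
  have K: "K \<in> M" "face K i s \<in> int_edges i" using assms(2) by (auto simp: ifaces_def)
  define L where "L = nb K i s"
  have L: "L \<in> M" using nb(1)[OF K] by (simp add: L_def)
  define A t x y where "A = area i (face K i s)" and "t = transm K i s"
    and "x = outward (u k n) i (face K i s) K" and "y = outward (\<delta>u k (Suc n)) i (face K i s) K"
  define d where "d = t * \<delta>t / (\<epsilon> k)\<^sup>2 * (P k (Suc n) K - P k (Suc n) L)"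
  let ?r = "\<rho> k (Suc n)"
  have pos: "0 < ?r K" "0 < ?r L" using density_pos assms(1) K L by auto
  have "0 < A" "0 < t" using area_face_pos[OF K(1)] trans_pos[OF assms(2)] by (auto simp: A_def t_def)
  have "\<bar>x\<bar> \<le> U" using U[of "(i, face K i s)"] K(1) by (auto simp: x_def outward_eq)
  have "?r L \<le> ?r K"
  proof (rule ccontr)
    assume "\<not> ?r L \<le> ?r K"
    then have "P k (Suc n) K \<le> P k (Suc n) L"
      unfolding pressure_def using pos \<gamma> by (intro powr_mono2) auto
    then show False using assms(3) by (simp add: L_def)
  qed
  then have "dual_value ?r i (face K i s) \<le> ?r K"
    by (intro dual_value_le[OF assms(2)]) (simp add: L_def)
  moreover have "0 < dual_value ?r i (face K i s)"
    using density_pos assms(1) by (intro dual_value_pos[OF assms(2)]) auto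
  then have "1 \<le> \<eta> * dual_value ?r i (face K i s)"
    using stability[OF assms(1) K(2), of k] by (simp add: field_simps)
  ultimately have "1 \<le> \<eta> * ?r K"
    using \<eta> by (meson less_eq_real_def mult_left_mono order_trans)
  have y: "y = - \<eta> * d" unfolding y_def outward_vel_corr[OF assms(2)] d_def t_def L_def
    by (simp add: algebra_simps diff_divide_distrib)
  have "0 \<le> d" using assms(3) \<open>0 < t\<close> \<delta>t unfolding d_def L_def by (intro mult_nonneg_nonneg divide_nonneg_nonneg) auto
  \<comment> \<open>As the pressure drops outward, the whole correction sits in
    \<open>neg_part y\<close> and is weighted by the density of \<open>K\<close>. The density of
    \<open>L\<close> only meets the negative part of the velocity, which \<open>R * U\<close>
    absorbs.\<close>
  have parts: "pos_part y = 0" "neg_part y = - \<eta> * d"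
    using y \<eta> \<open>0 \<le> d\<close> by (auto simp: pos_part_def neg_part_def abs_mult)
  have flux: "mass_flux k n i (face K i s) K = A * (?r K * (pos_part x + \<eta> * d) + ?r L * neg_part x)"
    unfolding flux_eq[OF assms(2)] using parts by (simp add: A_def x_def[symmetric] y_def[symmetric] L_def)
  have "0 \<le> ?r K * pos_part x" using pos by (simp add: pos_part_def)
  moreover have "d \<le> ?r K * (\<eta> * d)"
    using mult_right_mono[OF \<open>1 \<le> \<eta> * ?r K\<close> \<open>0 \<le> d\<close>] by (simp add: algebra_simps)
  moreover have "- (R * U) \<le> ?r L * neg_part x"
  proof -
    have "- neg_part x \<le> U" "0 \<le> - neg_part x"
      using \<open>\<bar>x\<bar> \<le> U\<close> by (auto simp: neg_part_def abs_if field_simps split: if_splits)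
    then have "?r L * (- neg_part x) \<le> R * U"
      using R[OF L] pos(2) by (intro mult_mono) auto
    then show ?thesis by simp
  qed
  ultimately have "d - R * U \<le> ?r K * (pos_part x + \<eta> * d) + ?r L * neg_part x"
    unfolding distrib_left by linarith
  then have "A * (d - R * U) \<le> mass_flux k n i (face K i s) K"
    unfolding flux using \<open>0 < A\<close> by (intro mult_left_mono) auto
  then show ?thesis by (simp add: d_def A_def t_def L_def algebra_simps)
qed

text \<open>\<open>jump_bound\<close> is applied to the mass flux and the pressure, with the outflow
  bounded by the old mass. The coefficient of the jumps carries
  \<open>1 / \<epsilon>\<^sup>2\<close>; all other constants are uniform in \<open>k\<close>, since
  masses and velocities at level \<open>n\<close> converge.\<close>

lemma pressure_jump:
  assumes "n < N" and hu: "\<And>e. convergent (\<lambda>k. u k n e)"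
    and h\<rho>: "\<And>K. K \<in> M \<Longrightarrow> (\<lambda>k. \<rho> k n K) \<longlonglongrightarrow> 1"
  obtains C where "0 \<le> C"
    "\<And>k K i s. (K, i, s) \<in> ifaces \<Longrightarrow> \<bar>P k (Suc n) K - P k (Suc n) (nb K i s)\<bar> \<le> C * (\<epsilon> k)\<^sup>2"
proof -
  obtain U where U: "0 \<le> U" "\<And>k e. \<bar>u k n e\<bar> \<le> U" using velocity_bounded[of n] assms by auto
  let ?m = "\<lambda>k. \<Sum>K\<in>M. measure lebesgue K * \<rho> k n K"
  have "?m \<longlonglongrightarrow> (\<Sum>K\<in>M. measure lebesgue K * 1)" by (intro tendsto_intros h\<rho>)
  then have "Bseq ?m" by (intro convergent_imp_Bseq) (auto simp: convergent_def)
  then obtain m where m: "0 < m" "\<forall>k. norm (?m k) \<le> m" by (rule BseqE)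
  have m': "?m k \<le> m" for k using spec[OF m(2), of k] by simp
  obtain \<kappa> where \<kappa>: "0 < \<kappa>" "\<And>K. K \<in> M \<Longrightarrow> \<kappa> \<le> measure lebesgue K"
    by (rule finite_lower_bound[OF finite_mesh, of "measure lebesgue"]) (use cell_measure_pos in auto)
  obtain a where a: "0 < a" "\<And>K i s. (K, i, s) \<in> ifaces \<Longrightarrow> a \<le> area i (face K i s) * transm K i s"
    using transmissibility_bound by blast
  define b where "b = (\<Sum>(K, i, s)\<in>ifaces. area i (face K i s))"
  have b: "area i (face K i s) \<le> b" if "(K, i, s) \<in> ifaces" for K i s
  proof -
    have "0 \<le> (case t of (K, i, s) \<Rightarrow> area i (face K i s))" if "t \<in> ifaces" for t
      using that area_face_pos by (cases t) (auto simp: ifaces_def less_imp_le)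
    then show ?thesis
      using member_le_sum[OF that, of "\<lambda>(K, i, s). area i (face K i s)"] finite_ifaces by (auto simp: b_def)
  qed
  have "0 \<le> b" unfolding b_def using area_face_pos
    by (intro sum_nonneg) (auto simp: ifaces_def less_imp_le)
  \<comment> \<open>Positivity and conserved mass: no density exceeds the total mass divided by a
    lower bound of the cell volumes.\<close>
  define R where "R = m / \<kappa>"
  have R: "\<rho> k (Suc n) K \<le> R" if "K \<in> M" for k K
  proof -
    have pos: "0 < \<rho> k (Suc n) K'" if "K' \<in> M" for K' using density_pos[of "Suc n" K'] assms(1) that by simp
    have "\<kappa> * \<rho> k (Suc n) K \<le> measure lebesgue K * \<rho> k (Suc n) K"
      using \<kappa>(2)[OF that] pos[OF that] by (intro mult_right_mono) auto
    also have "\<dots> \<le> (\<Sum>K\<in>M. measure lebesgue K * \<rho> k (Suc n) K)"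
      using that finite_mesh pos
      by (intro member_le_sum[where f="\<lambda>K. measure lebesgue K * \<rho> k (Suc n) K"]) (auto simp: less_imp_le)
    also have "\<dots> \<le> m" using m'[of k] mass_conserved[OF assms(1), of k] by simp
    finally show ?thesis using \<kappa>(1) by (simp add: R_def field_simps)
  qed
  have "0 \<le> R" using m \<kappa> by (simp add: R_def)
  \<comment> \<open>Old mass per time step, plus for every face the most that the velocity can draw
    in from the neighbour.\<close>
  define Q where "Q = m / \<delta>t + real (card ifaces) * (b * R * U)"
  have "0 \<le> Q" unfolding Q_def using m \<delta>t \<open>0 \<le> b\<close> \<open>0 \<le> R\<close> U by simp
  have jump: "\<bar>P k (Suc n) K - P k (Suc n) (nb K i s)\<bar> \<le> Q / (a * \<delta>t) * (\<epsilon> k)\<^sup>2" if "(K, i, s) \<in> ifaces" for k K i s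
  proof -
    let ?q = "P k (Suc n)"
    have "a * \<delta>t / (\<epsilon> k)\<^sup>2 * \<bar>?q K - ?q (nb K i s)\<bar> \<le>
      (\<Sum>K\<in>M. measure lebesgue K * \<rho> k n K / \<delta>t) + real (card ifaces) * (b * R * U)"
    proof (rule jump_bound[where G="\<lambda>K i s. mass_flux k n i (face K i s) K"])
      fix K i s assume f: "(K, i, s) \<in> ifaces" "?q (nb K i s) < ?q K"
      have "a * \<delta>t / (\<epsilon> k)\<^sup>2 * (?q K - ?q (nb K i s)) \<le>
          area i (face K i s) * transm K i s * \<delta>t / (\<epsilon> k)\<^sup>2 * (?q K - ?q (nb K i s))"
        using a(2)[OF f(1)] f(2) \<delta>t by (intro mult_right_mono divide_right_mono) auto
      moreover have "area i (face K i s) * R * U \<le> b * R * U"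
        using b[OF f(1)] \<open>0 \<le> R\<close> U by (intro mult_right_mono) auto
      ultimately show "a * \<delta>t / (\<epsilon> k)\<^sup>2 * (?q K - ?q (nb K i s)) - b * R * U \<le> mass_flux k n i (face K i s) K"
        using flux_lower_bound[OF assms(1) f U(2) R] by linarith
    next
      fix K assume "K \<in> M"
      \<comment> \<open>The new mass is positive and is dropped; the old one plays the role of
        \<open>D\<close>.\<close>
      show "(\<Sum>i\<in>UNIV. \<Sum>s\<in>UNIV. mass_flux k n i (face K i s) K) \<le> measure lebesgue K * \<rho> k n K / \<delta>t"
        unfolding total_flux[OF assms(1) \<open>K \<in> M\<close>]
        using \<delta>t density_pos[of "Suc n" K] assms(1) \<open>K \<in> M\<close>
        by (intro divide_right_mono mult_left_mono) (auto intro: less_imp_le)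
      show "0 \<le> measure lebesgue K * \<rho> k n K / \<delta>t"
        using \<delta>t density_pos[of n K k] assms(1) \<open>K \<in> M\<close> by simp
    next
      show "0 \<le> b * R * U" using \<open>0 \<le> b\<close> \<open>0 \<le> R\<close> U by simp
    qed (use flux_flip flux_external that a \<delta>t in auto)
    also have "\<dots> \<le> Q" using m'[of k] \<delta>t
      by (simp add: Q_def sum_divide_distrib[symmetric] divide_right_mono)
    finally show ?thesis using a(1) \<delta>t \<epsilon>_pos[of k] by (simp add: field_simps)
  qed
  show ?thesis
    by (rule that[of "Q / (a * \<delta>t)"]) (use jump \<open>0 \<le> Q\<close> a \<delta>t in auto)
qed

text \<open>Nearly equal pressures do not fix the level of the density; conserved mass does. The
  mean density \<open>r k\<close> is inherited from level \<open>n\<close> and tends to 1. Some cell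
  lies at or below it and some cell at or above, so \<open>r k powr \<gamma>\<close> lies between
  two cell pressures, and all cell pressures agree up to a multiple of
  \<open>\<epsilon>\<^sup>2\<close>.\<close>

lemma density_step:
  assumes "n < N" and hu: "\<And>e. convergent (\<lambda>k. u k n e)"
    and h\<rho>: "\<And>K. K \<in> M \<Longrightarrow> (\<lambda>k. \<rho> k n K) \<longlonglongrightarrow> 1"
    and "K \<in> M"
  shows "(\<lambda>k. \<rho> k (Suc n) K) \<longlonglongrightarrow> 1"
proof -
  obtain C where C: "0 \<le> C"
    "\<And>k K i s. (K, i, s) \<in> ifaces \<Longrightarrow> \<bar>P k (Suc n) K - P k (Suc n) (nb K i s)\<bar> \<le> C * (\<epsilon> k)\<^sup>2"
    using pressure_jump[OF assms(1) hu h\<rho>] by blast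
  obtain c :: real where c: "0 \<le> c" "\<And>q b K L. \<lbrakk>\<And>K i s. (K, i, s) \<in> ifaces \<Longrightarrow> \<bar>q K - q (nb K i s)\<bar> \<le> b; 0 \<le> b; K \<in> M; L \<in> M\<rbrakk>
       \<Longrightarrow> \<bar>q K - q L\<bar> \<le> c * b" using oscillation_bound by blast
  have osc: "\<bar>P k (Suc n) K - P k (Suc n) L\<bar> \<le> c * (C * (\<epsilon> k)\<^sup>2)" if "K \<in> M" "L \<in> M" for k K L
    by (rule c(2)[OF C(2)]) (use that C(1) in auto)
  define V where "V = (\<Sum>K\<in>M. measure lebesgue K)"
  have "0 < V" unfolding V_def using finite_mesh mesh_nonempty cell_measure_pos by (intro sum_pos) auto
  define r where "r k = (\<Sum>K\<in>M. measure lebesgue K * \<rho> k n K) / V" for k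
  have r_pos: "0 < r k" for k unfolding r_def
    using finite_mesh mesh_nonempty cell_measure_pos density_pos[of n] assms(1) \<open>0 < V\<close>
    by (intro divide_pos_pos sum_pos) auto
  have mass: "(\<Sum>K\<in>M. measure lebesgue K * (\<rho> k (Suc n) K - r k)) = 0" for k
  proof -
    have "(\<Sum>K\<in>M. measure lebesgue K * r k) = V * r k" by (simp add: V_def sum_distrib_right)
    also have "\<dots> = (\<Sum>K\<in>M. measure lebesgue K * \<rho> k n K)" using \<open>0 < V\<close> by (simp add: r_def)
    finally show ?thesis
      using mass_conserved[OF assms(1), of k] by (simp add: right_diff_distrib sum_subtractf)
  qed
  have below: "\<exists>L\<in>M. \<rho> k (Suc n) L \<le> r k" for k
  proof (rule ccontr)
    assume "\<not> ?thesis"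
    then have "0 < (\<Sum>K\<in>M. measure lebesgue K * (\<rho> k (Suc n) K - r k))"
      using finite_mesh mesh_nonempty cell_measure_pos by (intro sum_pos) (auto simp: not_le)
    then show False using mass by simp
  qed
  have above: "\<exists>L\<in>M. r k \<le> \<rho> k (Suc n) L" for k
  proof (rule ccontr)
    assume "\<not> ?thesis"
    then have "0 < (\<Sum>K\<in>M. - (measure lebesgue K * (\<rho> k (Suc n) K - r k)))"
      using finite_mesh mesh_nonempty cell_measure_pos
      by (intro sum_pos) (auto simp: not_le mult_less_0_iff mult_pos_neg)
    then show False using mass by (simp add: sum_negf)
  qed
  have close: "\<bar>P k (Suc n) K - r k powr \<gamma>\<bar> \<le> c * (C * (\<epsilon> k)\<^sup>2)" for k
  proof -
    obtain L L' where L: "L \<in> M" "\<rho> k (Suc n) L \<le> r k" "L' \<in> M" "r k \<le> \<rho> k (Suc n) L'"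
      using below above by meson
    have "P k (Suc n) L \<le> r k powr \<gamma>" "r k powr \<gamma> \<le> P k (Suc n) L'"
      unfolding pressure_def using L \<gamma> r_pos[of k] density_pos[of "Suc n" L] assms(1)
      by (auto intro!: powr_mono2 intro: less_imp_le)
    then show ?thesis using osc[OF \<open>K \<in> M\<close> L(1), of k] osc[OF \<open>K \<in> M\<close> L(3), of k] by linarith
  qed
  have "r \<longlonglongrightarrow> (\<Sum>K\<in>M. measure lebesgue K * 1) / V"
    unfolding r_def by (intro tendsto_intros h\<rho>) (use \<open>0 < V\<close> in auto)
  then have "r \<longlonglongrightarrow> 1" using \<open>0 < V\<close> by (simp add: V_def[symmetric])
  then have rlim: "(\<lambda>k. r k powr \<gamma>) \<longlonglongrightarrow> 1 powr \<gamma>" by (intro tendsto_powr) auto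
  have "(\<lambda>k. c * (C * (\<epsilon> k)\<^sup>2)) \<longlonglongrightarrow> c * (C * 0\<^sup>2)" by (intro tendsto_intros \<epsilon>_lim)
  then have "(\<lambda>k. c * (C * (\<epsilon> k)\<^sup>2)) \<longlonglongrightarrow> 0" by simp
  then have "(\<lambda>k. P k (Suc n) K - r k powr \<gamma>) \<longlonglongrightarrow> 0"
    by (rule Lim_null_comparison[rotated]) (use close in auto)
  from tendsto_add[OF this rlim] have "(\<lambda>k. P k (Suc n) K) \<longlonglongrightarrow> 1" by simp
  then have "(\<lambda>k. P k (Suc n) K powr (1 / \<gamma>)) \<longlonglongrightarrow> 1 powr (1 / \<gamma>)" by (intro tendsto_powr) auto
  moreover have "P k (Suc n) K powr (1 / \<gamma>) = \<rho> k (Suc n) K" for k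
    using \<gamma> density_pos[of "Suc n" K k] assms(1,4) by (simp add: pressure_def powr_powr)
  ultimately show ?thesis by simp
qed

lemma \<pi>_jump:
  assumes "n < N" "\<And>e. convergent (\<lambda>k. u k n e)" "\<And>K. K \<in> M \<Longrightarrow> (\<lambda>k. \<rho> k n K) \<longlonglongrightarrow> 1"
  obtains C where "0 \<le> C"
    "\<And>k K i s. (K, i, s) \<in> ifaces \<Longrightarrow> \<bar>\<pi> k (Suc n) K - \<pi> k (Suc n) (nb K i s)\<bar> \<le> C"
proof -
  obtain C where C: "0 \<le> C"
    "\<And>k K i s. (K, i, s) \<in> ifaces \<Longrightarrow> \<bar>P k (Suc n) K - P k (Suc n) (nb K i s)\<bar> \<le> C * (\<epsilon> k)\<^sup>2"
    using pressure_jump[OF assms] by blast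
  have "\<bar>\<pi> k (Suc n) K - \<pi> k (Suc n) (nb K i s)\<bar> \<le> C" if "(K, i, s) \<in> ifaces" for k K i s
  proof -
    have "K \<in> M" "nb K i s \<in> M" using that nb(1) by (auto simp: ifaces_def)
    then show ?thesis using C(2)[OF that, of k] \<epsilon>_pos[of k]
      by (simp add: \<pi>_diff abs_divide pos_divide_le_eq)
  qed
  then show ?thesis using that C(1) by blast
qed

text \<open>The mass balance expresses the discrete Laplacian of \<open>\<pi>\<close> by the divergence of the velocity, up
  to terms which vanish because the densities tend to 1.\<close>

lemma laplacian_convergent:
  assumes "n < N" and hu: "\<And>e. convergent (\<lambda>k. u k n e)"
    and h\<rho>: "\<And>K. K \<in> M \<Longrightarrow> (\<lambda>k. \<rho> k n K) \<longlonglongrightarrow> 1"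
    and "K \<in> M"
  shows "convergent (\<lambda>k. \<Sum>i\<in>UNIV. \<Sum>s\<in>UNIV. diffusion_flux (\<pi> k (Suc n)) K i s)"
proof -
  obtain U where U: "0 \<le> U" "\<And>k e. \<bar>u k n e\<bar> \<le> U" using velocity_bounded[of n] assms by auto
  obtain C where C: "0 \<le> C"
    "\<And>k K i s. (K, i, s) \<in> ifaces \<Longrightarrow> \<bar>\<pi> k (Suc n) K - \<pi> k (Suc n) (nb K i s)\<bar> \<le> C"
    using \<pi>_jump[OF assms(1) hu h\<rho>] by blast
  let ?r = "\<lambda>k. \<rho> k (Suc n)"
  define x y where "x k i s = outward (u k n) i (face K i s) K"
    and "y k i s = outward (\<delta>u k (Suc n)) i (face K i s) K" for k i s
  define p m where "p k i s = pos_part (x k i s) - neg_part (y k i s)"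
    and "m k i s = neg_part (x k i s) - pos_part (y k i s)" for k i s
  \<comment> \<open>The mass flux consists of \<open>X\<close>, the transport by \<open>u\<close> at
    density 1, of the correction at density 1, and of \<open>E\<close>, the error made by replacing
    both densities by 1.\<close>
  define X where "X k i s = (if (K, i, s) \<in> ifaces then area i (face K i s) * x k i s else 0)" for k i s
  define E where "E k i s = (if (K, i, s) \<in> ifaces then area i (face K i s) *
      ((?r k K - 1) * p k i s + (?r k (nb K i s) - 1) * m k i s) else 0)" for k i s
  have decomp: "\<eta> * \<delta>t * diffusion_flux (\<pi> k (Suc n)) K i s =
      mass_flux k n i (face K i s) K - X k i s - E k i s" for k i s
  proof (cases "(K, i, s) \<in> ifaces")
    case True
    have y: "y k i s = \<eta> * \<delta>t * (transm K i s * (\<pi> k (Suc n) (nb K i s) - \<pi> k (Suc n) K))"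
      unfolding y_def vel_corr_eq outward_scale outward_grad[OF True] by simp
    have "p k i s + m k i s = x k i s - y k i s"
      by (simp add: p_def m_def pos_part_def neg_part_def field_simps)
    then have "area i (face K i s) * (p k i s + m k i s) = area i (face K i s) * (x k i s - y k i s)" by simp
    moreover have "mass_flux k n i (face K i s) K = area i (face K i s) * (?r k K * p k i s + ?r k (nb K i s) * m k i s)"
      unfolding flux_eq[OF True] p_def m_def x_def y_def ..
    moreover have "\<eta> * \<delta>t * diffusion_flux (\<pi> k (Suc n)) K i s = - (area i (face K i s) * y k i s)"
      using True unfolding y diffusion_flux_def by (simp add: algebra_simps)
    ultimately show ?thesis using True by (simp add: X_def E_def algebra_simps)
  next
    case False
    then show ?thesis using assms(4) by (simp add: diffusion_flux_def X_def E_def flux_external)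
  qed
  \<comment> \<open>Old and new densities both tend to 1, so the increment of mass disappears in the
    limit.\<close>
  have F: "(\<lambda>k. \<Sum>i\<in>UNIV. \<Sum>s\<in>UNIV. mass_flux k n i (face K i s) K) \<longlonglongrightarrow> measure lebesgue K * (1 - 1) / \<delta>t"
    unfolding total_flux[OF assms(1,4)]
    by (intro tendsto_intros h\<rho> density_step[OF assms(1) hu h\<rho>] assms(4)) (use \<delta>t in auto)
  have Xlim: "\<exists>l. (\<lambda>k. X k i s) \<longlonglongrightarrow> l" for i s
  proof -
    obtain l where "(\<lambda>k. u k n (i, face K i s)) \<longlonglongrightarrow> l" using hu unfolding convergent_def by blast
    then have "(\<lambda>k. x k i s) \<longlonglongrightarrow> l * (axis i 1 \<bullet> normal (face K i s) K)"
      unfolding x_def outward_def by (intro tendsto_intros)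
    then show ?thesis unfolding X_def by (cases "(K, i, s) \<in> ifaces") (auto intro: tendsto_mult_left)
  qed
  then obtain Xl where Xl: "\<And>i s. (\<lambda>k. X k i s) \<longlonglongrightarrow> Xl i s" by metis
  have Elim: "(\<lambda>k. E k i s) \<longlonglongrightarrow> 0" for i s
  proof (cases "(K, i, s) \<in> ifaces")
    case True
    then have nbM: "nb K i s \<in> M" using nb(1) by (auto simp: ifaces_def)
    \<comment> \<open>Both upwind parts are bounded by the absolute values of \<open>x\<close> and
      \<open>y\<close> together, and the bounded jumps of the fluctuation control
      \<open>y\<close>.\<close>
    define B where "B = U + \<eta> * \<delta>t * (transm K i s * C)"
    have xb: "\<bar>x k i s\<bar> \<le> U" for k using U(2)[of k "(i, face K i s)"] assms(4) by (auto simp: x_def outward_eq)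
    have yb: "\<bar>y k i s\<bar> \<le> \<eta> * \<delta>t * (transm K i s * C)" for k
    proof -
      have "\<bar>y k i s\<bar> = \<bar>\<eta>\<bar> * \<bar>\<delta>t\<bar> * (\<bar>transm K i s\<bar> * \<bar>\<pi> k (Suc n) (nb K i s) - \<pi> k (Suc n) K\<bar>)"
        unfolding y_def vel_corr_eq outward_scale outward_grad[OF True] abs_mult ..
      also have "\<dots> = \<eta> * \<delta>t * (transm K i s * \<bar>\<pi> k (Suc n) K - \<pi> k (Suc n) (nb K i s)\<bar>)"
        unfolding abs_of_pos[OF \<eta>] abs_of_pos[OF \<delta>t] abs_of_pos[OF trans_pos[OF True]]
        by (simp only: abs_minus_commute)
      also have "\<dots> \<le> \<eta> * \<delta>t * (transm K i s * C)"
        using \<eta> \<delta>t trans_pos[OF True] C(2)[OF True] by (intro mult_left_mono) auto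
      finally show ?thesis .
    qed
    have parts: "\<bar>pos_part z\<bar> \<le> \<bar>z\<bar>" "\<bar>neg_part z\<bar> \<le> \<bar>z\<bar>" for z
      by (auto simp: pos_part_def neg_part_def abs_if)
    have pb: "\<bar>p k i s\<bar> \<le> B" "\<bar>m k i s\<bar> \<le> B" for k
      unfolding p_def m_def B_def
      by (intro order_trans[OF abs_triangle_ineq4 add_mono] order_trans[OF parts(1) xb] order_trans[OF parts(2) xb]
          order_trans[OF parts(1) yb] order_trans[OF parts(2) yb])+
    have null: "(\<lambda>k. (?r k L - 1) * z k) \<longlonglongrightarrow> 0" if "L \<in> M" "\<And>k. \<bar>z k\<bar> \<le> B" for L z
    proof -
      have "(\<lambda>k. \<bar>?r k L - 1\<bar> * B) \<longlonglongrightarrow> \<bar>1 - 1\<bar> * B"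
        by (intro tendsto_intros density_step[OF assms(1) hu h\<rho>] that)
      then have lim: "(\<lambda>k. \<bar>?r k L - 1\<bar> * B) \<longlonglongrightarrow> 0" by simp
      have "norm ((?r k L - 1) * z k) \<le> \<bar>?r k L - 1\<bar> * B" for k
        using that(2)[of k] by (simp add: abs_mult mult_left_mono)
      then show ?thesis by (intro Lim_null_comparison[OF always_eventually lim] allI)
    qed
    have "(\<lambda>k. area i (face K i s) * ((?r k K - 1) * p k i s + (?r k (nb K i s) - 1) * m k i s)) \<longlonglongrightarrow>
      area i (face K i s) * (0 + 0)"
      by (intro tendsto_mult_left tendsto_add null pb assms(4) nbM)
    then show ?thesis using True by (simp add: E_def)
  qed (simp add: E_def)
  have "(\<lambda>k. ((\<Sum>i\<in>UNIV. \<Sum>s\<in>UNIV. mass_flux k n i (face K i s) K) - (\<Sum>i\<in>UNIV. \<Sum>s\<in>UNIV. X k i s)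
      - (\<Sum>i\<in>UNIV. \<Sum>s\<in>UNIV. E k i s)) / (\<eta> * \<delta>t)) \<longlonglongrightarrow>
      (measure lebesgue K * (1 - 1) / \<delta>t - (\<Sum>i\<in>UNIV. \<Sum>s\<in>UNIV. Xl i s) - (\<Sum>i\<in>(UNIV::'d set). \<Sum>s\<in>(UNIV::bool set). 0)) / (\<eta> * \<delta>t)"
    by (intro tendsto_divide tendsto_diff tendsto_sum tendsto_const F Xl Elim) (use \<eta> \<delta>t in auto)
  moreover have "((\<Sum>i\<in>UNIV. \<Sum>s\<in>UNIV. mass_flux k n i (face K i s) K) - (\<Sum>i\<in>UNIV. \<Sum>s\<in>UNIV. X k i s)
      - (\<Sum>i\<in>UNIV. \<Sum>s\<in>UNIV. E k i s)) / (\<eta> * \<delta>t) = (\<Sum>i\<in>UNIV. \<Sum>s\<in>UNIV. diffusion_flux (\<pi> k (Suc n)) K i s)" for k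
    unfolding sum_subtractf[symmetric] decomp[symmetric] sum_distrib_left[symmetric] using \<eta> \<delta>t by simp
  ultimately show ?thesis unfolding convergent_def by auto
qed

text \<open>\<open>diffusion_flux\<close> is linear, so the difference of two members of the
  sequence has a small discrete Laplacian and mean zero. By \<open>poisson_stability\<close> the
  sequence is Cauchy, and the limit problem need not be solved beforehand.\<close>

lemma fluctuation_step:
  assumes "n < N" and hu: "\<And>e. convergent (\<lambda>k. u k n e)"
    and h\<rho>: "\<And>K. K \<in> M \<Longrightarrow> (\<lambda>k. \<rho> k n K) \<longlonglongrightarrow> 1"
  shows "convergent (\<lambda>k. \<pi> k (Suc n) K)"
proof (cases "K \<in> M")
  case True
  let ?S = "\<lambda>k K. \<Sum>i\<in>UNIV. \<Sum>s\<in>UNIV. diffusion_flux (\<pi> k (Suc n)) K i s"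
  obtain c :: real where c: "0 \<le> c"
    "\<And>q b K L. \<lbrakk>\<And>K. K \<in> M \<Longrightarrow> \<bar>\<Sum>i\<in>UNIV. \<Sum>s\<in>UNIV. diffusion_flux q K i s\<bar> \<le> b; 0 \<le> b; K \<in> M; L \<in> M\<rbrakk>
       \<Longrightarrow> \<bar>q K - q L\<bar> \<le> c * b"
    using poisson_stability by blast
  obtain w where w: "\<And>K. 0 \<le> w K" "(\<Sum>K\<in>M. w K) = 1"
    "\<And>q. (\<integral>x. cell_fun q x \<partial>lebesgue_on \<Omega>) / measure lebesgue \<Omega> = (\<Sum>K\<in>M. w K * q K)"
    using mean_weights by blast
  have mean_zero: "(\<Sum>L\<in>M. w L * \<pi> k (Suc n) L) = 0" for k
  proof -
    have "(\<Sum>L\<in>M. w L * \<pi> k (Suc n) L) = (\<Sum>L\<in>M. w L * (P k (Suc n) L - (\<Sum>K\<in>M. w K * P k (Suc n) K))) / (\<epsilon> k)\<^sup>2"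
      by (simp add: pressure_fluct_def w(3) sum_divide_distrib)
    also have "(\<Sum>L\<in>M. w L * (P k (Suc n) L - (\<Sum>K\<in>M. w K * P k (Suc n) K))) = 0"
      by (simp add: right_diff_distrib sum_subtractf sum_distrib_right[symmetric] w(2))
    finally show ?thesis by simp
  qed
  have diff: "\<bar>\<pi> k (Suc n) K - \<pi> l (Suc n) K\<bar> \<le> c * b"
    if "\<And>K. K \<in> M \<Longrightarrow> \<bar>?S k K - ?S l K\<bar> \<le> b" "0 \<le> b" for k l b
  proof -
    define q where "q = (\<lambda>K. \<pi> k (Suc n) K - \<pi> l (Suc n) K)"
    have "diffusion_flux q K i s = diffusion_flux (\<pi> k (Suc n)) K i s - diffusion_flux (\<pi> l (Suc n)) K i s" for K i s
      by (simp add: diffusion_flux_def q_def algebra_simps diff_divide_distrib add_divide_distrib)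
    then have osc: "\<bar>q K - q L\<bar> \<le> c * b" if "L \<in> M" for L
      using that \<open>K \<in> M\<close> \<open>0 \<le> b\<close> \<open>\<And>K. K \<in> M \<Longrightarrow> \<bar>?S k K - ?S l K\<bar> \<le> b\<close>
      by (intro c(2)) (simp_all add: sum_subtractf)
    have "(\<Sum>L\<in>M. w L * q L) = 0"
      using mean_zero[of k] mean_zero[of l] by (simp add: q_def right_diff_distrib sum_subtractf)
    \<comment> \<open>The weights sum to 1 and \<open>q\<close> has mean zero, which fixes the
      additive constant left open by \<open>osc\<close>.\<close>
    then have "q K = (\<Sum>L\<in>M. w L * (q K - q L))"
      using w(2) by (simp add: right_diff_distrib sum_subtractf sum_distrib_right[symmetric])
    then have "\<bar>q K\<bar> \<le> (\<Sum>L\<in>M. \<bar>w L * (q K - q L)\<bar>)" using sum_abs by metis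
    also have "\<dots> \<le> (\<Sum>L\<in>M. w L * (c * b))"
      using osc w(1) by (intro sum_mono) (auto simp: abs_mult intro!: mult_left_mono)
    also have "\<dots> = c * b" using w(2) by (simp add: sum_distrib_right[symmetric])
    finally show ?thesis by (simp add: q_def)
  qed
  have "Cauchy (\<lambda>k. \<pi> k (Suc n) K)"
  proof (rule metric_CauchyI)
    fix e :: real assume "0 < e"
    \<comment> \<open>\<open>c + 1\<close> in place of \<open>c\<close> avoids a division by zero
      when \<open>c = 0\<close>.\<close>
    define b where "b = e / (2 * (c + 1))"
    have "0 < b" using \<open>0 < e\<close> c(1) by (simp add: b_def)
    define l where "l L = lim (\<lambda>k. ?S k L)" for L
    have l: "(\<lambda>k. ?S k L) \<longlonglongrightarrow> l L" if "L \<in> M" for L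
      unfolding l_def using laplacian_convergent[OF assms(1) hu h\<rho> that]
      by (rule convergent_LIMSEQ_iff[THEN iffD1])
    have "eventually (\<lambda>k. \<forall>L\<in>M. dist (?S k L) (l L) < b / 2) sequentially"
      by (intro eventually_ball_finite ballI tendstoD l finite_mesh) (use \<open>0 < b\<close> in simp_all)
    then obtain k0 where k0: "\<And>k L. k \<ge> k0 \<Longrightarrow> L \<in> M \<Longrightarrow> dist (?S k L) (l L) < b / 2"
      unfolding eventually_sequentially by blast
    have "dist (\<pi> j (Suc n) K) (\<pi> k (Suc n) K) < e" if "j \<ge> k0" "k \<ge> k0" for j k
    proof -
      have "\<bar>?S j L - ?S k L\<bar> \<le> b" if "L \<in> M" for L
        using k0[OF \<open>j \<ge> k0\<close> that] k0[OF \<open>k \<ge> k0\<close> that] unfolding dist_real_def by linarith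
      then have "\<bar>\<pi> j (Suc n) K - \<pi> k (Suc n) K\<bar> \<le> c * b" using \<open>0 < b\<close> by (intro diff) auto
      also have "\<dots> < e" using \<open>0 < e\<close> c(1) by (simp add: b_def field_simps add_nonneg_pos)
      finally show ?thesis by (simp add: dist_real_def)
    qed
    then show "\<exists>k0. \<forall>j\<ge>k0. \<forall>k\<ge>k0. dist (\<pi> j (Suc n) K) (\<pi> k (Suc n) K) < e" by blast
  qed
  then show ?thesis by (simp add: Cauchy_convergent_iff)
next
  case False
  then show ?thesis by (simp add: pressure_fluct_def convergent_const)
qed

section \<open>Passage to the limit in the scheme\<close>

lemma tendsto_mass_flux:
  assumes "n < N" "K \<in> M"
    and ul: "\<And>e. (\<lambda>k. u k n e) \<longlonglongrightarrow> ul e" and \<pi>l: "\<And>K. K \<in> M \<Longrightarrow> (\<lambda>k. \<pi> k (Suc n) K) \<longlonglongrightarrow> \<pi>l K"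
    and h\<rho>: "\<And>K. K \<in> M \<Longrightarrow> (\<lambda>k. \<rho> k (Suc n) K) \<longlonglongrightarrow> 1"
  shows "(\<lambda>k. mass_flux k n i (face K i s) K) \<longlonglongrightarrow>
    flux (\<lambda>_. 1) ul (\<lambda>e. \<eta> * \<delta>t * grad \<pi>l e) i (face K i s) K"
  unfolding vel_corr_eq
  by (rule tendsto_flux[OF assms(2)]) (intro h\<rho> ul \<pi>l tendsto_mult_left tendsto_grad | assumption)+

text \<open>The momentum balance is solved for the new velocity; the dual density by which it is
  divided is positive and tends to 1.\<close>

lemma velocity_step:
  assumes "n < N" "\<And>e. convergent (\<lambda>k. u k n e)" "\<And>K. K \<in> M \<Longrightarrow> (\<lambda>k. \<rho> k n K) \<longlonglongrightarrow> 1"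
  shows "convergent (\<lambda>k. u k (Suc n) e)"
proof -
  obtain i \<sigma> where e: "e = (i, \<sigma>)" by (cases e)
  show ?thesis
  proof (cases "\<sigma> \<in> int_edges i")
    case True
    define ul where "ul e = lim (\<lambda>k. u k n e)" for e
    define \<pi>l where "\<pi>l K = lim (\<lambda>k. \<pi> k (Suc n) K)" for K
    have ul: "(\<lambda>k. u k n e) \<longlonglongrightarrow> ul e" for e unfolding ul_def using assms(2) convergent_LIMSEQ_iff by blast
    have \<pi>l: "(\<lambda>k. \<pi> k (Suc n) K) \<longlonglongrightarrow> \<pi>l K" for K
      unfolding \<pi>l_def using fluctuation_step[OF assms] by (simp add: convergent_LIMSEQ_iff)
    note h\<rho> = density_step[OF assms]
    let ?d = "\<lambda>k n. dual_value (\<rho> k n) i \<sigma>"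
    let ?c = "\<lambda>k. convection (mass_flux k n) (u k n) i \<sigma>"
    have d: "0 < ?d k (Suc n)" for k
    proof -
      obtain K where "(K, i, True) \<in> ifaces" "\<sigma> = face K i True" using int_edge_iface[OF True] .
      then show ?thesis using dual_value_pos density_pos assms(1) by simp
    qed
    have "u k (Suc n) e = (?d k n * u k n e - \<delta>t * (?c k + grad (\<pi> k (Suc n)) e)) / ?d k (Suc n)" for k
    proof -
      have "(?d k (Suc n) * u k (Suc n) e - ?d k n * u k n e) / \<delta>t + ?c k + grad (\<pi> k (Suc n)) e = 0"
        using momentum_balance[OF assms(1) True, of k] unfolding grad_pressure e .
      then show ?thesis using d[of k] \<delta>t by (simp add: field_simps)
    qed
    moreover have "(\<lambda>k. (?d k n * u k n e - \<delta>t * (?c k + grad (\<pi> k (Suc n)) e)) / ?d k (Suc n)) \<longlonglongrightarrow>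
       (1 * ul e - \<delta>t * (convection (flux (\<lambda>_. 1) ul (\<lambda>e. \<eta> * \<delta>t * grad \<pi>l e)) ul i \<sigma> + grad \<pi>l e)) / 1"
      by (intro tendsto_divide tendsto_diff tendsto_add tendsto_mult tendsto_const tendsto_dual_value
          tendsto_convection tendsto_mass_flux tendsto_grad ul \<pi>l h\<rho> assms True | simp)+
    ultimately show ?thesis unfolding convergent_def by auto
  next
    case False
    then have "u k (Suc n) e = 0" for k using velocity_space[of "Suc n" k] assms(1) by (simp add: H_E0_def e)
    then show ?thesis by (simp add: convergent_const)
  qed
qed

text \<open>The fluctuation stays out of the induction hypothesis: the step from level
  \<open>n\<close> uses only \<open>\<rho>\<close> and \<open>u\<close> there, so a blow-up of
  \<open>\<pi>\<close> at level 0 does no harm.\<close>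

lemma density_limit_velocity_convergent:
  assumes "n \<le> N"
  shows "(\<forall>K\<in>M. (\<lambda>k. \<rho> k n K) \<longlonglongrightarrow> 1) \<and> (\<forall>e. convergent (\<lambda>k. u k n e))"
  using assms
proof (induction n)
  case 0
  then show ?case using initial_density initial_velocity by simp
next
  case (Suc n)
  then have "n < N" "\<And>e. convergent (\<lambda>k. u k n e)" "\<And>K. K \<in> M \<Longrightarrow> (\<lambda>k. \<rho> k n K) \<longlonglongrightarrow> 1" by auto
  from density_step[OF this] velocity_step[OF this] show ?case by blast
qed

text \<open>Solvability of the limit scheme is a by-product: the limits exist by induction, and the
  equations pass to the limit term by term.\<close>

lemma converges_to_limit_scheme:
  "\<exists>ul \<pi>l. discrete_convergence N u \<pi> ul \<pi>l \<and> limit_solution \<eta> \<delta>t N ul \<pi>l"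
proof -
  define ul where "ul n e = lim (\<lambda>k. u k n e)" for n e
  \<comment> \<open>The fluctuation at level 0 may diverge and is constrained by no equation; 0 is a
    default value in \<open>L_M\<close>.\<close>
  define \<pi>l where "\<pi>l n K = (if n = 0 then 0 else lim (\<lambda>k. \<pi> k n K))" for n K
  have \<rho>lim: "(\<lambda>k. \<rho> k n K) \<longlonglongrightarrow> 1" if "n \<le> N" "K \<in> M" for n K using density_limit_velocity_convergent that by blast
  have ul: "(\<lambda>k. u k n e) \<longlonglongrightarrow> ul n e" if "n \<le> N" for n e
    unfolding ul_def using density_limit_velocity_convergent[OF that] convergent_LIMSEQ_iff by blast
  have \<pi>l: "(\<lambda>k. \<pi> k (Suc n) K) \<longlonglongrightarrow> \<pi>l (Suc n) K" if "n < N" for n K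
  proof -
    have "convergent (\<lambda>k. \<pi> k (Suc n) K)"
      using density_limit_velocity_convergent[of n] that by (intro fluctuation_step) auto
    then show ?thesis by (simp add: \<pi>l_def convergent_LIMSEQ_iff)
  qed
  have ul_space: "ul n \<in> H_E0" if "n \<le> N" for n
    unfolding ul_def H_E0_def using velocity_space[OF that] by (auto simp: H_E0_def)
  have \<pi>_space: "\<pi> k n \<in> L_M" for k n by (simp add: L_M_def pressure_fluct_def)
  have \<pi>l_space: "\<pi>l n \<in> L_M" for n
    by (auto simp: L_M_def \<pi>l_def pressure_fluct_def)
  have H: "H_E0 = {w. \<forall>e. e \<notin> Sigma UNIV int_edges \<longrightarrow> w e = 0}" by (auto simp: H_E0_def)
  have "(\<lambda>k. nrm (\<lambda>e. u k n e - ul n e)) \<longlonglongrightarrow> 0" if "norm_on H_E0 nrm" "n \<le> N" for nrm n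
  proof (rule norm_on_tendsto_zero[OF that(1)[unfolded H]])
    show "finite (Sigma UNIV int_edges)" using finite_int_edges by auto
    show "u k n e - ul n e = 0" if "e \<notin> Sigma UNIV int_edges" for k e
      using velocity_space[OF \<open>n \<le> N\<close>, of k] ul_space[OF \<open>n \<le> N\<close>] that by (cases e) (simp add: H_E0_def)
    show "(\<lambda>k. u k n e - ul n e) \<longlonglongrightarrow> 0" for e using ul[OF \<open>n \<le> N\<close>] by (simp add: LIM_zero)
  qed
  moreover have "(\<lambda>k. nrm (\<lambda>K. \<pi> k n K - \<pi>l n K)) \<longlonglongrightarrow> 0" if nrm: "norm_on L_M nrm" and n: "n \<in> {1..N}" for nrm n
  proof -
    obtain m where m: "n = Suc m" "m < N" using n by (cases n) auto
    show ?thesis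
    proof (rule norm_on_tendsto_zero[OF nrm[unfolded L_M_def] finite_mesh])
      show "\<pi> k n K - \<pi>l n K = 0" if "K \<notin> M" for k K
        using \<pi>_space[of k n] \<pi>l_space[of n] that by (simp add: L_M_def)
      show "(\<lambda>k. \<pi> k n K - \<pi>l n K) \<longlonglongrightarrow> 0" for K using \<pi>l[OF m(2)] m(1) by (simp add: LIM_zero)
    qed
  qed
  ultimately have conv: "discrete_convergence N u \<pi> ul \<pi>l" by (auto simp: discrete_convergence_def)
  have "limit_solution \<eta> \<delta>t N ul \<pi>l"
    unfolding limit_solution_def Let_def
  proof (intro conjI allI impI ballI)
    fix n assume n: "n < N"
    let ?\<delta> = "\<lambda>e. \<eta> * \<delta>t * grad (\<pi>l (Suc n)) e"
    let ?F = "flux (\<lambda>_. 1) (ul n) ?\<delta>"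
    have F: "(\<lambda>k. mass_flux k n i (face K i s) K) \<longlonglongrightarrow> ?F i (face K i s) K" if "K \<in> M" for K i s
      using n that by (intro tendsto_mass_flux ul \<pi>l \<rho>lim) auto
    show "div_M (\<lambda>e. ul n e - ?\<delta> e) K = 0" if K: "K \<in> M" for K
    proof -
      \<comment> \<open>The total flux has two limits, one computed face by face and one from the
        mass balance; their equality is the divergence constraint.\<close>
      have "(\<lambda>k. \<Sum>i\<in>UNIV. \<Sum>s\<in>UNIV. mass_flux k n i (face K i s) K) \<longlonglongrightarrow> (\<Sum>i\<in>UNIV. \<Sum>s\<in>UNIV. ?F i (face K i s) K)"
        by (intro tendsto_sum F K)
      moreover have "(\<lambda>k. \<Sum>i\<in>UNIV. \<Sum>s\<in>UNIV. mass_flux k n i (face K i s) K) \<longlonglongrightarrow> measure lebesgue K * (1 - 1) / \<delta>t"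
        unfolding total_flux[OF n K] by (intro tendsto_intros \<rho>lim) (use n K \<delta>t in auto)
      ultimately have "(\<Sum>i\<in>UNIV. \<Sum>s\<in>UNIV. ?F i (face K i s) K) = 0"
        using LIMSEQ_unique by fastforce
      moreover have "?F i (face K i s) K = area i (face K i s) * outward (\<lambda>e. ul n e - ?\<delta> e) i (face K i s) K" for i s
        using n by (intro flux_one K ul_space scale_in_H_E0 grad_in_H_E0) simp
      ultimately show ?thesis by (simp add: div_M_def)
    qed
    show "(ul (Suc n) (i, \<sigma>) - ul n (i, \<sigma>)) / \<delta>t + convection ?F (ul n) i \<sigma> + grad (\<pi>l (Suc n)) (i, \<sigma>) = 0"
      if \<sigma>: "\<sigma> \<in> int_edges i" for i \<sigma>
    proof -
      have "(\<lambda>k. (dual_value (\<rho> k (Suc n)) i \<sigma> * u k (Suc n) (i, \<sigma>) - dual_value (\<rho> k n) i \<sigma> * u k n (i, \<sigma>)) / \<delta>t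
          + convection (mass_flux k n) (u k n) i \<sigma> + grad (\<pi> k (Suc n)) (i, \<sigma>)) \<longlonglongrightarrow>
        (1 * ul (Suc n) (i, \<sigma>) - 1 * ul n (i, \<sigma>)) / \<delta>t + convection ?F (ul n) i \<sigma> + grad (\<pi>l (Suc n)) (i, \<sigma>)"
        using n \<delta>t
        by (intro tendsto_divide tendsto_diff tendsto_add tendsto_mult tendsto_const tendsto_dual_value
            tendsto_convection F tendsto_grad ul \<pi>l \<rho>lim \<sigma>) auto
      then show ?thesis
        using momentum_balance[OF n \<sigma>] LIMSEQ_unique[OF tendsto_const] unfolding grad_pressure by fastforce
    qed
  qed (use ul_space \<pi>l_space in auto)
  with conv show ?thesis by blast
qed

end

section \<open>Subsequences and the convergence theorem\<close>

lemma LIMSEQ_subsequenceI: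
  fixes f :: "nat \<Rightarrow> 'a::metric_space"
  assumes "\<And>r :: nat \<Rightarrow> nat. strict_mono r \<Longrightarrow> \<exists>s :: nat \<Rightarrow> nat. strict_mono s \<and> (\<lambda>k. f (r (s k))) \<longlonglongrightarrow> l"
  shows "f \<longlonglongrightarrow> l"
proof (rule ccontr)
  assume "\<not> f \<longlonglongrightarrow> l"
  then obtain e where e: "0 < e" "\<And>k0. \<exists>k\<ge>k0. e \<le> dist (f k) l"
    unfolding lim_sequentially by (meson not_le)
  \<comment> \<open>Enumerating these indices gives a subsequence none of whose subsequences can
    tend to \<open>l\<close>.\<close>
  then have "infinite {k. e \<le> dist (f k) l}"
    unfolding infinite_nat_iff_unbounded_le by auto
  then obtain r :: "nat \<Rightarrow> nat" where r: "strict_mono r" "\<And>k. r k \<in> {k. e \<le> dist (f k) l}"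
    using infinite_enumerate by blast
  obtain s :: "nat \<Rightarrow> nat" where "strict_mono s" "(\<lambda>k. f (r (s k))) \<longlonglongrightarrow> l"
    using assms[OF r(1)] by blast
  then have "eventually (\<lambda>k. dist (f (r (s k))) l < e) sequentially" using e(1) by (intro tendstoD)
  then obtain k where "dist (f (r (s k))) l < e" by (auto simp: eventually_sequentially)
  then show False using r(2)[of "s k"] by simp
qed

text \<open>The subsequence is refined one coordinate at a time; convergence already achieved
  survives each refinement.\<close>

lemma simultaneously_convergent_subsequence:
  fixes f :: "nat \<Rightarrow> 'a \<Rightarrow> real"
  assumes "finite S" "\<And>x. x \<in> S \<Longrightarrow> bounded (range (\<lambda>k. f k x))"
  shows "\<exists>r :: nat \<Rightarrow> nat. strict_mono r \<and> (\<forall>x\<in>S. convergent (\<lambda>k. f (r k) x))"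
  using assms
proof (induction S)
  case empty
  show ?case by (intro exI[of _ id]) (auto simp: strict_mono_def)
next
  case (insert x S)
  then obtain r :: "nat \<Rightarrow> nat" where r: "strict_mono r" "\<And>x. x \<in> S \<Longrightarrow> convergent (\<lambda>k. f (r k) x)" by auto
  have "bounded (range (\<lambda>k. f (r k) x))"
    using insert.prems[of x] by (rule bounded_subset) auto
  then obtain l and s :: "nat \<Rightarrow> nat" where s: "strict_mono s" "((\<lambda>k. f (r k) x) \<circ> s) \<longlonglongrightarrow> l"
    using bounded_imp_convergent_subsequence by blast
  have "convergent (\<lambda>k. f ((r \<circ> s) k) y)" if "y \<in> insert x S" for y
  proof (cases "y = x")
    case True
    then show ?thesis using s(2) by (auto simp: convergent_def o_def)
  next
    case False
    then show ?thesis using convergent_subseq_convergent[OF r(2) s(1)] that by (simp add: o_def)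
  qed
  then show ?case using strict_mono_o[OF r(1) s(1)] by blast
qed

text \<open>Ill-prepared initial velocities are bounded but may oscillate in \<open>k\<close>, and
  \<open>discrete_convergence\<close> includes their level 0. So velocities and fluctuations
  converge along a subsequence in general, and as a whole once the initial velocities do. The
  densities need no such distinction, their limit being always 1.\<close>

theorem theorem6p4:
  fixes \<Omega> :: "(real^'d) set" and M :: "(real^'d) set set"
    and \<gamma> \<eta> T \<delta>t C :: real and N :: nat
    and \<epsilon> :: "nat \<Rightarrow> real"
    and \<rho>0 :: "nat \<Rightarrow> real^'d \<Rightarrow> real" and u0 :: "nat \<Rightarrow> real^'d \<Rightarrow> real^'d"
    and \<rho> :: "nat \<Rightarrow> nat \<Rightarrow> (real^'d) set \<Rightarrow> real"
    and u :: "nat \<Rightarrow> nat \<Rightarrow> 'd \<times> (real^'d) set \<Rightarrow> real"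
    and \<pi> :: "nat \<Rightarrow> nat \<Rightarrow> (real^'d) set \<Rightarrow> real"
  assumes grid: "mac_grid \<Omega> M"
    and "\<gamma> \<ge> 1" "\<eta> > 0" "T > 0" "N \<ge> 1" "\<delta>t = T / real N"
    and "\<And>k. 0 < \<epsilon> k \<and> \<epsilon> k \<le> 1" "\<epsilon> \<longlonglongrightarrow> 0"
    and "\<And>k. in_Linf (lebesgue_on \<Omega>) (\<rho>0 k)"
    and "\<And>k i. in_Linf (lebesgue_on \<Omega>) (\<lambda>x. u0 k x $ i)"
    and "\<And>k. AE x in lebesgue_on \<Omega>. \<rho>0 k x > 0"
    and "C > 0"
    and ill_prepared:
      "\<And>k. ereal (Lp_norm (lebesgue_on \<Omega>) 2 (\<lambda>x. norm (u0 k x)))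
            + ereal (1 / \<epsilon> k) * Linf_norm (lebesgue_on \<Omega>) (\<lambda>x. \<rho>0 k x - 1) \<le> ereal C"
    and solution: "\<And>k. mac_grid.numerical_solution \<Omega> M \<gamma> \<eta> (\<epsilon> k) \<delta>t N (\<rho>0 k) (u0 k) (\<rho> k) (u k)"
    and positive: "\<And>k n K. n \<le> N \<Longrightarrow> K \<in> M \<Longrightarrow> \<rho> k n K > 0"
    and stable: "\<And>k. mac_grid.stability_conditions \<Omega> M \<gamma> \<eta> (\<epsilon> k) \<delta>t N (\<rho> k) (u k)"
    and \<pi>_def: "\<And>k n. \<pi> k n = mac_grid.pressure_fluct \<Omega> M \<gamma> (\<epsilon> k) (\<rho> k n)"
  shows "((\<lambda>k. mac_grid.Linf_Lp_dist \<Omega> M T \<delta>t \<gamma> (\<rho> k) 1) \<longlonglongrightarrow> 0) \<and>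
         (\<exists>r. strict_mono r \<and>
           (\<exists>ul \<pi>l. mac_grid.discrete_convergence \<Omega> M N (u \<circ> r) (\<pi> \<circ> r) ul \<pi>l \<and>
                    mac_grid.limit_solution \<Omega> M \<eta> \<delta>t N ul \<pi>l)) \<and>
         ((\<forall>i. \<forall>\<sigma>\<in>mac_grid.int_edges \<Omega> M i. convergent (\<lambda>k. u k 0 (i, \<sigma>))) \<longrightarrow>
           (\<exists>ul \<pi>l. mac_grid.discrete_convergence \<Omega> M N u \<pi> ul \<pi>l \<and>
                    mac_grid.limit_solution \<Omega> M \<eta> \<delta>t N ul \<pi>l))"
proof -
  interpret mac_grid \<Omega> M by (rule grid)
  have \<epsilon>_pos: "0 < \<epsilon> k" for k using assms(7) by blast
  have "0 < \<delta>t" using assms(4-6) by simp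
  have sol: "\<And>n. n \<le> N \<Longrightarrow> u k n \<in> H_E0" "\<And>K. K \<in> M \<Longrightarrow> \<rho> k 0 K = mean_over K (\<rho>0 k)"
    "\<And>i \<sigma>. \<sigma> \<in> int_edges i \<Longrightarrow> u k 0 (i, \<sigma>) = mean_over (dual_cell i \<sigma>) (\<lambda>x. u0 k x $ i)" for k
    using solution[of k] unfolding numerical_solution_def by blast+
  \<comment> \<open>Positive measure of the domain makes the essential supremum nonnegative, so the
    bound on the data splits into two separate bounds.\<close>
  have "emeasure (lebesgue_on \<Omega>) (space (lebesgue_on \<Omega>)) \<noteq> 0"
  proof
    assume "emeasure (lebesgue_on \<Omega>) (space (lebesgue_on \<Omega>)) = 0"
    then have "measure (lebesgue_on \<Omega>) (space (lebesgue_on \<Omega>)) = 0" unfolding measure_def by simp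
    then show False using domain_measure_pos domain_lmeasurable by (simp add: measure_restrict_space)
  qed
  then have Linf_nonneg: "0 \<le> Linf_norm (lebesgue_on \<Omega>) (\<lambda>x. \<rho>0 k x - 1)" for k by (rule Linf_norm_nonneg)
  have L2_bound: "Lp_norm (lebesgue_on \<Omega>) 2 (\<lambda>x. norm (u0 k x)) \<le> C"
    and Linf_bound: "Linf_norm (lebesgue_on \<Omega>) (\<lambda>x. \<rho>0 k x - 1) \<le> ereal (C * \<epsilon> k)" for k
  proof -
    let ?a = "Lp_norm (lebesgue_on \<Omega>) 2 (\<lambda>x. norm (u0 k x))"
    have "0 \<le> ?a" by (simp add: Lp_norm_def)
    have le: "ereal ?a + ereal (1 / \<epsilon> k) * Linf_norm (lebesgue_on \<Omega>) (\<lambda>x. \<rho>0 k x - 1) \<le> ereal C"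
      by (rule ill_prepared)
    have "?a \<le> C \<and> Linf_norm (lebesgue_on \<Omega>) (\<lambda>x. \<rho>0 k x - 1) \<le> ereal (C * \<epsilon> k)"
    proof (cases "Linf_norm (lebesgue_on \<Omega>) (\<lambda>x. \<rho>0 k x - 1)")
      case (real b)
      then have "?a + b / \<epsilon> k \<le> C" "0 \<le> b" using le Linf_nonneg[of k] by auto
      then have "?a \<le> C" "b / \<epsilon> k \<le> C" using \<open>0 \<le> ?a\<close> \<epsilon>_pos[of k]
        by (auto intro: order_trans[rotated])
      then show ?thesis using real \<epsilon>_pos[of k] by (simp add: field_simps)
    next
      case PInf
      then show ?thesis using le \<epsilon>_pos[of k] by simp
    next
      case MInf
      then show ?thesis using Linf_nonneg[of k] by simp
    qed
    then show "?a \<le> C" "Linf_norm (lebesgue_on \<Omega>) (\<lambda>x. \<rho>0 k x - 1) \<le> ereal (C * \<epsilon> k)" by auto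
  qed
  have initial_density: "(\<lambda>k. \<rho> k 0 K) \<longlonglongrightarrow> 1" if K: "K \<in> M" for K
  proof -
    have "\<bar>\<rho> k 0 K - 1\<bar> \<le> C * \<epsilon> k" for k
      unfolding sol(2)[OF K]
    proof (rule mean_over_close)
      show "AE x in lebesgue_on \<Omega>. \<bar>\<rho>0 k x - 1\<bar> \<le> C * \<epsilon> k"
        using AE_Linf_norm[of "\<lambda>x. \<rho>0 k x - 1" "lebesgue_on \<Omega>"]
        by eventually_elim (use Linf_bound[of k] in \<open>metis ereal_less_eq(3) order_trans\<close>)
    qed (use assms(9) measure_cell_domain_pos[OF K] closed_cell[OF K] in \<open>auto simp: in_Linf_def\<close>)
    then have "\<forall>\<^sub>F k in sequentially. norm (\<rho> k 0 K - 1) \<le> C * \<epsilon> k" by simp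
    moreover have "(\<lambda>k. C * \<epsilon> k) \<longlonglongrightarrow> 0" using tendsto_mult_right_zero[OF assms(8)] .
    ultimately have "(\<lambda>k. \<rho> k 0 K - 1) \<longlonglongrightarrow> 0" by (rule Lim_null_comparison)
    then show ?thesis by (simp add: LIM_zero_iff)
  qed
  have convergent_if_internal: "convergent (\<lambda>k. u (r k) 0 e)"
    if "\<And>e. e \<in> Sigma UNIV int_edges \<Longrightarrow> convergent (\<lambda>k. u (r k) 0 e)" for e and r :: "nat \<Rightarrow> nat"
  proof (cases "e \<in> Sigma UNIV int_edges")
    case False
    then have "u (r k) 0 e = 0" for k using sol(1)[of 0 "r k"] by (cases e) (auto simp: H_E0_def)
    then show ?thesis by (simp add: convergent_const)
  qed (rule that)
  \<comment> \<open>The interpretation already supplies the grid axioms, so the goals below are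
    numbered by the locale's own assumptions in their order.\<close>
  have subsequence: "low_mach_sequence \<Omega> M \<gamma> \<eta> \<delta>t N (\<lambda>k. \<epsilon> (r k)) (\<lambda>k. \<rho> (r k)) (\<lambda>k. u (r k))"
    if r: "strict_mono r" and conv: "\<And>e. e \<in> Sigma UNIV int_edges \<Longrightarrow> convergent (\<lambda>k. u (r k) 0 e)" for r
  proof (unfold_locales, goal_cases)
    case (5)
    show ?case using LIMSEQ_subseq_LIMSEQ[OF assms(8) r] by (simp add: o_def)
  next
    case (8 k n K)
    then show ?case using solution[of "r k"] unfolding numerical_solution_def Let_def by blast
  next
    case (9 k n i \<sigma>)
    then show ?case using solution[of "r k"] unfolding numerical_solution_def Let_def by blast
  next
    case (10 k n i \<sigma>)
    then show ?case using stable[of "r k"] unfolding stability_conditions_def Let_def by blast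
  next
    case (11 K)
    then show ?case using LIMSEQ_subseq_LIMSEQ[OF initial_density r] by (simp add: o_def)
  next
    case (12 e)
    show ?case by (rule convergent_if_internal[OF conv])
  qed (use assms(2,3) \<open>0 < \<delta>t\<close> \<epsilon>_pos sol(1) positive in auto)
  have fin: "finite (Sigma UNIV int_edges)" using finite_int_edges by auto
  have bd: "bounded (range (\<lambda>k. u k 0 e))" if mem: "e \<in> Sigma UNIV int_edges" for e
  proof -
    obtain i \<sigma> where e: "e = (i, \<sigma>)" "\<sigma> \<in> int_edges i" using mem by (cases e) auto
    have "norm (u k 0 e) \<le> (measure lebesgue \<Omega> + C\<^sup>2) / measure lebesgue (dual_cell i \<sigma> \<inter> \<Omega>)" for k
      unfolding e(1) sol(3)[OF e(2)] real_norm_def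
      by (rule mean_over_bounded[OF dual_cell_sets[OF e(2)] assms(10) L2_bound])
    then show ?thesis by (auto simp: bounded_iff)
  qed
  have subseq_conv: "\<exists>s :: nat \<Rightarrow> nat. strict_mono s \<and> (\<forall>e\<in>Sigma UNIV int_edges. convergent (\<lambda>k. u (r (s k)) 0 e))"
    for r :: "nat \<Rightarrow> nat"
  proof (rule simultaneously_convergent_subsequence[OF fin, where f = "\<lambda>k. u (r k) 0"])
    fix e assume mem: "e \<in> Sigma UNIV int_edges"
    have "range (\<lambda>k. u (r k) 0 e) \<subseteq> range (\<lambda>k. u k 0 e)" by auto
    with bd[OF mem] show "bounded (range (\<lambda>k. u (r k) 0 e))" by (rule bounded_subset)
  qed
  \<comment> \<open>Every subsequence has a further one with convergent initial velocities, along
    which the densities tend to 1.\<close>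
  have "(\<lambda>k. \<rho> k n K) \<longlonglongrightarrow> 1" if "n < N" "K \<in> M" for n K
  proof (rule LIMSEQ_subsequenceI)
    fix r :: "nat \<Rightarrow> nat" assume r: "strict_mono r"
    obtain s where s: "strict_mono s" "\<forall>e\<in>Sigma UNIV int_edges. convergent (\<lambda>k. u (r (s k)) 0 e)"
      using subseq_conv[of r] by (elim exE conjE)
    interpret low_mach_sequence \<Omega> M \<gamma> \<eta> \<delta>t N "\<lambda>k. \<epsilon> (r (s k))" "\<lambda>k. \<rho> (r (s k))" "\<lambda>k. u (r (s k))"
      using subsequence[of "r \<circ> s"] strict_mono_o[OF r s(1)] s(2) by (simp add: o_def)
    show "\<exists>s. strict_mono s \<and> (\<lambda>k. \<rho> (r (s k)) n K) \<longlonglongrightarrow> 1"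
      using s(1) density_limit_velocity_convergent[of n] that by auto
  qed
  then have density: "(\<lambda>k. Linf_Lp_dist T \<delta>t \<gamma> (\<rho> k) 1) \<longlonglongrightarrow> 0"
    by (rule Linf_Lp_dist_tendsto_zero[OF assms(4-6,2)])
  have limit: "\<exists>ul \<pi>l. discrete_convergence N (u \<circ> r) (\<pi> \<circ> r) ul \<pi>l \<and> limit_solution \<eta> \<delta>t N ul \<pi>l"
    if r: "strict_mono r" and conv: "\<And>e. e \<in> Sigma UNIV int_edges \<Longrightarrow> convergent (\<lambda>k. u (r k) 0 e)" for r
  proof -
    have "u \<circ> r = (\<lambda>k. u (r k))" "\<pi> \<circ> r = (\<lambda>k n. pressure_fluct \<gamma> (\<epsilon> (r k)) (\<rho> (r k) n))"
      by (simp_all add: fun_eq_iff \<pi>_def)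
    then show ?thesis
      using low_mach_sequence.converges_to_limit_scheme[OF subsequence[OF r conv]] by simp
  qed
  obtain r where "strict_mono r" "\<forall>e\<in>Sigma UNIV int_edges. convergent (\<lambda>k. u (r k) 0 e)"
    using subseq_conv[of "\<lambda>k. k"] by (elim exE conjE)
  then have "\<exists>r. strict_mono r \<and> (\<exists>ul \<pi>l. discrete_convergence N (u \<circ> r) (\<pi> \<circ> r) ul \<pi>l \<and> limit_solution \<eta> \<delta>t N ul \<pi>l)"
    using limit by blast
  moreover have "\<exists>ul \<pi>l. discrete_convergence N u \<pi> ul \<pi>l \<and> limit_solution \<eta> \<delta>t N ul \<pi>l"
    if "\<forall>i. \<forall>\<sigma>\<in>int_edges i. convergent (\<lambda>k. u k 0 (i, \<sigma>))"
    using limit[of id] that by (auto simp: strict_mono_def)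
  ultimately show ?thesis using density by blast
qed

end
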